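(* Let $G$ be a connected real linear reductive Lie group and $H$ a closed subgroup of $G$. Then any discrete subgroup $\Gamma$ of $G$ acting properly discontinuously and cocompactly on $G/H$ (by left multiplication) is finitely generated and sharply embedded in $G$ with respect to $H$. In particular (Sharpness Conjecture for $G/H$) the action of any such $\Gamma$ on $G/H$ is sharp.
   Context: Let $K$ be a maximal compact subgroup of $G$ (the fixed points of a Cartan involution), $\mathfrak g=\mathfrak k+\mathfrak p$ the corresponding Cartan decomposition of the Lie algebra, $\mathfrak a$ a maximal abelian subspace of $\mathfrak p$, and $\mathfrak a^+\subset\mathfrak a$ a closed positive Weyl chamber. The Cartan projection $\mu:G\to\mathfrak a^+$ sends $g$ to the unique element of $\mathfrak a^+$ with $g\in K\exp(\mu(g))K$. Fix a Euclidean norm $\|\cdot\|$ on $\mathfrak a$ with associated distance function $d_{\mathfrak a}$. Sharp: the action of a discrete subgroup $\Gamma$ of $G$ on $G/H$ is sharp if there exist $c,c'>0$ such that $d_{\mathfrak a}(\mu(\gamma),\mu(H))\ge c\,\|\mu(\gamma)\|-c'$ for all $\gamma\in\Gamma$. Sharply embedded: a finitely generated discrete subgroup $\Gamma$, with finite generating subset $S$ and associated word length function $|\cdot|_S$, is sharply embedded in $G$ with respect to $H$ if there exist $c,c'>0$ such that $d_{\mathfrak a}(\mu(\gamma),\mu(H))\ge c\,|\gamma|_S-c'$ for all $\gamma\in\Gamma$ (this does not depend on $S$). *)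

theory Defs
  imports
    "HOL-Analysis.Analysis"
    "HOL-Algebra.Generated_Groups"
    "HOL-Algebra.Group_Action"
begin

section \<open>Linear groups\<close>

definition matgrp :: "(real^'n^'n) set \<Rightarrow> (real^'n^'n) monoid" where
  "matgrp G = \<lparr>carrier = G, mult = (**), one = mat 1\<rparr>"

definition GL :: "(real^'n^'n) set" where
  "GL = {g. invertible g}"

lemma group_GL: "group (matgrp GL)"
proof (rule groupI)
  fix x :: "real^'n^'n"
  assume "x \<in> carrier (matgrp GL)"
  then obtain y where "x ** y = mat 1" "y ** x = mat 1"
    by (auto simp: matgrp_def GL_def invertible_def)
  then show "\<exists>y\<in>carrier (matgrp GL). y \<otimes>\<^bsub>matgrp GL\<^esub> x = \<one>\<^bsub>matgrp GL\<^esub>"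
    by (auto simp: matgrp_def GL_def invertible_def)
qed (auto simp: matgrp_def GL_def invertible_mult matrix_mul_assoc invertible_def[of "mat 1"])

definition inner_product :: "('v::real_vector \<Rightarrow> 'v \<Rightarrow> real) \<Rightarrow> bool" where
  "inner_product B \<longleftrightarrow>
     bilinear B \<and> (\<forall>x y. B x y = B y x) \<and> (\<forall>x. x \<noteq> 0 \<longrightarrow> B x x > 0)"

text \<open>
  A Cartan involution of a linear group \<open>G\<close> is a map \<open>g \<mapsto> (g\<^sup>*)\<^sup>-\<^sup>1\<close>, the adjoint being taken
  with respect to an inner product on the space on which \<open>G\<close> acts, which maps \<open>G\<close> to itself.
  The last equation below says exactly that \<open>\<Theta> g\<close> is the inverse of the adjoint of \<open>g\<close>. The
  values of \<open>\<Theta>\<close> outside \<open>G\<close> are irrelevant.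
\<close>

definition cartan_involution ::
  "(real^'n^'n) set \<Rightarrow> (real^'n^'n \<Rightarrow> real^'n^'n) \<Rightarrow> bool" where
  "cartan_involution G \<Theta> \<longleftrightarrow>
     (\<exists>B :: real^'n \<Rightarrow> real^'n \<Rightarrow> real. inner_product B \<and>
        (\<forall>g\<in>G. \<Theta> g \<in> G \<and> (\<forall>v w. B (g *v v) (\<Theta> g *v w) = B v w)))"

text \<open>
  Linear reductive groups: closed subgroups of the general linear group which are self-adjoint
  (stable under \<open>g \<mapsto> g\<^sup>*\<close>) for some inner product, i.e. which, in a suitable basis, are stable
  under transposition. Connectedness is imposed separately.
\<close>

definition linear_reductive :: "(real^'n^'n) set \<Rightarrow> bool" where
  "linear_reductive G \<longleftrightarrow>
     subgroup G (matgrp GL) \<and> closedin (top_of_set GL) G \<and> (\<exists>\<Theta>. cartan_involution G \<Theta>)"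

section \<open>Cartan decomposition and Cartan projection\<close>

text \<open>The type \<open>real^'n^'n\<close> carries the componentwise product, so \<open>exp\<close> is not available.\<close>

definition mexp :: "real^'n^'n \<Rightarrow> real^'n^'n" where
  "mexp X = (\<Sum>k. (1 / fact k) *\<^sub>R (((**) X) ^^ k) (mat 1))"

definition lie_algebra :: "(real^'n^'n) set \<Rightarrow> (real^'n^'n) set" where
  "lie_algebra G = {X. \<forall>t::real. mexp (t *\<^sub>R X) \<in> G}"

definition lie_bracket :: "real^'n^'n \<Rightarrow> real^'n^'n \<Rightarrow> real^'n^'n" where
  "lie_bracket X Y = X ** Y - Y ** X"

definition cartan_K ::
  "(real^'n^'n) set \<Rightarrow> (real^'n^'n \<Rightarrow> real^'n^'n) \<Rightarrow> (real^'n^'n) set" where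
  "cartan_K G \<Theta> = {g \<in> G. \<Theta> g = g}"

text \<open>The subspace on which the differential of \<open>\<Theta>\<close> is \<open>-1\<close>.\<close>

definition cartan_p ::
  "(real^'n^'n) set \<Rightarrow> (real^'n^'n \<Rightarrow> real^'n^'n) \<Rightarrow> (real^'n^'n) set" where
  "cartan_p G \<Theta> =
     {X \<in> lie_algebra G. \<forall>t::real. \<Theta> (mexp (t *\<^sub>R X)) = mexp (- (t *\<^sub>R X))}"

definition abelian_subspace :: "(real^'n^'n) set \<Rightarrow> (real^'n^'n) set \<Rightarrow> bool" where
  "abelian_subspace P A \<longleftrightarrow>
     subspace A \<and> A \<subseteq> P \<and> (\<forall>X\<in>A. \<forall>Y\<in>A. lie_bracket X Y = 0)"

definition maximal_abelian_subspace :: "(real^'n^'n) set \<Rightarrow> (real^'n^'n) set \<Rightarrow> bool" where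
  "maximal_abelian_subspace P A \<longleftrightarrow>
     abelian_subspace P A \<and> (\<forall>A'. abelian_subspace P A' \<and> A \<subseteq> A' \<longrightarrow> A' = A)"

text \<open>
  Only the restriction of \<open>\<alpha>\<close> to \<open>A\<close> matters; it is automatically linear since the root
  space is nonzero.
\<close>

definition restricted_root ::
  "(real^'n^'n) set \<Rightarrow> (real^'n^'n) set \<Rightarrow> (real^'n^'n \<Rightarrow> real) \<Rightarrow> bool" where
  "restricted_root G A \<alpha> \<longleftrightarrow>
     (\<exists>X\<in>A. \<alpha> X \<noteq> 0) \<and>
     (\<exists>Y\<in>lie_algebra G. Y \<noteq> 0 \<and> (\<forall>X\<in>A. lie_bracket X Y = \<alpha> X *\<^sub>R Y))"

definition closed_weyl_chamber ::
  "(real^'n^'n) set \<Rightarrow> (real^'n^'n) set \<Rightarrow> (real^'n^'n) set \<Rightarrow> bool" where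
  "closed_weyl_chamber G A Ap \<longleftrightarrow>
     (\<exists>C \<in> components {X \<in> A. \<forall>\<alpha>. restricted_root G A \<alpha> \<longrightarrow> \<alpha> X \<noteq> 0}. Ap = closure C)"

definition cartan_projection ::
  "(real^'n^'n) set \<Rightarrow> (real^'n^'n \<Rightarrow> real^'n^'n) \<Rightarrow> (real^'n^'n) set
     \<Rightarrow> real^'n^'n \<Rightarrow> real^'n^'n" where
  "cartan_projection G \<Theta> Ap g =
     (THE X. X \<in> Ap \<and> (\<exists>k\<in>cartan_K G \<Theta>. \<exists>k'\<in>cartan_K G \<Theta>. g = k ** mexp X ** k'))"

text \<open>
  Every inner product on a subspace extends to the whole space, so this covers all Euclidean
  norms on \<open>A\<close>.
\<close>

definition euclidean_norm_on :: "'v::real_vector set \<Rightarrow> ('v \<Rightarrow> real) \<Rightarrow> bool" where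
  "euclidean_norm_on A N \<longleftrightarrow> (\<exists>B. inner_product B \<and> (\<forall>X\<in>A. N X = sqrt (B X X)))"

definition dist_to_set :: "('v::real_vector \<Rightarrow> real) \<Rightarrow> 'v \<Rightarrow> 'v set \<Rightarrow> real" where
  "dist_to_set N X S = (INF Y\<in>S. N (X - Y))"

section \<open>Actions on homogeneous spaces\<close>

definition quotient_topology :: "'a topology \<Rightarrow> ('a \<Rightarrow> 'b) \<Rightarrow> 'b topology" where
  "quotient_topology X f =
     topology (\<lambda>U. U \<subseteq> f ` topspace X \<and> openin X {x \<in> topspace X. f x \<in> U})"

lemma openin_quotient_topology:
  "openin (quotient_topology X f) U \<longleftrightarrow>
     U \<subseteq> f ` topspace X \<and> openin X {x \<in> topspace X. f x \<in> U}"
proof -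
  have "istopology (\<lambda>U. U \<subseteq> f ` topspace X \<and> openin X {x \<in> topspace X. f x \<in> U})"
    unfolding istopology_def
  proof (intro conjI allI impI)
    fix S T
    assume S: "S \<subseteq> f ` topspace X \<and> openin X {x \<in> topspace X. f x \<in> S}"
      and T: "T \<subseteq> f ` topspace X \<and> openin X {x \<in> topspace X. f x \<in> T}"
    then show "S \<inter> T \<subseteq> f ` topspace X" by blast
    have "{x \<in> topspace X. f x \<in> S \<inter> T} =
        {x \<in> topspace X. f x \<in> S} \<inter> {x \<in> topspace X. f x \<in> T}" by blast
    then show "openin X {x \<in> topspace X. f x \<in> S \<inter> T}" using S T by auto
  next
    fix \<K>
    assume K: "\<forall>K\<in>\<K>. K \<subseteq> f ` topspace X \<and> openin X {x \<in> topspace X. f x \<in> K}"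
    then show "\<Union>\<K> \<subseteq> f ` topspace X" by blast
    have "{x \<in> topspace X. f x \<in> \<Union>\<K>} = \<Union>((\<lambda>K. {x \<in> topspace X. f x \<in> K}) ` \<K>)" by blast
    then show "openin X {x \<in> topspace X. f x \<in> \<Union>\<K>}" using K by auto
  qed
  then show ?thesis by (simp add: quotient_topology_def)
qed

lemma topspace_quotient_topology: "topspace (quotient_topology X f) = f ` topspace X"
proof
  show "topspace (quotient_topology X f) \<subseteq> f ` topspace X"
    using openin_quotient_topology[of X f "topspace (quotient_topology X f)"] by simp
  have "{x \<in> topspace X. f x \<in> f ` topspace X} = topspace X" by blast
  then have "openin (quotient_topology X f) (f ` topspace X)"
    by (simp add: openin_quotient_topology)
  then show "f ` topspace X \<subseteq> topspace (quotient_topology X f)"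
    by (rule openin_subset)
qed

lemma quotient_map_quotient_topology: "quotient_map X (quotient_topology X f) f"
  by (auto simp: quotient_map_def openin_quotient_topology topspace_quotient_topology)

text \<open>The space \<open>G/H\<close> of left cosets, with the quotient topology.\<close>

definition coset_space ::
  "(real^'n^'n) set \<Rightarrow> (real^'n^'n) set \<Rightarrow> (real^'n^'n) set topology" where
  "coset_space G H = quotient_topology (top_of_set G) (\<lambda>g. g <#\<^bsub>matgrp G\<^esub> H)"

definition properly_discontinuous ::
  "('g, 'b) monoid_scheme \<Rightarrow> ('g \<Rightarrow> 'x \<Rightarrow> 'x) \<Rightarrow> 'x topology \<Rightarrow> bool" where
  "properly_discontinuous M act X \<longleftrightarrow>
     (\<forall>C. compactin X C \<longrightarrow> finite {g \<in> carrier M. act g ` C \<inter> C \<noteq> {}})"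

definition cocompact ::
  "('g, 'b) monoid_scheme \<Rightarrow> ('g \<Rightarrow> 'x \<Rightarrow> 'x) \<Rightarrow> 'x topology \<Rightarrow> bool" where
  "cocompact M act X \<longleftrightarrow> compact_space (quotient_topology X (orbit M act))"

definition generating_set :: "('g, 'b) monoid_scheme \<Rightarrow> 'g set \<Rightarrow> bool" where
  "generating_set M S \<longleftrightarrow> S \<subseteq> carrier M \<and> generate M S = carrier M"

definition finitely_generated :: "('g, 'b) monoid_scheme \<Rightarrow> bool" where
  "finitely_generated M \<longleftrightarrow> (\<exists>S. finite S \<and> generating_set M S)"

definition word_length :: "('g, 'b) monoid_scheme \<Rightarrow> 'g set \<Rightarrow> 'g \<Rightarrow> nat" where
  "word_length M S g =
     (LEAST n. \<exists>ws. length ws = n \<and> set ws \<subseteq> S \<union> m_inv M ` S \<and> g = foldr (mult M) ws \<one>\<^bsub>M\<^esub>)"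

section \<open>Sharpness\<close>

definition sharp_action ::
  "('v::real_vector \<Rightarrow> real) \<Rightarrow> ('g \<Rightarrow> 'v) \<Rightarrow> 'g set \<Rightarrow> 'g set \<Rightarrow> bool" where
  "sharp_action N \<mu> H \<Gamma> \<longleftrightarrow>
     (\<exists>c>0. \<exists>c'>0. \<forall>\<gamma>\<in>\<Gamma>. dist_to_set N (\<mu> \<gamma>) (\<mu> ` H) \<ge> c * N (\<mu> \<gamma>) - c')"

text \<open>
  The property does not depend on the finite generating set \<open>S\<close>; we require it for all of them
  (as well as the existence of one).
\<close>

definition sharply_embedded ::
  "('v::real_vector \<Rightarrow> real) \<Rightarrow> (real^'n^'n \<Rightarrow> 'v) \<Rightarrow> (real^'n^'n) set \<Rightarrow> (real^'n^'n) set \<Rightarrow> bool"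
  where
  "sharply_embedded N \<mu> H \<Gamma> \<longleftrightarrow>
     finitely_generated (matgrp \<Gamma>) \<and>
     (\<forall>S. finite S \<and> generating_set (matgrp \<Gamma>) S \<longrightarrow>
        (\<exists>c>0. \<exists>c'>0. \<forall>\<gamma>\<in>\<Gamma>.
           dist_to_set N (\<mu> \<gamma>) (\<mu> ` H) \<ge> c * real (word_length (matgrp \<Gamma>) S \<gamma>) - c'))"

end

theory Submission
  imports Defs
begin

text \<open>
  The group acts cocompactly on \<open>G/H\<close>, so \<open>G = \<Gamma> B H\<close> for a compact ball \<open>B\<close>. Let \<open>\<rho>\<close> be the logarithm of
  a size function on \<open>G\<close> which is bi-invariant under the maximal compact subgroup. If \<open>\<gamma> = k h g\<close> with
  \<open>k\<close> in that subgroup and \<open>h \<in> H\<close>, then \<open>\<rho> g\<close> can be decreased by a definite amount by multiplying \<open>g\<close> on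
  the right by a conjugate of a small element; cocompactness turns this step into the multiplication of
  \<open>\<gamma>\<close> by an element of \<open>\<Gamma>\<close>, which proper discontinuity confines to a finite set. Hence
  \<open>\<gamma>\<close> is a word of length at most \<open>a * \<rho> g + b\<close> in this finite set. Writing \<open>\<gamma>\<close> and \<open>h\<close> in the Cartan
  decomposition gives such a \<open>g\<close> with \<open>\<rho> g\<close> bounded linearly by the distance between the Cartan projections
  of \<open>\<gamma>\<close> and \<open>h\<close>.
\<close>

section \<open>Square matrices as a Banach algebra\<close>

text \<open>Cocompactness writes a point as \<open>\<gamma>1 ** c1 ** h1\<close>. A small
  \<open>u\<close> inserted before \<open>h1\<close> acts on the point through its conjugate by
  \<open>h1\<close>, and \<open>h1\<close> ranges over all of \<open>H\<close>, so
  \<open>\<rho>\<close> must decrease uniformly over all conjugations. This is possible because the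
  gradient of \<open>\<rho>\<close> is self-adjoint: no conjugate of a self-adjoint matrix is
  shorter than the matrix itself, so there is always a unit vector of the Lie algebra along whose
  conjugate \<open>\<rho>\<close> falls at a definite rate. The Cartan projection is a definite
  description, so existence and uniqueness of the Cartan decomposition have to be proved, for closed
  connected matrix groups stable under adjoints. Instead of charts, connectedness acts through a
  criterion by which a closed subset with enough tangent directions is the whole group. Uniqueness
  comes from a highest weight matrix coefficient, treated as a polynomial on matrices. Both
  sharpness bounds are instances of one estimate: it holds for every function on the group that is
  at most linear in the length of words, such as the word length and the norm of the Cartan
  projection.\<close>

text \<open>
  A copy of the square matrices carrying the matrix product and the operator norm, so that the
  library facts about \<open>exp\<close> in Banach algebras apply to \<open>mexp\<close>.
\<close>

typedef ('n::finite) matalg = "UNIV :: (real^'n^'n) set" by simp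

setup_lifting type_definition_matalg

instantiation matalg :: (finite) real_normed_algebra_1
begin
lift_definition zero_matalg :: "'a matalg" is 0 .
lift_definition one_matalg :: "'a matalg" is "mat 1" .
lift_definition plus_matalg :: "'a matalg \<Rightarrow> 'a matalg \<Rightarrow> 'a matalg" is "(+)" .
lift_definition minus_matalg :: "'a matalg \<Rightarrow> 'a matalg \<Rightarrow> 'a matalg" is "(-)" .
lift_definition uminus_matalg :: "'a matalg \<Rightarrow> 'a matalg" is uminus .
lift_definition times_matalg :: "'a matalg \<Rightarrow> 'a matalg \<Rightarrow> 'a matalg" is "(**)" .
lift_definition scaleR_matalg :: "real \<Rightarrow> 'a matalg \<Rightarrow> 'a matalg" is scaleR .
lift_definition norm_matalg :: "'a matalg \<Rightarrow> real" is "\<lambda>M. onorm ((*v) M)" .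
definition dist_matalg :: "'a matalg \<Rightarrow> 'a matalg \<Rightarrow> real" where "dist_matalg x y = norm (x - y)"
lift_definition sgn_matalg :: "'a matalg \<Rightarrow> 'a matalg" is "\<lambda>M. inverse (onorm ((*v) M)) *\<^sub>R M" .
definition uniformity_matalg :: "('a matalg \<times> 'a matalg) filter"
  where "uniformity_matalg = (INF e\<in>{0<..}. principal {(x, y). dist x y < e})"
definition open_matalg :: "'a matalg set \<Rightarrow> bool"
  where "open_matalg U = (\<forall>x\<in>U. eventually (\<lambda>(x', y). x' = x \<longrightarrow> y \<in> U) uniformity)"
instance
proof
  fix a b c :: "'a matalg" and r s :: real
  show "a + b + c = a + (b + c)" "a + b = b + a" "0 + a = a" "- a + a = 0" "a - b = a + - b"
    "r *\<^sub>R (a + b) = r *\<^sub>R a + r *\<^sub>R b" "(r + s) *\<^sub>R a = r *\<^sub>R a + s *\<^sub>R a"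
    "r *\<^sub>R s *\<^sub>R a = (r * s) *\<^sub>R a" "1 *\<^sub>R a = a"
    by (transfer; simp add: algebra_simps)+
  show "a * b * c = a * (b * c)" by transfer (simp add: matrix_mul_assoc)
  show "1 * a = a" "a * 1 = a" by (transfer; simp)+
  show "(0::'a matalg) \<noteq> 1" by transfer (auto simp: mat_def vec_eq_iff)
  show "(a + b) * c = a * c + b * c" "a * (b + c) = a * b + a * c"
    by (transfer; simp add: matrix_add_ldistrib matrix_matrix_mult_def vec_eq_iff
        sum.distrib algebra_simps)+
  show "r *\<^sub>R a * b = r *\<^sub>R (a * b)" "a * r *\<^sub>R b = r *\<^sub>R (a * b)"
    by (transfer; simp add: matrix_matrix_mult_def vec_eq_iff sum_distrib_left algebra_simps)+
  show "dist a b = norm (a - b)" by (rule dist_matalg_def)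
  show "sgn a = inverse (norm a) *\<^sub>R a" by transfer simp
  show "(uniformity :: ('a matalg \<times> 'a matalg) filter) = (INF e\<in>{0<..}. principal {(x, y). dist x y < e})"
    by (rule uniformity_matalg_def)
  show "open U = (\<forall>x\<in>U. \<forall>\<^sub>F (x', y) in uniformity. x' = x \<longrightarrow> y \<in> U)" for U :: "'a matalg set"
    by (rule open_matalg_def)
  show "(norm a = 0) = (a = 0)"
  proof transfer
    fix a :: "real^'a^'a"
    show "(onorm ((*v) a) = 0) = (a = 0)"
      using onorm_eq_0[of "(*v) a"] by (simp add: matrix_eq)
  qed
  show "norm (a + b) \<le> norm a + norm b"
  proof transfer
    fix a b :: "real^'a^'a"
    show "onorm ((*v) (a + b)) \<le> onorm ((*v) a) + onorm ((*v) b)"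
      using onorm_triangle[of "(*v) a" "(*v) b"] by (simp add: matrix_vector_mult_add_rdistrib[abs_def])
  qed
  show "norm (r *\<^sub>R a) = \<bar>r\<bar> * norm a"
  proof transfer
    fix a :: "real^'a^'a" and r :: real
    show "onorm ((*v) (r *\<^sub>R a)) = \<bar>r\<bar> * onorm ((*v) a)"
      using onorm_scaleR[of "(*v) a" r] by (simp add: scaleR_matrix_vector_assoc[symmetric, abs_def])
  qed
  show "norm (a * b) \<le> norm a * norm b"
  proof transfer
    fix a b :: "real^'a^'a"
    show "onorm ((*v) (a ** b)) \<le> onorm ((*v) a) * onorm ((*v) b)"
      using onorm_compose[of "(*v) a" "(*v) b"] by (simp add: matrix_vector_mul_assoc o_def)
  qed
  show "norm (1 :: 'a matalg) = 1"
  proof transfer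
    have "(*v) (mat 1 :: real^'a^'a) = (\<lambda>x. x)" by (simp add: fun_eq_iff)
    then show "onorm ((*v) (mat 1 :: real^'a^'a)) = 1" by (simp only: onorm_id)
  qed
qed
end

text \<open>With the converse bound that follows, this makes \<open>Rep_matalg\<close> and
  \<open>Abs_matalg\<close> bounded linear, so limits, series and derivatives pass between the two
  copies of the matrices.\<close>

lemma norm_Rep_matalg_le:
  "norm (Rep_matalg (a::'n::finite matalg)) \<le> real (CARD('n)) * real (CARD('n)) * norm a"
proof transfer
  fix a :: "real^'n^'n"
  have "norm a \<le> (\<Sum>i\<in>UNIV. norm (a $ i))" by (simp add: norm_vec_def L2_set_le_sum)
  also have "\<dots> \<le> (\<Sum>i::'n\<in>UNIV. \<Sum>j::'n\<in>UNIV. onorm ((*v) a))"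
    by (rule sum_mono, rule order_trans[OF norm_le_l1_cart], rule sum_mono)
       (rule matrix_component_le_onorm)
  finally show "norm a \<le> real (CARD('n)) * real (CARD('n)) * onorm ((*v) a)" by simp
qed

lemma norm_matalg_le:
  "norm (a::'n::finite matalg) \<le> real (CARD('n)) * real (CARD('n)) * norm (Rep_matalg a)"
proof transfer
  fix a :: "real^'n^'n"
  show "onorm ((*v) a) \<le> real (CARD('n)) * real (CARD('n)) * norm a"
    by (rule onorm_le_matrix_component)
       (metis component_le_norm_cart Finite_Cartesian_Product.norm_nth_le order_trans)
qed

lemma bounded_linear_Rep_matalg: "bounded_linear (Rep_matalg :: 'n::finite matalg \<Rightarrow> _)"
  by (rule bounded_linear_intro[where K = "real (CARD('n)) * real (CARD('n))"])
     (use norm_Rep_matalg_le in \<open>auto simp: plus_matalg.rep_eq scaleR_matalg.rep_eq mult.commute\<close>)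

lemma bounded_linear_Abs_matalg: "bounded_linear (Abs_matalg :: _ \<Rightarrow> 'n::finite matalg)"
proof (rule bounded_linear_intro[where K = "real (CARD('n)) * real (CARD('n))"])
  show "norm (Abs_matalg x :: 'n matalg) \<le> norm x * (real CARD('n) * real CARD('n))" for x
    using norm_matalg_le[of "Abs_matalg x"] by (simp add: Abs_matalg_inverse mult.commute)
qed (simp_all add: plus_matalg.abs_eq scaleR_matalg.abs_eq)

instance matalg :: (finite) banach
proof
  fix X :: "nat \<Rightarrow> 'a matalg"
  assume "Cauchy X"
  then have "Cauchy (\<lambda>n. Rep_matalg (X n))"
    by (rule bounded_linear.Cauchy[OF bounded_linear_Rep_matalg])
  then obtain L where "(\<lambda>n. Rep_matalg (X n)) \<longlonglongrightarrow> L"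
    using Cauchy_convergent convergent_def by blast
  then have "(\<lambda>n. Abs_matalg (Rep_matalg (X n))) \<longlonglongrightarrow> Abs_matalg L"
    by (rule bounded_linear.tendsto[OF bounded_linear_Abs_matalg])
  then show "convergent X" by (auto simp: Rep_matalg_inverse convergent_def)
qed

lemma bounded_bilinear_matrix_mult:
  "bounded_bilinear ((**) :: real^'n^'n \<Rightarrow> real^'n^'n \<Rightarrow> real^'n^'n)"
  unfolding bilinear_conv_bounded_bilinear[symmetric] bilinear_def linear_iff
  by (simp add: matrix_add_ldistrib matrix_matrix_mult_def vec_eq_iff sum.distrib
      sum_distrib_left algebra_simps)

interpretation mm: bounded_bilinear "(**) :: real^'n^'n \<Rightarrow> real^'n^'n \<Rightarrow> real^'n^'n"
  by (rule bounded_bilinear_matrix_mult)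

lemmas mat_ring = mm.add_left mm.add_right mm.diff_left mm.diff_right mm.minus_left
  mm.minus_right mm.scaleR_left mm.scaleR_right matrix_mul_assoc

lemma Rep_matalg_power: "Rep_matalg (a ^ k) = (((**) (Rep_matalg a)) ^^ k) (mat 1)"
  by (induction k) (simp_all add: one_matalg.rep_eq times_matalg.rep_eq)

lemma mexp_Rep_matalg: "mexp (Rep_matalg a) = Rep_matalg (exp a)"
proof -
  have "(\<lambda>k. Rep_matalg (a ^ k /\<^sub>R fact k)) sums Rep_matalg (exp a)"
    by (rule bounded_linear.sums[OF bounded_linear_Rep_matalg exp_converges])
  then have "(\<lambda>k. (1 / fact k) *\<^sub>R (((**) (Rep_matalg a)) ^^ k) (mat 1)) sums Rep_matalg (exp a)"
    by (simp add: scaleR_matalg.rep_eq Rep_matalg_power divide_inverse)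
  then show ?thesis by (simp add: mexp_def sums_iff)
qed

lemma mexp_eq: "mexp X = Rep_matalg (exp (Abs_matalg X))"
  using mexp_Rep_matalg[of "Abs_matalg X"] by (simp add: Abs_matalg_inverse)

lemma mexp_0 [simp]: "mexp 0 = mat 1"
  by (simp add: mexp_eq one_matalg.rep_eq flip: zero_matalg_def)

lemma mexp_add_commuting:
  assumes "X ** Y = Y ** X"
  shows "mexp (X + Y) = mexp X ** mexp Y"
proof -
  have "Abs_matalg X * Abs_matalg Y = Abs_matalg Y * Abs_matalg X"
    using assms by (simp add: times_matalg.abs_eq)
  from exp_add_commuting[OF this] show ?thesis
    by (simp add: mexp_eq plus_matalg.abs_eq times_matalg.rep_eq)
qed

lemma mexp_add_scaleR: "mexp ((s + t) *\<^sub>R X) = mexp (s *\<^sub>R X) ** mexp (t *\<^sub>R X)"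
  by (simp add: scaleR_left_distrib mat_ring mexp_add_commuting)

lemma mexp_minus [simp]: "mexp X ** mexp (- X) = mat 1" "mexp (- X) ** mexp X = mat 1"
  using mexp_add_commuting[of X "- X"] mexp_add_commuting[of "- X" X] by (simp_all add: mat_ring)

lemma invertible_mexp: "invertible (mexp X)"
  unfolding invertible_def using mexp_minus by blast

lemma has_vector_derivative_mexp:
  "((\<lambda>t. mexp (t *\<^sub>R X)) has_vector_derivative (mexp (t *\<^sub>R X) ** X)) (at t within S)"
  using bounded_linear.has_vector_derivative[OF bounded_linear_Rep_matalg
      exp_scaleR_has_vector_derivative_right[of "Abs_matalg X" t S]]
  by (simp add: mexp_eq times_matalg.rep_eq scaleR_matalg.abs_eq Abs_matalg_inverse)

lemma mexp_conj:
  fixes U V X :: "real^'n^'n"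
  assumes "U ** V = mat 1" "V ** U = mat 1"
  shows "mexp (U ** X ** V) = U ** mexp X ** V"
proof -
  have p: "(((**) (U ** X ** V)) ^^ k) (mat 1) = U ** ((((**) X) ^^ k) (mat 1)) ** V" for k
  proof (induction k)
    case (Suc k)
    have "U ** X ** V ** (U ** Y ** V) = U ** X ** (V ** U) ** Y ** V" for Y
      by (simp only: matrix_mul_assoc)
    with Suc show ?case by (simp add: assms(2) matrix_mul_assoc)
  qed (use assms in simp)
  have "(\<lambda>k. Rep_matalg (Abs_matalg X ^ k /\<^sub>R fact k)) sums Rep_matalg (exp (Abs_matalg X))"
    by (rule bounded_linear.sums[OF bounded_linear_Rep_matalg exp_converges])
  then have "(\<lambda>k. (1 / fact k) *\<^sub>R (((**) X) ^^ k) (mat 1)) sums mexp X"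
    by (simp add: mexp_eq scaleR_matalg.rep_eq Rep_matalg_power divide_inverse Abs_matalg_inverse)
  from bounded_linear.sums[OF bounded_linear_compose[OF mm.bounded_linear_left[of V]
        mm.bounded_linear_right[of U]] this]
  have "(\<lambda>k. (1 / fact k) *\<^sub>R (((**) (U ** X ** V)) ^^ k) (mat 1)) sums (U ** mexp X ** V)"
    by (simp add: p mat_ring)
  then show ?thesis by (simp add: mexp_def sums_iff)
qed

lemma linear_transpose: "linear (transpose :: real^'n^'m \<Rightarrow> real^'m^'n)"
  by (simp add: linear_iff transpose_def vec_eq_iff)

lemma mexp_transpose: "mexp (transpose X) = transpose (mexp X)"
proof -
  have p: "(((**) (transpose X)) ^^ k) (mat 1) = transpose ((((**) X) ^^ k) (mat 1))" for k
  proof (induction k)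
    case (Suc k)
    have "(((**) X) ^^ k) (mat 1) ** X = X ** (((**) X) ^^ k) (mat 1)"
      by (induction k) (simp_all, metis matrix_mul_assoc)
    with Suc show ?case by (simp flip: matrix_transpose_mul)
  qed simp
  have "(\<lambda>k. Rep_matalg (Abs_matalg X ^ k /\<^sub>R fact k)) sums Rep_matalg (exp (Abs_matalg X))"
    by (rule bounded_linear.sums[OF bounded_linear_Rep_matalg exp_converges])
  then have "(\<lambda>k. (1 / fact k) *\<^sub>R (((**) X) ^^ k) (mat 1)) sums mexp X"
    by (simp add: mexp_eq scaleR_matalg.rep_eq Rep_matalg_power divide_inverse Abs_matalg_inverse)
  from bounded_linear.sums[OF linear_conv_bounded_linear[THEN iffD1, OF linear_transpose] this]
  have "(\<lambda>k. (1 / fact k) *\<^sub>R (((**) (transpose X)) ^^ k) (mat 1)) sums transpose (mexp X)"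
    by (simp add: p transpose_scalar)
  then show ?thesis by (simp add: mexp_def sums_iff)
qed

text \<open>Serves to compute the exponential of a diagonal matrix one column at a time.\<close>

lemma mexp_eigenvector:
  assumes "X *v v = l *\<^sub>R v"
  shows "mexp X *v v = exp l *\<^sub>R v"
proof -
  have p: "(((**) X) ^^ k) (mat 1) *v v = (l ^ k) *\<^sub>R v" for k
    by (induction k) (simp_all add: assms matrix_vector_mult_scaleR flip: matrix_vector_mul_assoc)
  have "(\<lambda>k. Rep_matalg (Abs_matalg X ^ k /\<^sub>R fact k)) sums Rep_matalg (exp (Abs_matalg X))"
    by (rule bounded_linear.sums[OF bounded_linear_Rep_matalg exp_converges])
  then have "(\<lambda>k. (1 / fact k) *\<^sub>R (((**) X) ^^ k) (mat 1)) sums mexp X"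
    by (simp add: mexp_eq scaleR_matalg.rep_eq Rep_matalg_power divide_inverse Abs_matalg_inverse)
  moreover have "linear (\<lambda>M. M *v v)"
    by (simp add: linear_iff matrix_vector_mult_add_rdistrib scaleR_matrix_vector_assoc)
  ultimately have "(\<lambda>k. (1 / fact k) *\<^sub>R (((**) X) ^^ k) (mat 1) *v v) sums (mexp X *v v)"
    using bounded_linear.sums linear_conv_bounded_linear by blast
  moreover have "(\<lambda>k. ((l ^ k) /\<^sub>R fact k) *\<^sub>R v) sums (exp l *\<^sub>R v)"
    by (rule bounded_linear.sums[OF bounded_linear_scaleR_left exp_converges])
  then have "(\<lambda>k. (1 / fact k) *\<^sub>R (((**) X) ^^ k) (mat 1) *v v) sums (exp l *\<^sub>R v)"
    by (simp add: p divide_inverse flip: scaleR_matrix_vector_assoc)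
  ultimately show ?thesis by (rule sums_unique2)
qed

section \<open>Powers and exponentials in a Banach algebra\<close>

lemma norm_power_diff_le:
  fixes a b :: "'a::real_normed_algebra_1"
  assumes "norm a \<le> M" "norm b \<le> M" "1 \<le> M"
  shows "norm (a ^ m - b ^ m) \<le> real m * M ^ m * norm (a - b)"
proof (induction m)
  case (Suc m)
  have "a ^ Suc m - b ^ Suc m = a * (a ^ m - b ^ m) + (a - b) * b ^ m"
    by (simp add: algebra_simps)
  also have "norm \<dots> \<le> M * (real m * M ^ m * norm (a - b)) + norm (a - b) * M ^ m"
  proof (rule norm_triangle_le, rule add_mono)
    show "norm (a * (a ^ m - b ^ m)) \<le> M * (real m * M ^ m * norm (a - b))"
      by (rule order_trans[OF norm_mult_ineq], rule mult_mono) (use assms Suc in auto)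
    have "norm (b ^ m) \<le> M ^ m"
      by (rule order_trans[OF norm_power_ineq]) (use assms in \<open>auto intro: power_mono\<close>)
    then show "norm ((a - b) * b ^ m) \<le> norm (a - b) * M ^ m"
      by (intro order_trans[OF norm_mult_ineq] mult_left_mono) auto
  qed
  \<comment> \<open>\<open>1 \<le> M\<close> allows the spare factor \<open>M\<close> by which both
    telescoping terms carry the same power.\<close>
  also have "\<dots> \<le> M * (real m * M ^ m * norm (a - b)) + norm (a - b) * (M * M ^ m)"
    using assms(3) by (intro add_left_mono mult_left_mono) (auto simp: mult_le_cancel_right1)
  also have "\<dots> = real (Suc m) * M ^ Suc m * norm (a - b)" by (simp add: algebra_simps)
  finally show ?case .
qed simp

text \<open>The tail starts at the second power, and \<open>2 ^ (n + 1) \<le> fact (n + 2)\<close>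
  compares it with a geometric series of sum 1; hence the constant is exactly 1.\<close>

lemma norm_exp_minus_one_minus_le:
  fixes x :: "'a::{real_normed_algebra_1,banach}"
  assumes "norm x \<le> 1"
  shows "norm (exp x - 1 - x) \<le> norm x ^ 2"
proof -
  let ?f = "\<lambda>n. inverse (fact (n + 2)) *\<^sub>R x ^ (n + 2)"
  have le: "norm (?f n) \<le> norm x ^ 2 * ((1/2) ^ (n + 1))" for n
  proof -
    have f: "(2::real) ^ (n + 1) \<le> fact (n + 2)"
    proof (induction n)
      case (Suc n)
      have "(2::real) ^ (Suc n + 1) = 2 * 2 ^ (n + 1)" by simp
      also have "\<dots> \<le> (real n + 3) * fact (n + 2)" using Suc by (intro mult_mono) auto
      also have "\<dots> = fact (Suc n + 2)" by (simp add: algebra_simps)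
      finally show ?case .
    qed simp
    have "inverse (fact (n + 2)) \<le> (1/2::real) ^ (n + 1)"
      using le_imp_inverse_le[OF f] by (simp add: power_one_over inverse_eq_divide)
    moreover have "norm x ^ (n + 2) \<le> norm x ^ 2"
      using assms by (intro power_decreasing) auto
    then have "norm (x ^ (n + 2)) \<le> norm x ^ 2" using norm_power_ineq[of x "n + 2"] by linarith
    ultimately have "inverse (fact (n + 2)) * norm (x ^ (n + 2)) \<le> (1/2) ^ (n + 1) * norm x ^ 2"
      by (intro mult_mono) auto
    then show ?thesis by (simp add: mult.commute)
  qed
  have s: "(\<lambda>n. norm x ^ 2 * ((1/2) ^ (n + 1))) sums (norm x ^ 2 * 1)"
    using sums_mult[OF power_half_series, of "norm x ^ 2"] by simp
  have "norm (\<Sum>n. ?f n) \<le> (\<Sum>n. norm x ^ 2 * ((1/2) ^ (n + 1)))"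
    by (rule norm_suminf_le) (use le s in \<open>auto simp: sums_iff\<close>)
  moreover have "exp x - 1 - x = (\<Sum>n. ?f n)"
    using exp_first_two_terms[of x] by (simp add: algebra_simps)
  ultimately show ?thesis using s by (simp add: sums_iff)
qed

lemma exp_real_nat_scaleR:
  fixes x :: "'a::{real_normed_algebra_1,banach}"
  shows "exp (real m *\<^sub>R x) = exp x ^ m"
proof (induction m)
  case (Suc m)
  have "exp (real (Suc m) *\<^sub>R x) = exp (x + real m *\<^sub>R x)" by (simp add: algebra_simps)
  also have "\<dots> = exp x * exp (real m *\<^sub>R x)" by (rule exp_add_commuting) simp
  finally show ?case using Suc by simp
qed simp

text \<open>Each exponential is split into \<open>m\<close> equal factors, and the powers are
  compared by telescoping. The factors differ to first order by \<open>(a - b) / m\<close>; the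
  second-order errors add up to \<open>2 * M ^ 2 / m\<close> and disappear in the limit.\<close>

lemma norm_exp_diff_le:
  fixes a b :: "'a::{real_normed_algebra_1,banach}"
  defines "M \<equiv> max (norm a) (norm b)"
  shows "norm (exp a - exp b) \<le> exp M * norm (a - b)"
proof (rule LIMSEQ_le_const)
  show "(\<lambda>m. exp M * (norm (a - b) + 2 * M ^ 2 * inverse (real (Suc m)))) \<longlonglongrightarrow> exp M * norm (a - b)"
    by (rule tendsto_eq_intros refl LIMSEQ_inverse_real_of_nat | simp)+
  have M: "M \<ge> 0" "norm a \<le> M" "norm b \<le> M" by (auto simp: M_def le_max_iff_disj)
  \<comment> \<open>From \<open>m0\<close> on, both arguments divided by \<open>m\<close> have norm
    at most 1, the range of the second-order estimate.\<close>
  obtain m0 :: nat where m0: "M \<le> real m0" using real_arch_simple by blast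
  show "\<exists>m0. \<forall>m\<ge>m0. norm (exp a - exp b) \<le> exp M * (norm (a - b) + 2 * M ^ 2 * inverse (real (Suc m)))"
  proof (intro exI[of _ m0] allI impI)
    fix m' assume "m' \<ge> m0"
    define m where "m = Suc m'"
    have m: "real m > 0" "M \<le> real m" using m0 \<open>m' \<ge> m0\<close> by (auto simp: m_def)
    let ?a = "inverse (real m) *\<^sub>R a" and ?b = "inverse (real m) *\<^sub>R b"
    have small: "norm (exp x - 1 - x) \<le> M ^ 2 * inverse (real m) ^ 2" "norm (exp x) \<le> exp (M / real m)"
      if x: "x = inverse (real m) *\<^sub>R y" "norm y \<le> M" for x y :: 'a
    proof -
      have nx: "norm x \<le> M / real m" using x m by (simp add: field_simps)
      also have "\<dots> \<le> 1" using m by simp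
      finally have "norm (exp x - 1 - x) \<le> norm x ^ 2" by (rule norm_exp_minus_one_minus_le)
      also have "\<dots> \<le> (M / real m) ^ 2" using nx by (intro power_mono) auto
      finally show "norm (exp x - 1 - x) \<le> M ^ 2 * inverse (real m) ^ 2" by (simp add: field_simps)
      show "norm (exp x) \<le> exp (M / real m)"
        using norm_exp[of x] nx by (meson exp_le_cancel_iff order_trans)
    qed
    have "exp ?a - exp ?b = (exp ?a - 1 - ?a) - (exp ?b - 1 - ?b) + inverse (real m) *\<^sub>R (a - b)"
      by (simp add: algebra_simps)
    also have "norm \<dots> \<le> norm ((exp ?a - 1 - ?a) - (exp ?b - 1 - ?b)) + norm (inverse (real m) *\<^sub>R (a - b))"
      by (rule norm_triangle_ineq)
    also have "\<dots> \<le> norm (exp ?a - 1 - ?a) + norm (exp ?b - 1 - ?b) + norm (inverse (real m) *\<^sub>R (a - b))"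
      by (intro add_right_mono norm_triangle_ineq4)
    also have "\<dots> \<le> M ^ 2 * inverse (real m) ^ 2 + M ^ 2 * inverse (real m) ^ 2 + inverse (real m) * norm (a - b)"
      using small(1)[OF refl M(2)] small(1)[OF refl M(3)] m by simp
    finally have d: "norm (exp ?a - exp ?b) \<le>
        inverse (real m) * (norm (a - b) + 2 * M ^ 2 * inverse (real m))"
      by (simp add: algebra_simps power2_eq_square)
    have "exp a - exp b = exp ?a ^ m - exp ?b ^ m"
      using m by (simp flip: exp_real_nat_scaleR)
    also have "norm \<dots> \<le> real m * exp (M / real m) ^ m * norm (exp ?a - exp ?b)"
      by (rule norm_power_diff_le) (use small(2)[OF refl M(2)] small(2)[OF refl M(3)] M m in auto)
    also have "\<dots> \<le> real m * exp (M / real m) ^ m * (inverse (real m) * (norm (a - b) + 2 * M ^ 2 * inverse (real m)))"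
      by (intro mult_left_mono d) auto
    also have "exp (M / real m) ^ m = exp M" using m by (simp add: exp_of_nat_mult[symmetric])
    also have "real m * exp M * (inverse (real m) * (norm (a - b) + 2 * M ^ 2 * inverse (real m))) =
        exp M * (norm (a - b) + 2 * M ^ 2 * inverse (real m))" using m by simp
    finally show "norm (exp a - exp b) \<le> exp M * (norm (a - b) + 2 * M ^ 2 * inverse (real (Suc m')))"
      by (simp only: m_def)
  qed
qed

lemma tendsto_exp_algebra:
  fixes f :: "nat \<Rightarrow> 'a::{real_normed_algebra_1,banach}"
  assumes "f \<longlonglongrightarrow> Y"
  shows "(\<lambda>k. exp (f k)) \<longlonglongrightarrow> exp Y"
proof -
  have "(\<lambda>k. exp (max (norm (f k)) (norm Y)) * norm (f k - Y)) \<longlonglongrightarrow> exp (max (norm Y) (norm Y)) * norm (Y - Y)"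
    by (intro tendsto_intros assms)
  then have "(\<lambda>k. exp (f k) - exp Y) \<longlonglongrightarrow> 0"
    by (rule Lim_null_comparison[rotated, OF tendsto_eq_rhs])
       (auto intro: always_eventually norm_exp_diff_le)
  then show ?thesis by (simp add: LIM_zero_iff)
qed

text \<open>\<open>1 + E k\<close> and \<open>exp (E k)\<close> differ by at most the square of
  \<open>norm (E k)\<close>. Over \<open>m k\<close> factors the error is still of order
  \<open>norm (E k)\<close>, because \<open>m k\<close> times \<open>E k\<close> converges.\<close>

lemma power_one_plus_tendsto_exp:
  fixes E :: "nat \<Rightarrow> 'a::{real_normed_algebra_1,banach}"
  assumes E: "E \<longlonglongrightarrow> 0" and m: "(\<lambda>k. real (m k) *\<^sub>R E k) \<longlonglongrightarrow> Y"
  shows "(\<lambda>k. (1 + E k) ^ m k) \<longlonglongrightarrow> exp Y"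
proof -
  have exp_le: "norm (exp x) \<le> exp (norm x)" for x :: 'a by (rule norm_exp)
  have le: "norm ((1 + E k) ^ m k - exp (E k) ^ m k)
      \<le> norm (real (m k) *\<^sub>R E k) * exp (norm (real (m k) *\<^sub>R E k)) * norm (E k)"
    if "norm (E k) \<le> 1" for k
  proof -
    have "norm (1 + E k) \<le> exp (norm (E k))"
      using norm_triangle_ineq[of 1 "E k"] exp_ge_add_one_self[of "norm (E k)"]
      unfolding norm_one by linarith
    then have "norm ((1 + E k) ^ m k - exp (E k) ^ m k)
        \<le> real (m k) * exp (norm (E k)) ^ m k * norm (1 + E k - exp (E k))"
      by (rule norm_power_diff_le) (use exp_le in auto)
    also have "\<dots> \<le> real (m k) * exp (norm (E k)) ^ m k * norm (E k) ^ 2"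
      using norm_exp_minus_one_minus_le[OF that]
      by (intro mult_left_mono) (auto simp: norm_minus_commute diff_diff_add)
    also have "\<dots> = norm (real (m k) *\<^sub>R E k) * exp (norm (real (m k) *\<^sub>R E k)) * norm (E k)"
      by (simp add: power2_eq_square exp_of_nat_mult)
    finally show ?thesis .
  qed
  have "\<forall>\<^sub>F k in sequentially. norm (E k) < 1"
    using tendsto_norm[OF E] by (intro order_tendstoD) auto
  then have "\<forall>\<^sub>F k in sequentially. norm ((1 + E k) ^ m k - exp (E k) ^ m k)
      \<le> norm (real (m k) *\<^sub>R E k) * exp (norm (real (m k) *\<^sub>R E k)) * norm (E k)"
    by eventually_elim (use le in auto)
  moreover have "(\<lambda>k. norm (real (m k) *\<^sub>R E k) * exp (norm (real (m k) *\<^sub>R E k)) * norm (E k))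
      \<longlonglongrightarrow> norm Y * exp (norm Y) * norm (0::'a)"
    by (intro tendsto_mult tendsto_exp tendsto_norm m E)
  ultimately have "(\<lambda>k. (1 + E k) ^ m k - exp (E k) ^ m k) \<longlonglongrightarrow> 0"
    by (auto intro: Lim_null_comparison)
  moreover have "(\<lambda>k. exp (E k) ^ m k) \<longlonglongrightarrow> exp Y"
  proof -
    have "exp (real (m k) *\<^sub>R E k) = exp (E k) ^ m k" for k
      by (rule exp_real_nat_scaleR)
    moreover have "(\<lambda>k. exp (real (m k) *\<^sub>R E k)) \<longlonglongrightarrow> exp Y"
      by (intro tendsto_exp_algebra m)
    ultimately show ?thesis by simp
  qed
  ultimately have "(\<lambda>k. ((1 + E k) ^ m k - exp (E k) ^ m k) + exp (E k) ^ m k) \<longlonglongrightarrow> 0 + exp Y"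
    by (rule tendsto_add)
  then show ?thesis by simp
qed

text \<open>The link between sequences tending to the identity and one-parameter subgroups, by which
  tangent vectors of a closed group integrate to exponentials in it.\<close>

lemma mat_power_tendsto_mexp:
  fixes g :: "nat \<Rightarrow> real^'n^'n"
  assumes "g \<longlonglongrightarrow> mat 1" "(\<lambda>k. real (m k) *\<^sub>R (g k - mat 1)) \<longlonglongrightarrow> Y"
  shows "(\<lambda>k. (((**) (g k)) ^^ m k) (mat 1)) \<longlonglongrightarrow> mexp Y"
proof -
  have "(\<lambda>k. Abs_matalg (g k - mat 1)) \<longlonglongrightarrow> Abs_matalg (mat 1 - mat 1)"
    by (intro bounded_linear.tendsto[OF bounded_linear_Abs_matalg] tendsto_intros assms)
  moreover have "(\<lambda>k. Abs_matalg (real (m k) *\<^sub>R (g k - mat 1))) \<longlonglongrightarrow> Abs_matalg Y"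
    by (intro bounded_linear.tendsto[OF bounded_linear_Abs_matalg] tendsto_intros assms)
  ultimately have "(\<lambda>k. Rep_matalg ((1 + Abs_matalg (g k - mat 1)) ^ m k))
      \<longlonglongrightarrow> Rep_matalg (exp (Abs_matalg Y))"
    by (intro bounded_linear.tendsto[OF bounded_linear_Rep_matalg] power_one_plus_tendsto_exp)
       (simp_all add: scaleR_matalg.abs_eq flip: zero_matalg_def)
  then show ?thesis
    by (simp add: Rep_matalg_power mexp_eq one_matalg_def plus_matalg.abs_eq Abs_matalg_inverse)
qed

section \<open>Commuting self-adjoint operators\<close>

text \<open>For \<open>b \<noteq> 0\<close> the value at \<open>t = - b / (2 * d)\<close>, with
  \<open>d\<close> positive and at least \<open>c\<close>, would be negative. Serves as the
  first-order condition at a maximum.\<close>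

lemma linear_coeff_eq_0_if_quadratic_nonneg:
  fixes b c :: real
  assumes "\<And>t. 0 \<le> t * b + t\<^sup>2 * c"
  shows "b = 0"
proof (rule ccontr)
  assume b: "b \<noteq> 0"
  define d where "d = \<bar>c\<bar> + 1"
  have d: "d > 0" "c \<le> d" by (auto simp: d_def)
  have "0 \<le> (- b / (2 * d)) * b + (- b / (2 * d))\<^sup>2 * c" by (rule assms)
  also have "\<dots> \<le> (- b / (2 * d)) * b + (- b / (2 * d))\<^sup>2 * d"
    using d by (intro add_left_mono mult_left_mono) auto
  also have "\<dots> = - (b\<^sup>2 / (4 * d))" using d by (simp add: field_simps power2_eq_square)
  finally have "b\<^sup>2 / (4 * d) \<le> 0" by simp
  moreover have "b\<^sup>2 / (4 * d) > 0" using b d by simp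
  ultimately show False by simp
qed

text \<open>A maximum point of the Rayleigh quotient on the unit sphere of \<open>V\<close> is an
  eigenvector.\<close>

lemma self_adjoint_has_eigenvector:
  fixes f :: "'a::euclidean_space \<Rightarrow> 'a"
  assumes V: "subspace V" "V \<noteq> {0}" and f: "linear f" "f ` V \<subseteq> V"
    and sa: "\<And>x y. x \<in> V \<Longrightarrow> y \<in> V \<Longrightarrow> f x \<bullet> y = x \<bullet> f y"
  shows "\<exists>v l. v \<in> V \<and> v \<noteq> 0 \<and> f v = l *\<^sub>R v"
proof -
  let ?S = "V \<inter> sphere 0 1"
  obtain u where u: "u \<in> V" "u \<noteq> 0" using V subspace_0 by blast
  then have "(1 / norm u) *\<^sub>R u \<in> ?S" using V(1) by (auto intro: subspace_scale)
  moreover have "compact ?S" using closed_subspace[OF V(1)] by (intro closed_Int_compact) auto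
  moreover have "continuous_on ?S (\<lambda>v. f v \<bullet> v)"
    by (intro continuous_on_inner linear_continuous_on continuous_on_id)
       (simp add: f linear_conv_bounded_linear[symmetric])
  ultimately obtain v where v: "v \<in> ?S" and max: "\<And>w. w \<in> ?S \<Longrightarrow> f w \<bullet> w \<le> f v \<bullet> v"
    using continuous_attains_sup[of ?S "\<lambda>v. f v \<bullet> v"] by blast
  define l where "l = f v \<bullet> v"
  have le: "f w \<bullet> w \<le> l * (w \<bullet> w)" if "w \<in> V" for w
  proof (cases "w = 0")
    case False
    let ?n = "1 / norm w"
    have "?n *\<^sub>R w \<in> ?S" using that V(1) False by (auto intro: subspace_scale)
    from max[OF this] have "?n * (?n * (f w \<bullet> w)) \<le> l"
      by (simp add: l_def linear_scale[OF f(1)])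
    with False show ?thesis by (simp add: field_simps dot_square_norm power2_eq_square)
  qed (simp add: linear_0[OF f(1)])
  have "l *\<^sub>R v - f v = 0"
  proof -
    \<comment> \<open>The residual of the eigenvalue equation is its own test direction: the first
      variation along \<open>w\<close> is \<open>2 * (w \<bullet> w)\<close>.\<close>
    define w where "w = l *\<^sub>R v - f v"
    have w: "w \<in> V" unfolding w_def using v f V by (intro subspace_diff subspace_scale) auto
    have "2 * (l * (v \<bullet> w) - f v \<bullet> w) = 0"
    proof (rule linear_coeff_eq_0_if_quadratic_nonneg)
      fix t :: real
      have "v + t *\<^sub>R w \<in> V" using v w V(1) by (auto intro: subspace_add subspace_scale)
      from le[OF this] have "0 \<le> l * ((v + t *\<^sub>R w) \<bullet> (v + t *\<^sub>R w)) - f (v + t *\<^sub>R w) \<bullet> (v + t *\<^sub>R w)"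
        by simp
      also have "\<dots> = t * (2 * (l * (v \<bullet> w) - f v \<bullet> w)) + t\<^sup>2 * (l * (w \<bullet> w) - f w \<bullet> w)
          + l * (v \<bullet> v) - f v \<bullet> v"
      proof -
        have c: "w \<bullet> v = v \<bullet> w" "f w \<bullet> v = f v \<bullet> w"
          using sa[of w v] v w by (simp_all add: inner_commute)
        show ?thesis
          by (simp add: linear_add[OF f(1)] linear_scale[OF f(1)] inner_add_left inner_add_right c
              distrib_left right_diff_distrib power2_eq_square)
      qed
      also have "l * (v \<bullet> v) = f v \<bullet> v" using v by (simp add: l_def dot_square_norm)
      finally show "0 \<le> t * (2 * (l * (v \<bullet> w) - f v \<bullet> w)) + t\<^sup>2 * (l * (w \<bullet> w) - f w \<bullet> w)"
        by simp
    qed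
    then have "w \<bullet> w = 0" by (simp add: w_def inner_diff_left inner_diff_right algebra_simps)
    then show ?thesis by (simp add: w_def)
  qed
  then have "f v = l *\<^sub>R v" by simp
  moreover have "v \<noteq> 0" using v by auto
  ultimately show ?thesis using v by blast
qed

text \<open>Invariance, self-adjointness and commutation are asked for on \<open>V\<close> only, so
  that invariant eigenspaces and orthogonal complements are again instances.\<close>

locale commuting_self_adjoint =
  fixes F :: "('a::euclidean_space \<Rightarrow> 'a) set" and V :: "'a set"
  assumes subspace_V: "subspace V"
    and linear_F: "f \<in> F \<Longrightarrow> linear f"
    and invariant: "f \<in> F \<Longrightarrow> f ` V \<subseteq> V"
    and self_adjoint: "f \<in> F \<Longrightarrow> x \<in> V \<Longrightarrow> y \<in> V \<Longrightarrow> f x \<bullet> y = x \<bullet> f y"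
    and commute: "f \<in> F \<Longrightarrow> g \<in> F \<Longrightarrow> x \<in> V \<Longrightarrow> f (g x) = g (f x)"
begin

definition joint_eigenvectors where
  "joint_eigenvectors = {v \<in> V. \<forall>f\<in>F. \<exists>l. f v = l *\<^sub>R v}"

lemma restrict:
  assumes "subspace W" "W \<subseteq> V" "\<And>f. f \<in> F \<Longrightarrow> f ` W \<subseteq> W"
  shows "commuting_self_adjoint F W"
proof (rule commuting_self_adjoint.intro)
  show "linear f" if "f \<in> F" for f using that by (rule linear_F)
  show "f ` W \<subseteq> W" if "f \<in> F" for f using that by (rule assms)
  show "f x \<bullet> y = x \<bullet> f y" if "f \<in> F" "x \<in> W" "y \<in> W" for f x y
    using that assms(2) by (intro self_adjoint) auto
  show "f (g x) = g (f x)" if "f \<in> F" "g \<in> F" "x \<in> W" for f g x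
    using that assms(2) by (intro commute) auto
qed (rule assms)

end

text \<open>Induction on the dimension: either every member of \<open>F\<close> is scalar on
  \<open>V\<close>, or one of them has a proper nonzero eigenspace, which the others preserve
  because they commute with it.\<close>

lemma commuting_self_adjoint_joint_eigenvector:
  assumes "commuting_self_adjoint F V" "V \<noteq> {0}"
  shows "\<exists>v\<in>V. v \<noteq> 0 \<and> (\<forall>f\<in>F. \<exists>l. f v = l *\<^sub>R v)"
  using assms
proof (induction "dim V" arbitrary: V rule: less_induct)
  case less
  interpret commuting_self_adjoint F V by fact
  show ?case
  proof (cases "\<forall>f\<in>F. \<exists>l. \<forall>v\<in>V. f v = l *\<^sub>R v")
    case True
    moreover obtain v where "v \<in> V" "v \<noteq> 0" using less(3) subspace_0[OF subspace_V] by auto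
    ultimately show ?thesis by meson
  next
    case False
    then obtain f where f: "f \<in> F" "\<And>l. \<exists>v\<in>V. f v \<noteq> l *\<^sub>R v" by meson
    obtain v l where v: "v \<in> V" "v \<noteq> 0" "f v = l *\<^sub>R v"
      using self_adjoint_has_eigenvector[OF subspace_V less(3) linear_F[OF f(1)]
        invariant[OF f(1)] self_adjoint[OF f(1)]] by blast
    define W where "W = {v \<in> V. f v = l *\<^sub>R v}"
    have W: "subspace W"
      unfolding W_def subspace_def
      using subspace_V linear_F[OF f(1)]
      by (auto simp: subspace_def linear_0 linear_add linear_scale scaleR_right_distrib)
    have "W \<subset> V" using f(2)[of l] by (auto simp: W_def)
    then have "dim W < dim V" using W subspace_V by (metis dim_psubset span_eq_iff)
    moreover have "commuting_self_adjoint F W"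
    proof (rule restrict[OF W])
      show "g ` W \<subseteq> W" if "g \<in> F" for g
      proof safe
        fix x assume "x \<in> W"
        then have x: "x \<in> V" "f x = l *\<^sub>R x" by (auto simp: W_def)
        have "f (g x) = l *\<^sub>R g x"
          using commute[OF f(1) that x(1)] linear_scale[OF linear_F[OF that]] x(2) by simp
        moreover have "g x \<in> V" using invariant[OF that] x(1) by blast
        ultimately show "g x \<in> W" by (simp add: W_def)
      qed
    qed (auto simp: W_def)
    moreover have "W \<noteq> {0}" using v by (auto simp: W_def)
    ultimately obtain w where "w \<in> W" "w \<noteq> 0" "\<forall>f\<in>F. \<exists>l. f w = l *\<^sub>R w"
      using less.hyps[of W] by auto
    then show ?thesis unfolding W_def by blast
  qed
qed

context commuting_self_adjoint begin

lemma orthogonal_complement_eigenvectors: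
  assumes "E \<subseteq> joint_eigenvectors"
  shows "commuting_self_adjoint F {v \<in> V. \<forall>e\<in>E. v \<bullet> e = 0}"
proof (rule restrict)
  show "subspace {v \<in> V. \<forall>e\<in>E. v \<bullet> e = 0}"
    using subspace_V by (auto simp: subspace_def inner_add_left)
  show "f ` {v \<in> V. \<forall>e\<in>E. v \<bullet> e = 0} \<subseteq> {v \<in> V. \<forall>e\<in>E. v \<bullet> e = 0}" if "f \<in> F" for f
  proof safe
    fix v assume v: "v \<in> V" "\<forall>e\<in>E. v \<bullet> e = 0"
    show "f v \<in> V" using invariant[OF that] v by blast
    fix e assume e: "e \<in> E"
    then have "e \<in> joint_eigenvectors" using assms by blast
    then obtain l where l: "f e = l *\<^sub>R e" "e \<in> V"
      using \<open>f \<in> F\<close> unfolding joint_eigenvectors_def by blast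
    have "f v \<bullet> e = v \<bullet> f e" by (rule self_adjoint[OF that v(1) l(2)])
    also have "\<dots> = 0" using l v e by simp
    finally show "f v \<bullet> e = 0" .
  qed
qed auto

text \<open>The orthogonal complement of the joint eigenvectors is invariant; if it were nonzero, it
  would contain a joint eigenvector orthogonal to itself.\<close>

lemma span_joint_eigenvectors: "span joint_eigenvectors = V"
proof
  let ?E = joint_eigenvectors
  show "span ?E \<subseteq> V" unfolding joint_eigenvectors_def by (intro span_minimal subspace_V) blast
  let ?W = "{v \<in> V. \<forall>e\<in>?E. v \<bullet> e = 0}"
  have W: "?W = {0}"
  proof (rule ccontr)
    assume "?W \<noteq> {0}"
    then obtain v where "v \<in> ?W" "v \<noteq> 0" "\<forall>f\<in>F. \<exists>l. f v = l *\<^sub>R v"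
      using commuting_self_adjoint_joint_eigenvector[OF orthogonal_complement_eigenvectors[OF order_refl]]
      by blast
    then have "v \<in> ?E" unfolding joint_eigenvectors_def by blast
    with \<open>v \<in> ?W\<close> have "v \<bullet> v = 0" by blast
    with \<open>v \<noteq> 0\<close> show False by simp
  qed
  show "V \<subseteq> span ?E"
  proof
    fix x assume x: "x \<in> V"
    obtain y z where yz: "y \<in> span ?E" "\<And>w. w \<in> span ?E \<Longrightarrow> orthogonal z w" "x = y + z"
      using orthogonal_subspace_decomp_exists[of ?E x] by metis
    have "x - y \<in> V" using yz x \<open>span ?E \<subseteq> V\<close> by (intro subspace_diff[OF subspace_V]) auto
    then have "z \<in> V" using yz(3) by simp
    moreover have "z \<bullet> e = 0" if "e \<in> ?E" for e
      using yz(2)[OF span_base[OF that]] by (simp add: orthogonal_def)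
    ultimately have "z \<in> ?W" by blast
    then have "z = 0" using W by blast
    then show "x \<in> span ?E" using yz by simp
  qed
qed

end

section \<open>Diagonal matrices, the spectral theorem and inner products\<close>

definition diagm :: "('n \<Rightarrow> real) \<Rightarrow> real^'n^'n" where
  "diagm x = (\<chi> i j. if i = j then x i else 0)"

lemma diagm_mult_nth [simp]: "(diagm x ** M) $ i $ j = x i * M $ i $ j"
  by (simp add: diagm_def matrix_matrix_mult_def if_distrib[of "\<lambda>a. a * _"] cong: if_cong)

lemma mult_diagm_nth [simp]: "(M ** diagm x) $ i $ j = M $ i $ j * x j"
  by (simp add: diagm_def matrix_matrix_mult_def if_distrib[of "\<lambda>a. _ * a"] cong: if_cong)

lemma diagm_mult_diagm: "diagm x ** diagm y = diagm (\<lambda>i. x i * y i)"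
  by (simp add: vec_eq_iff) (simp add: diagm_def)

lemma transpose_diagm [simp]: "transpose (diagm x) = diagm x"
  by (auto simp: diagm_def transpose_def vec_eq_iff)

lemma trace_diagm: "trace (diagm x) = sum x UNIV"
  by (simp add: trace_def diagm_def)

lemma diagm_one [simp]: "diagm (\<lambda>_. 1) = mat 1"
  by (simp add: diagm_def mat_def)

text \<open>A largest orthonormal set of eigenvectors spans, since its orthogonal complement is
  invariant and a further unit eigenvector there could be adjoined. The rows of \<open>R\<close>
  form such a set.\<close>

theorem symmetric_matrix_diagonalization:
  fixes M :: "real^'n^'n"
  assumes "transpose M = M"
  obtains R :: "real^'n^'n" and x where "transpose R ** R = mat 1" "R ** transpose R = mat 1" "M = transpose R ** diagm x ** R"
proof -
  let ?e = "\<lambda>v. \<exists>l. M *v v = l *\<^sub>R v"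
  have sa: "(M *v v) \<bullet> w = v \<bullet> (M *v w)" for v w
    using dot_lmul_matrix[of v M w] vector_transpose_matrix[of v M] assms by simp
  interpret commuting_self_adjoint "{(*v) M}" UNIV
    by (rule commuting_self_adjoint.intro) (auto simp: sa)
  define ONS where "ONS = {U. (\<forall>v\<in>U. norm v = 1 \<and> ?e v) \<and> pairwise orthogonal U}"
  have bound: "finite U \<and> card U \<le> CARD('n)" if "U \<in> ONS" for U
  proof -
    have "0 \<notin> U" using that by (auto simp: ONS_def)
    then have "independent U" using that pairwise_orthogonal_independent by (auto simp: ONS_def)
    from independent_bound[OF this] show ?thesis by simp
  qed
  have ONS0: "{} \<in> ONS" by (simp add: ONS_def)
  have "\<exists>U. U \<in> ONS \<and> (\<forall>U'. U' \<in> ONS \<longrightarrow> card U' \<le> card U)"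
    using bound by (intro ex_has_greatest_nat[where P="\<lambda>U. U \<in> ONS" and b="Suc CARD('n)", OF ONS0]) (auto simp: le_imp_less_Suc)
  then obtain U where U: "U \<in> ONS" and max: "\<And>U'. U' \<in> ONS \<Longrightarrow> card U' \<le> card U"
    by auto
  let ?W = "{v \<in> UNIV. \<forall>e\<in>U. v \<bullet> e = 0}"
  have W: "?W = {0}"
  proof (rule ccontr)
    assume "?W \<noteq> {0}"
    moreover have "U \<subseteq> joint_eigenvectors" using U by (auto simp: ONS_def joint_eigenvectors_def)
    ultimately obtain v where v: "v \<in> ?W" "v \<noteq> 0" "?e v"
      using commuting_self_adjoint_joint_eigenvector[OF orthogonal_complement_eigenvectors[of U]] by auto
    define u where "u = (1 / norm v) *\<^sub>R v"
    have nu: "norm u = 1" and eu: "?e u"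
      using v by (auto simp: u_def matrix_vector_mult_scaleR)
    have ou: "orthogonal u e" "orthogonal e u" if "e \<in> U" for e
      using v(1) that by (auto simp: u_def orthogonal_def inner_commute)
    have "u \<notin> U" using ou[of u] nu by (auto simp: orthogonal_def)
    moreover have "insert u U \<in> ONS"
      using U nu eu ou by (auto simp: ONS_def pairwise_insert)
    ultimately show False using max[of "insert u U"] bound[OF U] by simp
  qed
  have "span U = UNIV"
  proof -
    have "x \<in> span U" for x
    proof -
      obtain y z where yz: "y \<in> span U" "\<And>w. w \<in> span U \<Longrightarrow> orthogonal z w" "x = y + z"
        using orthogonal_subspace_decomp_exists[of U x] by metis
      have "z \<bullet> e = 0" if "e \<in> U" for e
        using yz(2)[OF span_base[OF that]] by (simp add: orthogonal_def)
      then have "z \<in> ?W" by blast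
      then have "z = 0" using W by blast
      then show ?thesis using yz by simp
    qed
    then show ?thesis by auto
  qed
  then have "CARD('n) \<le> card U" using bound[OF U] dim_le_card[of UNIV U] by simp
  then have "card U = CARD('n)" using bound[OF U] by simp
  then obtain b where b: "bij_betw b (UNIV :: 'n set) U"
    using bound[OF U] by (metis finite_same_card_bij finite)
  then have bO: "b i \<in> U" for i by (auto simp: bij_betw_def)
  then have "\<forall>i. \<exists>l. M *v b i = l *\<^sub>R b i" using U by (auto simp: ONS_def)
  then obtain x where x: "\<And>i. M *v b i = x i *\<^sub>R b i" by metis
  define R :: "real^'n^'n" where "R = (\<chi> i. b i)"
  have bb: "b i \<bullet> b j = (if i = j then 1 else 0)" for i j
  proof (cases "i = j")
    case True
    then show ?thesis using U bO by (auto simp: ONS_def dot_square_norm)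
  next
    case False
    then have "b i \<noteq> b j" using b by (auto simp: bij_betw_def inj_def)
    then show ?thesis using U bO False by (auto simp: ONS_def pairwise_def orthogonal_def)
  qed
  have RR: "R ** transpose R = mat 1"
    by (simp add: matrix_mult_transpose_dot_row row_def R_def mat_def vec_eq_iff bb)
  then have RR': "transpose R ** R = mat 1" using matrix_left_right_inverse by blast
  have "M ** transpose R = transpose R ** diagm x"
  proof -
    have "(M ** transpose R) $ i $ j = (M *v b j) $ i" for i j
      by (simp add: matrix_matrix_mult_def matrix_vector_mult_def transpose_def R_def)
    then show ?thesis by (simp add: vec_eq_iff x transpose_def R_def)
  qed
  then have "M = transpose R ** diagm x ** R"
    by (metis RR' matrix_mul_assoc matrix_mul_rid)
  with RR RR' show ?thesis using that by blast
qed

lemma inner_transpose_mult: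
  fixes M :: "real^'n^'m"
  shows "v \<bullet> (transpose M *v w) = (M *v v) \<bullet> w"
  by (metis dot_lmul_matrix vector_transpose_matrix)

text \<open>The Gram matrix \<open>P\<close> is diagonalised; the square roots of its eigenvalues,
  which are positive, turn the orthogonal matrix \<open>R\<close> into the change of basis
  \<open>S\<close> with \<open>P = transpose S ** S\<close>.\<close>

lemma inner_product_eq_inner:
  fixes B :: "real^'n \<Rightarrow> real^'n \<Rightarrow> real"
  assumes "inner_product B"
  obtains S Si :: "real^'n^'n" where "S ** Si = mat 1" "Si ** S = mat 1" "\<And>v w. B v w = (S *v v) \<bullet> (S *v w)"
proof -
  have bil: "bilinear B" and sym: "\<And>v w. B v w = B w v" and pos: "\<And>v. v \<noteq> 0 \<Longrightarrow> B v v > 0"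
    using assms by (auto simp: inner_product_def)
  define P :: "real^'n^'n" where "P = (\<chi> i j. B (axis i 1) (axis j 1))"
  have BP: "B v w = v \<bullet> (P *v w)" for v w
  proof -
    have "B v w = B (\<Sum>i\<in>UNIV. v $ i *\<^sub>R axis i 1) (\<Sum>j\<in>UNIV. w $ j *\<^sub>R axis j 1)"
      by (simp add: basis_expansion flip: scalar_mult_eq_scaleR)
    also have "\<dots> = (\<Sum>i\<in>UNIV. v $ i * (\<Sum>j\<in>UNIV. P $ i $ j * w $ j))"
      unfolding bilinear_sum[OF bil] sum.cartesian_product[symmetric]
      by (simp add: bilinear_lmul[OF bil] bilinear_rmul[OF bil] P_def sum_distrib_left mult_ac)
    finally show ?thesis by (simp add: inner_vec_def matrix_vector_mult_def)
  qed
  have "P $ j $ i = P $ i $ j" for i j by (simp add: P_def) (rule sym)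
  then have "transpose P = P" by (simp add: transpose_def vec_eq_iff)
  then obtain R :: "real^'n^'n" and x where R: "transpose R ** R = mat 1" "R ** transpose R = mat 1" "P = transpose R ** diagm x ** R"
    by (rule symmetric_matrix_diagonalization)
  have x: "x i > 0" for i
  proof -
    \<comment> \<open>An eigenvector of the Gram matrix for \<open>x i\<close>, on which the
      quadratic form takes the value \<open>x i\<close>.\<close>
    define v where "v = transpose R *v axis i 1"
    have Rv: "R *v v = axis i 1" unfolding v_def matrix_vector_mul_assoc R by simp
    then have "v \<noteq> 0" by (metis axis_eq_0_iff matrix_vector_mult_0_right zero_neq_one)
    have "B v v = (R *v v) \<bullet> (diagm x *v (R *v v))"
      unfolding BP R(3) matrix_vector_mul_assoc[symmetric] inner_transpose_mult ..
    also have "\<dots> = x i"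
      by (simp add: Rv inner_axis' matrix_vector_mult_basis column_def diagm_def)
    finally show ?thesis using pos[OF \<open>v \<noteq> 0\<close>] by simp
  qed
  define S where "S = diagm (\<lambda>i. sqrt (x i)) ** R"
  define Si where "Si = transpose R ** diagm (\<lambda>i. 1 / sqrt (x i))"
  have "x i \<noteq> 0" for i using x[of i] by simp
  then have dd: "diagm (\<lambda>i. sqrt (x i)) ** diagm (\<lambda>i. 1 / sqrt (x i)) = mat 1"
    by (simp add: diagm_mult_diagm)
  have "S ** Si = diagm (\<lambda>i. sqrt (x i)) ** (R ** transpose R) ** diagm (\<lambda>i. 1 / sqrt (x i))"
    by (simp only: S_def Si_def matrix_mul_assoc)
  then have 1: "S ** Si = mat 1" by (simp add: R dd)
  then have 2: "Si ** S = mat 1" using matrix_left_right_inverse by blast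
  have "x i = sqrt (x i) * sqrt (x i)" for i using x[of i] by simp
  then have "diagm x = diagm (\<lambda>i. sqrt (x i)) ** diagm (\<lambda>i. sqrt (x i))"
    by (simp add: diagm_mult_diagm)
  then have "P = transpose S ** S"
    by (simp add: R(3) S_def matrix_transpose_mul matrix_mul_assoc)
  then have "B v w = (S *v v) \<bullet> (S *v w)" for v w
    unfolding BP \<open>P = transpose S ** S\<close> matrix_vector_mul_assoc[symmetric] inner_transpose_mult by simp
  with 1 2 that show ?thesis by blast
qed

section \<open>Adjoints\<close>

lemma inner_eq_trace: "(A :: real^'n^'n) \<bullet> B = trace (A ** transpose B)"
  by (simp add: inner_vec_def trace_def matrix_matrix_mult_def transpose_def)

lemma trace_scaleR: "trace (c *\<^sub>R (A :: real^'n^'n)) = c * trace A"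
  by (simp add: trace_def sum_distrib_left)

lemma trace_transpose: "trace (transpose A) = trace A"
  by (simp add: trace_def transpose_def)

lemma bounded_linear_trace: "bounded_linear (trace :: real^'n^'n \<Rightarrow> real)"
  by (rule linear_conv_bounded_linear[THEN iffD1]) (simp add: linear_iff trace_add trace_scaleR)

lemma trace_conj:
  fixes J :: "real^'n^'n"
  assumes "Ji ** J = mat 1"
  shows "trace (J ** M ** Ji) = trace M"
  using trace_mul_sym[of "J ** M" Ji] by (simp add: matrix_mul_assoc assms)

lemma mexp_diagm: "mexp (diagm x) = diagm (\<lambda>i. exp (x i))"
proof -
  have "diagm x *v axis j 1 = x j *\<^sub>R axis j 1" for j
    by (auto simp: diagm_def vec_eq_iff axis_def matrix_vector_mult_def if_distrib[of "\<lambda>a. _ * a"] cong: if_cong)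
  then have "mexp (diagm x) *v axis j 1 = exp (x j) *\<^sub>R axis j 1" for j
    by (rule mexp_eigenvector)
  then have "column j (mexp (diagm x)) $ i = (exp (x j) *\<^sub>R axis j 1) $ i" for i j
    by (simp add: matrix_vector_mult_basis)
  then show ?thesis
    by (simp add: column_def diagm_def vec_eq_iff axis_def)
qed

lemma mexp_conj_diagm:
  fixes J Ji :: "real^'n^'n"
  assumes "J ** Ji = mat 1" "Ji ** J = mat 1"
  shows "mexp (J ** diagm x ** Ji) = J ** diagm (\<lambda>i. exp (x i)) ** Ji"
  by (simp add: mexp_conj[OF assms] mexp_diagm)

section \<open>Inverse matrices\<close>

lemma
  fixes A :: "real^'n^'n"
  assumes "invertible A"
  shows matrix_inv_right: "A ** matrix_inv A = mat 1" and matrix_inv_left: "matrix_inv A ** A = mat 1"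
proof -
  have "A ** matrix_inv A = mat 1 \<and> matrix_inv A ** A = mat 1"
    unfolding matrix_inv_def by (rule someI_ex) (use assms in \<open>simp add: invertible_def\<close>)
  then show "A ** matrix_inv A = mat 1" "matrix_inv A ** A = mat 1" by auto
qed

lemma matrix_inv_eq:
  fixes A B :: "real^'n^'n"
  assumes "A ** B = mat 1"
  shows "matrix_inv A = B"
proof -
  have "invertible A" using assms matrix_left_right_inverse unfolding invertible_def by blast
  then have "matrix_inv A ** A = mat 1" by (rule matrix_inv_left)
  then have "matrix_inv A = matrix_inv A ** (A ** B)" by (simp add: assms)
  also have "\<dots> = B" by (simp add: matrix_mul_assoc \<open>matrix_inv A ** A = mat 1\<close>)
  finally show ?thesis .
qed

lemma invertible_if_right_inverse:
  fixes A B :: "real^'n^'n"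
  assumes "A ** B = mat 1"
  shows "invertible A"
  using assms matrix_left_right_inverse unfolding invertible_def by blast

lemma continuous_on_det: "continuous_on UNIV (det :: real^'n^'n \<Rightarrow> real)"
  unfolding det_def by (intro continuous_intros)

lemma open_invertible: "open {A :: real^'n^'n. invertible A}"
proof -
  have "{A :: real^'n^'n. invertible A} = det -` (- {0})" by (auto simp: invertible_det_nz)
  then show ?thesis using open_vimage[OF open_Compl[OF closed_singleton] continuous_on_det] by simp
qed

text \<open>The identity \<open>matrix_inv A - h = matrix_inv A ** (a - A) ** h\<close> is used
  twice: it bounds the inverse by \<open>2 * norm h\<close> once \<open>c k < 1/2\<close>, and with
  this bound it gives the convergence.\<close>

lemma tendsto_matrix_inv:
  fixes g :: "nat \<Rightarrow> real^'n^'n"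
  assumes g: "g \<longlonglongrightarrow> a" and a: "invertible a"
  shows "(\<lambda>k. matrix_inv (g k)) \<longlonglongrightarrow> matrix_inv a"
proof -
  have "\<exists>K>0. \<forall>(A :: real^'n^'n) (B :: real^'n^'n). norm (A ** B) \<le> norm A * norm B * K"
    by (rule mm.pos_bounded)
  then obtain K where K0: "K > 0" and K: "\<And>(A :: real^'n^'n) (B :: real^'n^'n). norm (A ** B) \<le> norm A * norm B * K"
    by auto
  define h where "h = matrix_inv a"
  have inv: "\<forall>\<^sub>F k in sequentially. invertible (g k)"
    using topological_tendstoD[OF g open_invertible] a by auto
  have eq: "matrix_inv A - h = matrix_inv A ** (a - A) ** h" if "invertible A" for A
  proof -
    have "matrix_inv A ** (a - A) ** h = matrix_inv A ** (a ** h) - (matrix_inv A ** A) ** h"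
      by (simp only: mat_ring)
    then show ?thesis by (simp add: h_def matrix_inv_left[OF that] matrix_inv_right[OF a])
  qed
  define c where "c k = norm (a - g k) * (K * (norm h * K))" for k
  have c0: "c \<longlonglongrightarrow> 0"
  proof -
    have "c \<longlonglongrightarrow> norm (a - a) * (K * (norm h * K))" unfolding c_def by (intro tendsto_intros g)
    then show ?thesis by simp
  qed
  have "\<forall>\<^sub>F k in sequentially. c k < 1/2" using order_tendstoD(2)[OF c0, of "1/2"] by simp
  with inv have "\<forall>\<^sub>F k in sequentially. norm (matrix_inv (g k) - h) \<le> 2 * norm h * c k"
  proof eventually_elim
    case (elim k)
    let ?i = "matrix_inv (g k)"
    have "norm (?i - h) \<le> norm (?i ** (a - g k)) * norm h * K"
      unfolding eq[OF elim(1)] by (rule K)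
    also have "\<dots> \<le> (norm ?i * norm (a - g k) * K) * norm h * K"
      by (intro mult_right_mono K) (use K0 in auto)
    also have "\<dots> = norm ?i * c k" by (simp add: c_def)
    finally have 1: "norm (?i - h) \<le> norm ?i * c k" .
    have "c k \<ge> 0" using K0 by (simp add: c_def)
    have "norm ?i \<le> norm h + norm (?i - h)" using norm_triangle_ineq[of h "?i - h"] by simp
    also have "norm (?i - h) \<le> norm ?i * (1/2)"
      using 1 mult_left_mono[of "c k" "1/2" "norm ?i"] elim by simp
    finally have "norm ?i \<le> 2 * norm h" by simp
    then have "norm ?i * c k \<le> 2 * norm h * c k" using \<open>c k \<ge> 0\<close> by (rule mult_right_mono)
    with 1 show ?case by simp
  qed
  moreover have "(\<lambda>k. 2 * norm h * c k) \<longlonglongrightarrow> 0" using tendsto_mult_left[OF c0, of "2 * norm h"] by simp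
  ultimately have "(\<lambda>k. matrix_inv (g k) - h) \<longlonglongrightarrow> 0" by (rule Lim_null_comparison)
  then show ?thesis by (simp add: h_def LIM_zero_iff)
qed

text \<open>\<open>S\<close> stands for an inner product, namely
  \<open>(S *v v) \<bullet> (S *v w)\<close>. In this picture \<open>cj\<close> passes to an
  orthonormal basis, where \<open>star\<close> becomes the transpose.\<close>

locale adjoint =
  fixes S Si :: "real^'n^'n"
  assumes S_Si: "S ** Si = mat 1" and Si_S: "Si ** S = mat 1"
begin

definition cj :: "real^'n^'n \<Rightarrow> real^'n^'n" where "cj M = S ** M ** Si"

definition star :: "real^'n^'n \<Rightarrow> real^'n^'n" where "star M = Si ** transpose (cj M) ** S"

text \<open>The Hilbert-Schmidt inner product in the orthonormal basis, see \<open>ip_eq\<close>;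
  the trace form is the one suited to cyclic permutation and conjugation.\<close>

definition ip :: "real^'n^'n \<Rightarrow> real^'n^'n \<Rightarrow> real" where "ip M N = trace (M ** star N)"

text \<open>\<open>matrix_mul_assoc\<close> brackets products to the left, which hides the pair
  \<open>S ** Si\<close>; hence the extra factor \<open>M\<close>.\<close>

lemma cancel [simp]: "M ** S ** Si = M" "M ** Si ** S = M"
  by (metis S_Si Si_S matrix_mul_assoc matrix_mul_rid)+

lemma cj_mult: "cj (X ** Y) = cj X ** cj Y"
proof -
  have "cj X ** cj Y = S ** X ** (Si ** S) ** Y ** Si" by (simp only: cj_def matrix_mul_assoc)
  then show ?thesis by (simp add: Si_S cj_def matrix_mul_assoc)
qed

lemma cj_star: "cj (star X) = transpose (cj X)"
  by (simp add: cj_def star_def matrix_mul_assoc S_Si)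

lemma linear_cj: "linear cj"
  by (simp add: linear_iff cj_def mat_ring)

lemma cj_inj: "cj X = cj Y \<longleftrightarrow> X = Y"
  by (metis cj_def cancel(2) Si_S matrix_mul_assoc matrix_mul_lid)

lemma cj_one: "cj (mat 1) = mat 1" by (simp add: cj_def S_Si)

lemma star_mult: "star (X ** Y) = star Y ** star X"
  by (simp add: cj_mult cj_star matrix_transpose_mul flip: cj_inj)

lemma star_star [simp]: "star (star X) = X"
  by (simp add: cj_star flip: cj_inj)

lemma star_one [simp]: "star (mat 1) = mat 1"
  by (simp add: cj_star cj_one flip: cj_inj)

lemma linear_star: "linear star"
proof -
  have "cj (star (X + Y)) = cj (star X + star Y)" "cj (star (c *\<^sub>R X)) = cj (c *\<^sub>R star X)" for X Y c
    by (simp_all add: cj_star linear_add[OF linear_cj] linear_scale[OF linear_cj]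
        linear_add[OF linear_transpose] linear_scale[OF linear_transpose])
  then show ?thesis by (simp add: linear_iff cj_inj)
qed

lemmas star_add = linear_add[OF linear_star]
lemmas star_diff = linear_diff[OF linear_star]
lemmas star_minus = linear_neg[OF linear_star]
lemmas star_scaleR = linear_scale[OF linear_star]
lemmas star_0 = linear_0[OF linear_star]
lemmas star_simps = star_mult star_add star_diff star_minus star_scaleR star_0

lemma bounded_linear_star: "bounded_linear star"
  using linear_star by (simp add: linear_conv_bounded_linear)

lemmas tendsto_star = bounded_linear.tendsto[OF bounded_linear_star]

lemma trace_star [simp]: "trace (star X) = trace X"
  by (simp add: star_def cj_def trace_conj[OF S_Si] trace_transpose trace_conj[OF Si_S])

lemma ip_eq: "ip M N = cj M \<bullet> cj N"
  by (simp add: ip_def inner_eq_trace cj_star[symmetric] cj_mult[symmetric])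
     (simp add: cj_def trace_conj[OF Si_S])

lemma ip_pos: "X \<noteq> 0 \<Longrightarrow> ip X X > 0"
  by (simp add: ip_eq) (metis cj_inj linear_0[OF linear_cj])

lemma ip_nonneg: "ip X X \<ge> 0" by (simp add: ip_eq)

lemma ip_eq_0_iff [simp]: "ip X X = 0 \<longleftrightarrow> X = 0"
  using ip_pos[of X] by (auto simp: ip_eq linear_0[OF linear_cj])

lemma ip_commute: "ip X Y = ip Y X" by (simp add: ip_eq inner_commute)

lemma ip_diff_left: "ip (X - Y) Z = ip X Z - ip Y Z"
  by (simp add: ip_def mm.diff_left trace_sub)

lemma ip_add_left: "ip (X + Y) Z = ip X Z + ip Y Z"
  by (simp add: ip_def mm.add_left trace_add)

lemma ip_scaleR_left: "ip (c *\<^sub>R X) Z = c * ip X Z"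
  by (simp add: ip_def mm.scaleR_left trace_scaleR)

lemma ip_cauchy_schwarz: "ip X Y \<le> sqrt (ip X X) * sqrt (ip Y Y)"
  by (simp add: ip_eq norm_eq_sqrt_inner[symmetric] norm_cauchy_schwarz)

lemma ip_star: "ip (star X) (star Y) = ip X Y"
  by (metis ip_commute ip_def star_star trace_mul_sym)

lemma star_mexp: "star (mexp X) = mexp (star X)"
  unfolding star_def cj_def
  by (simp add: mexp_conj[OF S_Si Si_S, symmetric] mexp_transpose[symmetric] mexp_conj[OF Si_S S_Si])

lemma star_matrix_inv: "invertible g \<Longrightarrow> star (matrix_inv g) = matrix_inv (star g)"
  by (rule matrix_inv_eq[symmetric]) (metis matrix_inv_left star_mult star_one)

text \<open>The spectral theorem carried back through \<open>S\<close>. The last two conclusions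
  record that the eigenbasis is orthonormal: every matrix diagonal in it is self-adjoint, and
  \<open>star g ** g\<close> turns into an ordinary Gram matrix.\<close>

lemma self_adjoint_diagonalization:
  assumes "star X = X"
  obtains J Ji :: "real^'n^'n" and x where
    "J ** Ji = mat 1" "Ji ** J = mat 1" "X = J ** diagm x ** Ji"
    "\<forall>y. star (J ** diagm y ** Ji) = J ** diagm y ** Ji"
    "\<forall>g. Ji ** (star g ** g) ** J = transpose (S ** g ** J) ** (S ** g ** J)"
proof -
  have "transpose (cj X) = cj X" using assms by (metis cj_star)
  then obtain R :: "real^'n^'n" and x where R: "transpose R ** R = mat 1" "R ** transpose R = mat 1"
    "cj X = transpose R ** diagm x ** R"
    by (rule symmetric_matrix_diagonalization)
  define J where "J = Si ** transpose R"
  define Ji where "Ji = R ** S"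
  have "J ** Ji = Si ** (transpose R ** R) ** S" by (simp only: J_def Ji_def matrix_mul_assoc)
  then have JJ: "J ** Ji = mat 1" by (simp add: R Si_S)
  have "Ji ** J = R ** (S ** Si) ** transpose R" by (simp only: J_def Ji_def matrix_mul_assoc)
  then have JJ': "Ji ** J = mat 1" by (simp add: R S_Si)
  have cjd: "cj (J ** diagm y ** Ji) = transpose R ** diagm y ** R" for y
    by (simp add: cj_def J_def Ji_def matrix_mul_assoc S_Si)
  have 1: "X = J ** diagm x ** Ji" by (simp add: cjd R flip: cj_inj)
  have 2: "star (J ** diagm y ** Ji) = J ** diagm y ** Ji" for y
    by (simp add: cj_star cjd matrix_transpose_mul matrix_mul_assoc flip: cj_inj)
  have 3: "Ji ** (star g ** g) ** J = transpose (S ** g ** J) ** (S ** g ** J)" for g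
    by (simp add: Ji_def J_def star_def cj_def matrix_transpose_mul matrix_mul_assoc S_Si)
  show ?thesis using that[OF JJ JJ' 1] 2 3 by blast
qed

text \<open>The positive definite self-adjoint matrices, presented as exponentials so that
  logarithms and square roots are at hand.\<close>

definition Pos :: "(real^'n^'n) set" where "Pos = mexp ` {X. star X = X}"

text \<open>In an eigenbasis the eigenvalues are the squared lengths of the columns of the
  invertible matrix \<open>h\<close>, so they have logarithms.\<close>

lemma star_mult_in_Pos:
  assumes "invertible g"
  shows "star g ** g \<in> Pos"
proof -
  have "star (star g ** g) = star g ** g" by (simp add: star_mult)
  then obtain J Ji :: "real^'n^'n" and x where J: "J ** Ji = mat 1" "Ji ** J = mat 1"
    "star g ** g = J ** diagm x ** Ji" "\<forall>y. star (J ** diagm y ** Ji) = J ** diagm y ** Ji"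
    and g: "\<forall>g. Ji ** (star g ** g) ** J = transpose (S ** g ** J) ** (S ** g ** J)"
    by (rule self_adjoint_diagonalization)
  define h where "h = S ** g ** J"
  have "Ji ** (star g ** g) ** J = (Ji ** J) ** diagm x ** (Ji ** J)"
    unfolding J(3) by (simp only: matrix_mul_assoc)
  then have hh: "transpose h ** h = diagm x" by (simp add: J(2) g h_def)
  have "invertible h" unfolding h_def
    using assms J S_Si by (intro invertible_mult) (auto intro: invertible_if_right_inverse)
  have "x i > 0" for i
  proof -
    have "x i = column i h \<bullet> column i h"
      using arg_cong[OF hh, of "\<lambda>M. M $ i $ i"]
      by (simp add: matrix_mult_transpose_dot_column diagm_def)
    moreover have "column i h \<noteq> 0"
    proof
      assume "column i h = 0"
      then have "h *v axis i 1 = 0" by (simp add: matrix_vector_mult_basis)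
      then have "matrix_inv h *v (h *v axis i 1) = 0" by simp
      then have "axis i (1::real) = 0"
        unfolding matrix_vector_mul_assoc matrix_inv_left[OF \<open>invertible h\<close>] by simp
      then show False by (simp add: axis_eq_0_iff)
    qed
    ultimately show ?thesis by simp
  qed
  then have "star g ** g = mexp (J ** diagm (\<lambda>i. ln (x i)) ** Ji)"
    by (simp add: mexp_conj_diagm[OF J(1,2)] J(3))
  then show ?thesis using J(4) by (auto simp: Pos_def)
qed

text \<open>The change of eigenbasis \<open>C\<close> intertwines the exponentiated eigenvalues.
  Entrywise, a nonzero entry of \<open>C\<close> forces \<open>exp (x i) = exp (y j)\<close>, so
  \<open>C\<close> intertwines the eigenvalues themselves.\<close>

lemma mexp_inj_self_adjoint:
  assumes X: "star X = X" and Y: "star Y = Y" and eq: "mexp X = mexp Y"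
  shows "X = Y"
proof -
  obtain J Ji :: "real^'n^'n" and x where J: "J ** Ji = mat 1" "Ji ** J = mat 1" "X = J ** diagm x ** Ji"
    using self_adjoint_diagonalization[OF X] by metis
  obtain K Ki :: "real^'n^'n" and y where K: "K ** Ki = mat 1" "Ki ** K = mat 1" "Y = K ** diagm y ** Ki"
    using self_adjoint_diagonalization[OF Y] by metis
  define C where "C = Ji ** K"
  have eq': "J ** diagm (\<lambda>i. exp (x i)) ** Ji = K ** diagm (\<lambda>i. exp (y i)) ** Ki"
    using eq by (simp add: J(3) K(3) mexp_conj_diagm J(1,2) K(1,2))
  have "diagm (\<lambda>i. exp (x i)) ** C = Ji ** (J ** diagm (\<lambda>i. exp (x i)) ** Ji) ** K"
    by (simp add: C_def matrix_mul_assoc J)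
  also have "\<dots> = Ji ** K ** diagm (\<lambda>i. exp (y i)) ** (Ki ** K)"
    unfolding eq' by (simp only: matrix_mul_assoc)
  also have "\<dots> = C ** diagm (\<lambda>i. exp (y i))" by (simp add: C_def K)
  finally have e: "exp (x i) * C $ i $ j = C $ i $ j * exp (y j)" for i j
    by (metis diagm_mult_nth mult_diagm_nth)
  have "diagm x ** C = C ** diagm y"
  proof -
    have "x i * C $ i $ j = C $ i $ j * y j" for i j
      using e[of i j] by (cases "C $ i $ j = 0") (auto simp: mult.commute)
    then show ?thesis by (simp add: vec_eq_iff)
  qed
  then have "J ** (diagm x ** C) ** Ki = J ** (C ** diagm y) ** Ki" by simp
  moreover have "J ** (diagm x ** C) ** Ki = X ** (K ** Ki)"
    by (simp only: C_def J(3) matrix_mul_assoc)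
  moreover have "J ** (C ** diagm y) ** Ki = (J ** Ji) ** Y"
    by (simp only: C_def K(3) matrix_mul_assoc)
  ultimately show ?thesis by (simp add: J K)
qed

lemma mexp_half: "mexp ((1/2) *\<^sub>R X) ** mexp ((1/2) *\<^sub>R X) = mexp X"
  using mexp_add_scaleR[of "1/2" "1/2" X] by simp

lemma Pos_sqrt:
  assumes "q \<in> Pos" obtains x where "x \<in> Pos" "x ** x = q"
proof -
  obtain X where X: "star X = X" "q = mexp X" using assms by (auto simp: Pos_def)
  then have "star ((1/2) *\<^sub>R X) = (1/2) *\<^sub>R X" by (simp add: star_scaleR)
  then have "mexp ((1/2) *\<^sub>R X) \<in> Pos" unfolding Pos_def by blast
  then show ?thesis using that X mexp_half by blast
qed

lemma Pos_sqrt_unique: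
  assumes "x \<in> Pos" "y \<in> Pos" "x ** x = y ** y"
  shows "x = y"
proof -
  obtain X Y where X: "star X = X" "x = mexp X" and Y: "star Y = Y" "y = mexp Y"
    using assms by (auto simp: Pos_def)
  have "mexp (2 *\<^sub>R Z) = mexp Z ** mexp Z" for Z :: "real^'n^'n"
    using mexp_add_scaleR[of 1 1 Z] by simp
  then have "mexp (2 *\<^sub>R X) = mexp (2 *\<^sub>R Y)" using assms X Y by simp
  then have "2 *\<^sub>R X = 2 *\<^sub>R Y"
    by (rule mexp_inj_self_adjoint[rotated 2]) (simp_all add: star_scaleR X Y)
  then show ?thesis using X Y by simp
qed

lemma Pos_star: "x \<in> Pos \<Longrightarrow> star x = x"
  by (auto simp: Pos_def star_mexp)

lemma Pos_invertible: "x \<in> Pos \<Longrightarrow> invertible x"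
  by (auto simp: Pos_def invertible_mexp)

lemma one_in_Pos: "mat 1 \<in> Pos"
  unfolding Pos_def by (rule image_eqI[of _ _ 0]) (simp_all add: star_0)

lemma Pos_conj:
  assumes "x \<in> Pos" "invertible g"
  shows "star g ** x ** g \<in> Pos"
proof -
  obtain y where y: "y \<in> Pos" "y ** y = x" using assms Pos_sqrt by blast
  have "star g ** x ** g = star (y ** g) ** (y ** g)"
    by (simp add: star_mult Pos_star[OF y(1)] matrix_mul_assoc flip: y(2))
  then show ?thesis
    using star_mult_in_Pos[OF invertible_mult[OF Pos_invertible[OF y(1)] assms(2)]] by simp
qed

end

section \<open>Closed linear groups and their Lie algebras\<close>

lemma matgrp_simps [simp]:
  "carrier (matgrp G) = G" "mult (matgrp G) = (**)" "one (matgrp G) = mat 1"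
  by (simp_all add: matgrp_def)

lemma subgroup_matgrp_GL:
  fixes G :: "(real^'n^'n) set"
  assumes "subgroup G (matgrp GL)"
  shows "g \<in> G \<Longrightarrow> invertible g" "mat 1 \<in> G" "g \<in> G \<Longrightarrow> h \<in> G \<Longrightarrow> g ** h \<in> G"
    "g \<in> G \<Longrightarrow> matrix_inv g \<in> G" "g \<in> G \<Longrightarrow> m_inv (matgrp GL) g = matrix_inv g"
proof -
  interpret GL: group "matgrp GL :: (real^'n^'n) monoid" by (rule group_GL)
  have sub: "G \<subseteq> GL" using subgroup.subset[OF assms] by simp
  show inv: "invertible g" if "g \<in> G" for g using that sub by (auto simp: GL_def)
  show "mat 1 \<in> G" using subgroup.one_closed[OF assms] by simp
  show "g ** h \<in> G" if "g \<in> G" "h \<in> G" using subgroup.m_closed[OF assms that] by simp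
  show *: "m_inv (matgrp GL) g = matrix_inv g" if "g \<in> G" for g
  proof -
    have "g \<in> carrier (matgrp GL)" using that sub by auto
    from GL.r_inv[OF this] have "g ** m_inv (matgrp GL) g = mat 1" by simp
    then show ?thesis by (rule matrix_inv_eq[symmetric])
  qed
  show "matrix_inv g \<in> G" if "g \<in> G"
    using subgroup.m_inv_closed[OF assms that] *[OF that] by simp
qed

lemma subgroup_matgrp_trans:
  assumes "subgroup G (matgrp GL)" "subgroup H (matgrp G)"
  shows "subgroup H (matgrp GL)"
  using group.incl_subgroup[OF group_GL assms(1), of H] assms(2) by (simp add: matgrp_def)

lemma mexp_difference_quotient:
  fixes d :: "nat \<Rightarrow> real"
  assumes "d \<longlonglongrightarrow> 0" "\<And>k. d k \<noteq> 0"
  shows "(\<lambda>k. (1 / d k) *\<^sub>R (mexp (d k *\<^sub>R X) - mat 1)) \<longlonglongrightarrow> X"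
proof -
  have "((\<lambda>t. mexp (t *\<^sub>R X)) has_derivative (\<lambda>t. t *\<^sub>R X)) (at 0)"
    using has_vector_derivative_mexp[of X 0 UNIV] by (simp add: has_vector_derivative_def)
  then have "((\<lambda>t. norm (mexp (t *\<^sub>R X) - mat 1 - t *\<^sub>R X) / \<bar>t\<bar>) \<longlongrightarrow> 0) (at 0)"
    by (simp add: has_derivative_iff_norm)
  moreover have "filterlim d (at 0) sequentially"
    using assms by (simp add: filterlim_at)
  ultimately have "(\<lambda>k. norm (mexp (d k *\<^sub>R X) - mat 1 - d k *\<^sub>R X) / \<bar>d k\<bar>) \<longlonglongrightarrow> 0"
    by (rule filterlim_compose)
  moreover have "norm (mexp (d k *\<^sub>R X) - mat 1 - d k *\<^sub>R X) / \<bar>d k\<bar> =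
      norm ((1 / d k) *\<^sub>R (mexp (d k *\<^sub>R X) - mat 1) - X)" for k
  proof -
    have "(1 / d k) *\<^sub>R (mexp (d k *\<^sub>R X) - mat 1) - X =
        (1 / d k) *\<^sub>R (mexp (d k *\<^sub>R X) - mat 1 - d k *\<^sub>R X)"
      using assms(2)[of k] by (simp add: scaleR_diff_right)
    then show ?thesis by simp
  qed
  ultimately have "(\<lambda>k. norm ((1 / d k) *\<^sub>R (mexp (d k *\<^sub>R X) - mat 1) - X)) \<longlonglongrightarrow> 0" by simp
  then show ?thesis by (rule LIM_zero_cancel[OF tendsto_norm_zero_cancel])
qed

lemma mexp_scaleR_tendsto_one:
  assumes "d \<longlonglongrightarrow> 0"
  shows "(\<lambda>k. mexp (d k *\<^sub>R X)) \<longlonglongrightarrow> mat 1"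
proof -
  have "isCont (\<lambda>t. mexp (t *\<^sub>R X)) 0"
    using has_vector_derivative_continuous[OF has_vector_derivative_mexp[of X 0 UNIV]] by simp
  from isCont_tendsto_compose[OF this assms] show ?thesis by simp
qed

locale lie_group = adjoint S Si for S Si :: "real^'n^'n" +
  fixes G
  assumes subgroup: "subgroup G (matgrp GL)" and closedin_GL: "closedin (top_of_set GL) G"
    and connected: "connected G" and G_star: "g \<in> G \<Longrightarrow> star g \<in> G"
begin

abbreviation (input) L where "L \<equiv> lie_algebra G"

lemmas G_invertible = subgroup_matgrp_GL(1)[OF subgroup]
lemmas G_one = subgroup_matgrp_GL(2)[OF subgroup]
lemmas G_mult = subgroup_matgrp_GL(3)[OF subgroup]
lemmas G_inv = subgroup_matgrp_GL(4)[OF subgroup]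

text \<open>\<open>G\<close> is closed among invertible matrices, not among all matrices, hence the
  condition on the limit.\<close>

lemma G_limit:
  assumes "\<And>k. g k \<in> G" "g \<longlonglongrightarrow> a" "invertible a"
  shows "a \<in> G"
proof -
  obtain C where C: "closed C" "G = GL \<inter> C" using closedin_GL by (auto simp: closedin_closed)
  then have "a \<in> C" using assms closed_sequentially[of C g a] by auto
  then show ?thesis using C assms by (auto simp: GL_def)
qed

lemma lie_mexp_scaleR: "X \<in> L \<Longrightarrow> mexp (t *\<^sub>R X) \<in> G"
  by (simp add: lie_algebra_def)

lemma lie_mexp: "X \<in> L \<Longrightarrow> mexp X \<in> G"
  using lie_mexp_scaleR[of X 1] by simp

text \<open>Von Neumann's criterion: the powers of \<open>g k\<close> with exponent
  \<open>t * r k\<close>, rounded down, stay in \<open>G\<close> and tend to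
  \<open>mexp (t *\<^sub>R X)\<close>; negative \<open>t\<close> follows by inversion.\<close>

lemma lie_limit:
  assumes g: "\<And>k. g k \<in> G" and r: "filterlim r at_top sequentially"
    and lim: "(\<lambda>k. r k *\<^sub>R (g k - mat 1)) \<longlonglongrightarrow> X"
  shows "X \<in> L"
proof -
  have inv0: "(\<lambda>k. inverse (r k)) \<longlonglongrightarrow> 0" by (rule tendsto_inverse_0_at_top[OF r])
  have pos: "\<forall>\<^sub>F k in sequentially. r k > 0" using r by (simp add: filterlim_at_top_dense)
  have "(\<lambda>k. inverse (r k) *\<^sub>R (r k *\<^sub>R (g k - mat 1))) \<longlonglongrightarrow> 0 *\<^sub>R X"
    by (intro tendsto_scaleR inv0 lim)
  moreover have "\<forall>\<^sub>F k in sequentially. inverse (r k) *\<^sub>R (r k *\<^sub>R (g k - mat 1)) = g k - mat 1"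
    using pos by eventually_elim simp
  ultimately have "(\<lambda>k. g k - mat 1) \<longlonglongrightarrow> 0" by (simp add: tendsto_cong)
  then have g1: "g \<longlonglongrightarrow> mat 1" by (simp add: LIM_zero_iff)
  have nonneg: "mexp (t *\<^sub>R X) \<in> G" if "t \<ge> 0" for t
  proof -
    define m where "m k = nat \<lfloor>t * r k\<rfloor>" for k
    have "(\<lambda>k. real (m k) * inverse (r k)) \<longlonglongrightarrow> t"
    proof (rule real_tendsto_sandwich)
      show "(\<lambda>k. t - inverse (r k)) \<longlonglongrightarrow> t" using tendsto_diff[OF tendsto_const inv0, of t] by simp
      show "(\<lambda>k. t) \<longlonglongrightarrow> t" by simp
      have b: "t * r k - 1 \<le> real (m k) \<and> real (m k) \<le> t * r k" if "r k > 0" for k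
      proof -
        have "t * r k \<ge> 0" using \<open>t \<ge> 0\<close> that by simp
        then have "real (m k) = of_int \<lfloor>t * r k\<rfloor>" by (simp add: m_def)
        then show ?thesis by linarith
      qed
      show "\<forall>\<^sub>F k in sequentially. t - inverse (r k) \<le> real (m k) * inverse (r k)"
        using pos
      proof eventually_elim
        case (elim k)
        have "t - inverse (r k) = (t * r k - 1) * inverse (r k)" using elim by (simp add: field_simps)
        also have "\<dots> \<le> real (m k) * inverse (r k)" using b[OF elim] elim by (intro mult_right_mono) auto
        finally show ?case .
      qed
      show "\<forall>\<^sub>F k in sequentially. real (m k) * inverse (r k) \<le> t"
        using pos by eventually_elim (use b in \<open>simp add: field_simps\<close>)
    qed
    then have "(\<lambda>k. (real (m k) * inverse (r k)) *\<^sub>R (r k *\<^sub>R (g k - mat 1))) \<longlonglongrightarrow> t *\<^sub>R X"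
      by (intro tendsto_scaleR lim)
    moreover have "\<forall>\<^sub>F k in sequentially. (real (m k) * inverse (r k)) *\<^sub>R (r k *\<^sub>R (g k - mat 1)) =
        real (m k) *\<^sub>R (g k - mat 1)"
      using pos by eventually_elim simp
    ultimately have "(\<lambda>k. real (m k) *\<^sub>R (g k - mat 1)) \<longlonglongrightarrow> t *\<^sub>R X"
      by (rule Lim_transform_eventually)
    then have lim': "(\<lambda>k. (((**) (g k)) ^^ m k) (mat 1)) \<longlonglongrightarrow> mexp (t *\<^sub>R X)"
      by (rule mat_power_tendsto_mexp[OF g1])
    have "(((**) (g k)) ^^ j) (mat 1) \<in> G" for k j
      by (induction j) (auto intro: G_one G_mult g)
    from G_limit[OF this lim' invertible_mexp] show ?thesis .
  qed
  have "mexp (t *\<^sub>R X) \<in> G" for t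
  proof (cases "t \<ge> 0")
    case False
    then have "mexp ((- t) *\<^sub>R X) \<in> G" by (intro nonneg) auto
    then have "matrix_inv (mexp (- (t *\<^sub>R X))) \<in> G" by (simp add: G_inv)
    moreover have "matrix_inv (mexp (- (t *\<^sub>R X))) = mexp (t *\<^sub>R X)" by (intro matrix_inv_eq mexp_minus)
    ultimately show ?thesis by simp
  qed (rule nonneg)
  then show ?thesis by (simp add: lie_algebra_def)
qed

lemma lie_scaleR: "X \<in> L \<Longrightarrow> c *\<^sub>R X \<in> L"
  by (simp add: lie_algebra_def)

lemma filterlim_Suc_at_top: "filterlim (\<lambda>k. real (Suc k)) at_top sequentially"
  by (rule filterlim_compose[OF filterlim_real_sequentially filterlim_Suc])

text \<open>The products of the two one-parameter subgroups form a curve in \<open>G\<close> whose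
  difference quotients at 0 tend to \<open>X + Y\<close>.\<close>

lemma lie_add:
  assumes X: "X \<in> L" and Y: "Y \<in> L"
  shows "X + Y \<in> L"
proof (rule lie_limit[OF _ filterlim_Suc_at_top])
  let ?d = "\<lambda>k. inverse (real (Suc k))"
  show "mexp (?d k *\<^sub>R X) ** mexp (?d k *\<^sub>R Y) \<in> G" for k
    using X Y by (intro G_mult lie_mexp_scaleR)
  have d0: "?d \<longlonglongrightarrow> 0" by (rule LIMSEQ_inverse_real_of_nat)
  have lim: "(\<lambda>k. (1 / ?d k) *\<^sub>R (mexp (?d k *\<^sub>R X) - mat 1) ** mexp (?d k *\<^sub>R Y)
      + (1 / ?d k) *\<^sub>R (mexp (?d k *\<^sub>R Y) - mat 1)) \<longlonglongrightarrow> X ** mat 1 + Y"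
    by (intro tendsto_add mm.tendsto mexp_difference_quotient d0 mexp_scaleR_tendsto_one) auto
  have eq: "(1 / ?d k) *\<^sub>R (mexp (?d k *\<^sub>R X) - mat 1) ** mexp (?d k *\<^sub>R Y)
      + (1 / ?d k) *\<^sub>R (mexp (?d k *\<^sub>R Y) - mat 1) =
      real (Suc k) *\<^sub>R (mexp (?d k *\<^sub>R X) ** mexp (?d k *\<^sub>R Y) - mat 1)" for k
  proof -
    have "(c *\<^sub>R (E - mat 1)) ** F + c *\<^sub>R (F - mat 1) = c *\<^sub>R (E ** F - mat 1)"
      for c and E :: "real^'n^'n" and F :: "real^'n^'n"
      by (simp add: mat_ring scaleR_diff_right)
    moreover have "1 / ?d k = real (Suc k)" by (simp only: divide_inverse inverse_inverse_eq mult_1_left)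
    ultimately show ?thesis by (simp only:)
  qed
  from lim show "(\<lambda>k. real (Suc k) *\<^sub>R (mexp (?d k *\<^sub>R X) ** mexp (?d k *\<^sub>R Y) - mat 1)) \<longlonglongrightarrow> X + Y"
    unfolding eq matrix_mul_rid .
qed

lemma subspace_lie: "subspace L"
proof -
  have "0 \<in> L" using G_one by (simp add: lie_algebra_def)
  then show ?thesis unfolding subspace_def by (intro conjI ballI allI lie_add lie_scaleR)
qed

lemma lie_Ad:
  assumes "g \<in> G" "X \<in> L"
  shows "g ** X ** matrix_inv g \<in> L"
proof -
  have "invertible g" using assms G_invertible by blast
  then have *: "g ** matrix_inv g = mat 1" "matrix_inv g ** g = mat 1"
    by (auto simp: matrix_inv_left matrix_inv_right)
  have "mexp (t *\<^sub>R (g ** X ** matrix_inv g)) = g ** mexp (t *\<^sub>R X) ** matrix_inv g" for t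
    using mexp_conj[OF *, of "t *\<^sub>R X"] by (simp add: mm.scaleR_left mm.scaleR_right)
  then show ?thesis using assms by (auto simp: lie_algebra_def intro: G_mult G_inv)
qed

lemma lie_star: "X \<in> L \<Longrightarrow> star X \<in> L"
  by (auto simp: lie_algebra_def star_mexp[symmetric] star_scaleR[symmetric] intro: G_star)

text \<open>The bracket is the derivative at 0 of \<open>Y\<close> conjugated by
  \<open>mexp (t *\<^sub>R X)\<close>; the difference quotients lie in \<open>L\<close>, which is
  closed as a subspace.\<close>

lemma lie_bracket_closed:
  assumes X: "X \<in> L" and Y: "Y \<in> L"
  shows "X ** Y - Y ** X \<in> L"
proof (rule closed_sequentially[OF closed_subspace[OF subspace_lie]])
  let ?d = "\<lambda>k. inverse (real (Suc k))"
  have d0: "?d \<longlonglongrightarrow> 0" by (rule LIMSEQ_inverse_real_of_nat)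
  then have d0': "(\<lambda>k. - ?d k) \<longlonglongrightarrow> 0" using tendsto_minus by fastforce
  have inv: "matrix_inv (mexp (?d k *\<^sub>R X)) = mexp ((- ?d k) *\<^sub>R X)" for k
    using mexp_minus[of "?d k *\<^sub>R X"] by (intro matrix_inv_eq) simp
  have "mexp (?d k *\<^sub>R X) ** Y ** mexp ((- ?d k) *\<^sub>R X) \<in> L" for k
    unfolding inv[symmetric] by (intro lie_Ad lie_mexp_scaleR X Y)
  then show "real (Suc k) *\<^sub>R (mexp (?d k *\<^sub>R X) ** Y ** mexp ((- ?d k) *\<^sub>R X) - Y) \<in> L" for k
    by (intro subspace_scale subspace_diff subspace_lie Y)
  have lim: "(\<lambda>k. ((1 / ?d k) *\<^sub>R (mexp (?d k *\<^sub>R X) - mat 1)) ** Y ** mexp ((- ?d k) *\<^sub>R X)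
      - Y ** ((1 / - ?d k) *\<^sub>R (mexp ((- ?d k) *\<^sub>R X) - mat 1))) \<longlonglongrightarrow> X ** Y ** mat 1 - Y ** X"
    by (intro tendsto_diff mm.tendsto tendsto_const mexp_difference_quotient d0 d0' mexp_scaleR_tendsto_one) auto
  have eq: "((1 / ?d k) *\<^sub>R (mexp (?d k *\<^sub>R X) - mat 1)) ** Y ** mexp ((- ?d k) *\<^sub>R X)
      - Y ** ((1 / - ?d k) *\<^sub>R (mexp ((- ?d k) *\<^sub>R X) - mat 1)) =
      real (Suc k) *\<^sub>R (mexp (?d k *\<^sub>R X) ** Y ** mexp ((- ?d k) *\<^sub>R X) - Y)" for k
  proof -
    have "(c *\<^sub>R (E - mat 1)) ** Y ** F - Y ** ((- c) *\<^sub>R (F - mat 1)) = c *\<^sub>R (E ** Y ** F - Y)"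
      for c and E :: "real^'n^'n" and F :: "real^'n^'n"
      by (simp add: mat_ring scaleR_diff_right)
    moreover have "1 / ?d k = real (Suc k)" "1 / - ?d k = - real (Suc k)"
      by (simp_all only: divide_inverse inverse_inverse_eq mult_1_left inverse_minus_eq)
    ultimately show ?thesis by (simp only:)
  qed
  from lim show "(\<lambda>k. real (Suc k) *\<^sub>R (mexp (?d k *\<^sub>R X) ** Y ** mexp ((- ?d k) *\<^sub>R X) - Y))
      \<longlonglongrightarrow> X ** Y - Y ** X"
    unfolding eq matrix_mul_rid .
qed

end

context lie_group begin

text \<open>
  A point of \<open>G\<close> near \<open>T\<close> but not in \<open>T\<close> is compared with a nearest point of \<open>T\<close>: in the limit
  their difference is tangent to \<open>G\<close>, so moving the nearest point in \<open>T\<close> along that tangent vector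
  would bring it closer.
\<close>

lemma closed_tangent_subset_eq:
  fixes T :: "(real^'n^'n) set"
  assumes "T \<subseteq> G" "T \<noteq> {}"
    and closed: "\<And>s a. (\<And>k. s k \<in> T) \<Longrightarrow> s \<longlonglongrightarrow> a \<Longrightarrow> invertible a \<Longrightarrow> a \<in> T"
    and tangent: "\<And>s d Z s0. (\<And>k. s k \<in> T) \<Longrightarrow> s \<longlonglongrightarrow> s0 \<Longrightarrow> s0 \<in> T \<Longrightarrow> (\<And>k. d k > 0) \<Longrightarrow> d \<longlonglongrightarrow> 0 \<Longrightarrow>
      Z \<in> L \<Longrightarrow> \<exists>r u. strict_mono r \<and> (\<forall>k::nat. u k \<in> T) \<and>
        (\<lambda>k. (1 / d (r k)) *\<^sub>R (u k - s (r k))) \<longlonglongrightarrow> s0 ** Z"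
  shows "T = G"
proof -
  have "closedin (top_of_set G) T"
  proof -
    have "T = G \<inter> closure T"
    proof
      show "G \<inter> closure T \<subseteq> T"
      proof
        fix a assume a: "a \<in> G \<inter> closure T"
        then have "\<exists>s. (\<forall>k. s k \<in> T) \<and> s \<longlonglongrightarrow> a" by (simp add: closure_sequential)
        then obtain s where s: "\<And>k. s k \<in> T" "s \<longlonglongrightarrow> a" by auto
        have "invertible a" using a by (intro G_invertible) simp
        from closed[OF s this] show "a \<in> T" .
      qed
    qed (use assms(1) closure_subset in auto)
    then show ?thesis by (metis closed_closure closedin_closed_Int)
  qed
  moreover have "openin (top_of_set G) T"
  proof (rule ccontr)
    assume "\<not> openin (top_of_set G) T"
    then have "\<exists>s0\<in>T. \<forall>e>0. \<not> ball s0 e \<inter> G \<subseteq> T"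
      using assms(1) by (simp add: openin_contains_ball)
    then obtain s0 where s0: "s0 \<in> T" "\<And>e. e > 0 \<Longrightarrow> \<not> ball s0 e \<inter> G \<subseteq> T"
      by blast
    have "\<forall>k. \<exists>g. g \<in> ball s0 (inverse (real (Suc k))) \<inter> G \<and> g \<notin> T"
      using s0(2)[of "inverse (real (Suc _))"] by (meson inverse_positive_iff_positive of_nat_0_less_iff subsetI zero_less_Suc)
    then obtain g where g: "\<And>k. dist s0 (g k) < inverse (real (Suc k))" "\<And>k. g k \<in> G" "\<And>k. g k \<notin> T"
      by (metis IntE mem_ball)
    obtain r where r: "r > 0" "cball s0 r \<subseteq> {A. invertible A}"
      using open_contains_cball[THEN iffD1, OF open_invertible] s0(1) assms(1) G_invertible by blast
    \<comment> \<open>\<open>T\<close> is closed only among invertible matrices. Its part in a ball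
      of invertible matrices is closed outright, so nearest points exist in it.\<close>
    define T' where "T' = T \<inter> cball s0 r"
    have "closed T'"
    proof (rule closed_sequential_limits[THEN iffD2], safe)
      fix x l assume x: "\<forall>n. x n \<in> T'" "x \<longlonglongrightarrow> l"
      then have "l \<in> cball s0 r" using closed_sequentially[of "cball s0 r" x l] by (auto simp: T'_def)
      moreover from this have "l \<in> T" using x r closed[of x l] by (auto simp: T'_def)
      ultimately show "l \<in> T'" by (simp add: T'_def)
    qed
    have "s0 \<in> T'" using s0 r by (simp add: T'_def)
    have "\<exists>s\<in>T'. \<forall>y\<in>T'. dist (g k) s \<le> dist (g k) y" for k
    proof -
      have "T' \<noteq> {}" using \<open>s0 \<in> T'\<close> by auto
      from distance_attains_inf[OF \<open>closed T'\<close> this, of "g k"] show ?thesis by metis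
    qed
    then obtain s where s: "\<And>k. s k \<in> T'" "\<And>k y. y \<in> T' \<Longrightarrow> dist (g k) (s k) \<le> dist (g k) y" by metis
    have ks: "s k \<in> T" "s k \<in> G" "invertible (s k)" for k
      using s(1)[of k] assms(1) G_invertible by (auto simp: T'_def)
    have "(\<lambda>k. dist (g k) s0) \<longlonglongrightarrow> 0"
      by (rule tendsto_sandwich[OF _ _ tendsto_const LIMSEQ_inverse_real_of_nat])
         (use less_imp_le[OF g(1)] in \<open>simp_all add: always_eventually dist_commute[of _ s0]\<close>)
    then have g0: "g \<longlonglongrightarrow> s0" by (rule tendsto_dist_iff[THEN iffD2])
    have "dist (s k) s0 \<le> 2 * dist (g k) s0" for k
      using dist_triangle[of "s k" s0 "g k"] s(2)[OF \<open>s0 \<in> T'\<close>, of k] by (simp add: dist_commute)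
    moreover have "(\<lambda>k. 2 * dist (g k) s0) \<longlonglongrightarrow> 0"
      using tendsto_mult_left[OF tendsto_dist_iff[THEN iffD1, OF g0], of 2] by simp
    ultimately have "(\<lambda>k. dist (s k) s0) \<longlonglongrightarrow> 0"
      by (intro tendsto_sandwich[of "\<lambda>_. 0" "\<lambda>k. dist (s k) s0" sequentially "\<lambda>k. 2 * dist (g k) s0"])
         (simp_all add: always_eventually)
    then have s_lim: "s \<longlonglongrightarrow> s0" by (rule tendsto_dist_iff[THEN iffD2])
    have s0i: "invertible s0" "s0 \<in> G" using s0 assms(1) G_invertible by auto
    \<comment> \<open>The deviation from the nearest point is written multiplicatively, so that it
      lies in \<open>G\<close> and \<open>lie_limit\<close> makes its limiting direction
      \<open>Z\<close> an element of \<open>L\<close>.\<close>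
    define e where "e k = matrix_inv (s k) ** g k" for k
    have "e \<longlonglongrightarrow> matrix_inv s0 ** s0"
      unfolding e_def by (intro mm.tendsto tendsto_matrix_inv s_lim g0 s0i)
    then have e1: "e \<longlonglongrightarrow> mat 1" by (simp add: matrix_inv_left s0i)
    have se: "s k ** e k = g k" for k
      unfolding e_def by (simp add: matrix_mul_assoc matrix_inv_right ks)
    have "e k \<noteq> mat 1" for k using se[of k] ks(1)[of k] g(3)[of k] by auto
    define d where "d k = norm (e k - mat 1)" for k
    have dpos: "d k > 0" for k using \<open>e k \<noteq> mat 1\<close> by (simp add: d_def)
    have "d \<longlonglongrightarrow> norm (mat 1 - mat 1 :: real^'n^'n)" unfolding d_def by (intro tendsto_intros e1)
    then have d0: "d \<longlonglongrightarrow> 0" by simp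
    define z where "z k = (1 / d k) *\<^sub>R (e k - mat 1)" for k
    have sph: "\<forall>k. z k \<in> sphere 0 1" using dpos by (simp add: z_def d_def)
    obtain Z \<rho> where Z: "Z \<in> sphere 0 1" "strict_mono \<rho>" "(z \<circ> \<rho>) \<longlonglongrightarrow> Z"
      by (rule seq_compactE[OF compact_imp_seq_compact[OF compact_sphere] sph])
    have d0r: "(d \<circ> \<rho>) \<longlonglongrightarrow> 0" using LIMSEQ_subseq_LIMSEQ[OF d0 Z(2)] .
    have "Z \<in> L"
    proof (rule lie_limit)
      show "e (\<rho> k) \<in> G" for k unfolding e_def using g ks by (intro G_mult G_inv)
      show "filterlim (\<lambda>k. inverse (d (\<rho> k))) at_top sequentially"
        using filterlim_inverse_at_top[OF d0r] dpos by (simp add: o_def)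
      show "(\<lambda>k. inverse (d (\<rho> k)) *\<^sub>R (e (\<rho> k) - mat 1)) \<longlonglongrightarrow> Z"
        using Z(3) by (simp add: z_def o_def inverse_eq_divide)
    qed
    \<comment> \<open>Tangency is available along a further subsequence only, since its users may
      construct the points \<open>u\<close> by a compactness argument.\<close>
    obtain \<sigma> u where u: "strict_mono \<sigma>" "\<And>k. u k \<in> T"
      and ulim: "(\<lambda>k. (1 / (d \<circ> \<rho>) (\<sigma> k)) *\<^sub>R (u k - (s \<circ> \<rho>) (\<sigma> k))) \<longlonglongrightarrow> s0 ** Z"
      using tangent[of "s \<circ> \<rho>" s0 "d \<circ> \<rho>" Z] ks(1) LIMSEQ_subseq_LIMSEQ[OF s_lim Z(2)] s0(1) dpos d0r \<open>Z \<in> L\<close>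
      by auto
    define \<tau> where "\<tau> = \<rho> \<circ> \<sigma>"
    have \<tau>: "strict_mono \<tau>" unfolding \<tau>_def using Z(2) u(1) by (rule strict_mono_o)
    have ulim': "(\<lambda>k. (1 / d (\<tau> k)) *\<^sub>R (u k - s (\<tau> k))) \<longlonglongrightarrow> s0 ** Z"
      using ulim by (simp add: \<tau>_def)
    have s\<tau>: "(\<lambda>k. s (\<tau> k)) \<longlonglongrightarrow> s0" using LIMSEQ_subseq_LIMSEQ[OF s_lim \<tau>] by (simp add: o_def)
    have d\<tau>: "(\<lambda>k. d (\<tau> k)) \<longlonglongrightarrow> 0" using LIMSEQ_subseq_LIMSEQ[OF d0 \<tau>] by (simp add: o_def)
    have z\<tau>: "(\<lambda>k. z (\<tau> k)) \<longlonglongrightarrow> Z" using LIMSEQ_subseq_LIMSEQ[OF Z(3) u(1)] by (simp add: o_def \<tau>_def)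
    have "(\<lambda>k. s (\<tau> k) + d (\<tau> k) *\<^sub>R ((1 / d (\<tau> k)) *\<^sub>R (u k - s (\<tau> k)))) \<longlonglongrightarrow> s0 + 0 *\<^sub>R (s0 ** Z)"
      by (intro tendsto_intros s\<tau> d\<tau> ulim')
    moreover have "s (\<tau> k) + d (\<tau> k) *\<^sub>R ((1 / d (\<tau> k)) *\<^sub>R (u k - s (\<tau> k))) = u k" for k
      using dpos[of "\<tau> k"] by simp
    ultimately have "u \<longlonglongrightarrow> s0" by simp
    then have "\<forall>\<^sub>F k in sequentially. dist (u k) s0 < r" using r(1) by (rule tendstoD)
    then have evT: "\<forall>\<^sub>F k in sequentially. u k \<in> T'"
      by eventually_elim (simp add: T'_def u dist_commute less_imp_le)
    have gs: "(1 / d k) *\<^sub>R (g k - s k) = s k ** z k" for k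
      unfolding z_def by (simp add: mat_ring se)
    \<comment> \<open>Minimality of the distance, divided by \<open>d\<close>: in the limit the left
      side is the norm of \<open>s0 ** Z\<close> and the right side is 0, although \<open>Z\<close>
      is a unit vector.\<close>
    from evT have "\<forall>\<^sub>F k in sequentially. norm (s (\<tau> k) ** z (\<tau> k)) \<le>
        norm (s (\<tau> k) ** z (\<tau> k) - (1 / d (\<tau> k)) *\<^sub>R (u k - s (\<tau> k)))"
    proof (eventually_elim)
      case (elim k)
      have "norm (g (\<tau> k) - s (\<tau> k)) \<le> norm (g (\<tau> k) - u k)"
        using s(2)[OF elim(1), of "\<tau> k"] by (simp add: dist_norm)
      then have "(1 / d (\<tau> k)) * norm (g (\<tau> k) - s (\<tau> k)) \<le> (1 / d (\<tau> k)) * norm (g (\<tau> k) - u k)"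
        using dpos[of "\<tau> k"] by (intro mult_left_mono) auto
      then have "norm ((1 / d (\<tau> k)) *\<^sub>R (g (\<tau> k) - s (\<tau> k))) \<le> norm ((1 / d (\<tau> k)) *\<^sub>R (g (\<tau> k) - u k))"
        using dpos[of "\<tau> k"] by simp
      moreover have "(1 / d (\<tau> k)) *\<^sub>R (g (\<tau> k) - u k) =
          (1 / d (\<tau> k)) *\<^sub>R (g (\<tau> k) - s (\<tau> k)) - (1 / d (\<tau> k)) *\<^sub>R (u k - s (\<tau> k))"
        by (simp add: scaleR_diff_right)
      ultimately show ?case by (simp add: gs)
    qed
    moreover have "(\<lambda>k. norm (s (\<tau> k) ** z (\<tau> k))) \<longlonglongrightarrow> norm (s0 ** Z)"
      by (intro tendsto_norm mm.tendsto s\<tau> z\<tau>)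
    moreover have "(\<lambda>k. norm (s (\<tau> k) ** z (\<tau> k) - (1 / d (\<tau> k)) *\<^sub>R (u k - s (\<tau> k)))) \<longlonglongrightarrow> norm (s0 ** Z - s0 ** Z)"
      by (intro tendsto_norm tendsto_diff mm.tendsto s\<tau> z\<tau> ulim')
    ultimately have "norm (s0 ** Z) \<le> norm (s0 ** Z - s0 ** Z)"
      by (intro tendsto_le[OF sequentially_bot]) auto
    then have "matrix_inv s0 ** (s0 ** Z) = 0" by simp
    then have "Z = 0" by (simp add: matrix_mul_assoc matrix_inv_left s0i)
    then show False using Z(1) by simp
  qed
  ultimately show ?thesis using connected assms(2) by (auto simp: connected_clopen)
qed

text \<open>One-parameter subgroups supply the tangent displacements; this plays the part of the
  generation of a connected group by exponentials.\<close>

lemma closed_mexp_invariant_subset_eq: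
  fixes T :: "(real^'n^'n) set"
  assumes "T \<subseteq> G" "T \<noteq> {}"
    and closed: "\<And>s a. (\<And>k. s k \<in> T) \<Longrightarrow> s \<longlonglongrightarrow> a \<Longrightarrow> invertible a \<Longrightarrow> a \<in> T"
    and inv: "\<And>s X. s \<in> T \<Longrightarrow> X \<in> L \<Longrightarrow> s ** mexp X \<in> T"
  shows "T = G"
proof (rule closed_tangent_subset_eq[OF assms(1,2) closed])
  fix s :: "nat \<Rightarrow> real^'n^'n" and d :: "nat \<Rightarrow> real" and Z s0
  assume s: "\<And>k. s k \<in> T" "s \<longlonglongrightarrow> s0" and d: "\<And>k. d k > 0" "d \<longlonglongrightarrow> 0" and Z: "Z \<in> L"
  have "(\<lambda>k. s k ** ((1 / d k) *\<^sub>R (mexp (d k *\<^sub>R Z) - mat 1))) \<longlonglongrightarrow> s0 ** Z"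
    using d by (intro mm.tendsto s mexp_difference_quotient) (auto simp: less_imp_neq[THEN not_sym])
  then have "(\<lambda>k. (1 / d (id k)) *\<^sub>R (s k ** mexp (d k *\<^sub>R Z) - s (id k))) \<longlonglongrightarrow> s0 ** Z"
    by (simp add: mat_ring)
  moreover have "s k ** mexp (d k *\<^sub>R Z) \<in> T" for k by (intro inv s lie_scaleR Z)
  ultimately show "\<exists>r u. strict_mono r \<and> (\<forall>k::nat. u k \<in> T) \<and>
        (\<lambda>k. (1 / d (r k)) *\<^sub>R (u k - s (r k))) \<longlonglongrightarrow> s0 ** Z"
    by (intro exI[of _ id] exI[of _ "\<lambda>k. s k ** mexp (d k *\<^sub>R Z)"]) (auto simp: strict_mono_id)
qed auto

end

section \<open>The polar decomposition\<close>

lemma trace_zero [simp]: "trace (0 :: real^'n^'n) = 0" by (simp add: trace_def)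

context adjoint begin

lemma norm_le_ip: "\<exists>C>0. \<forall>X. norm X \<le> C * sqrt (ip X X)"
proof -
  obtain C where C: "C > 0" "\<And>X. norm (Si ** X ** S) \<le> norm X * C"
    using bounded_linear.pos_bounded[OF bounded_linear_compose[OF mm.bounded_linear_left[of S]
        mm.bounded_linear_right[of Si]]] by auto
  have "norm X \<le> C * sqrt (ip X X)" for X
  proof -
    have "Si ** cj X ** S = X" by (simp add: cj_def matrix_mul_assoc Si_S)
    then show ?thesis using C(2)[of "cj X"] by (simp add: ip_eq norm_eq_sqrt_inner mult.commute)
  qed
  with C(1) show ?thesis by blast
qed

lemma ip_bounded_imp_convergent_subsequence:
  fixes x :: "nat \<Rightarrow> real^'n^'n"
  assumes "\<And>k. ip (x k) (x k) \<le> B"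
  obtains l r where "strict_mono (r :: nat \<Rightarrow> nat)" "(\<lambda>k. x (r k)) \<longlonglongrightarrow> l"
proof -
  obtain C where C: "C > 0" "\<And>X. norm X \<le> C * sqrt (ip X X)" using norm_le_ip by auto
  have "norm (x k) \<le> C * sqrt B" for k
    using C(2)[of "x k"] mult_left_mono[OF real_sqrt_le_mono[OF assms[of k]], of C] C(1) by linarith
  then have "bounded (range x)" unfolding bounded_iff by auto
  then show ?thesis using bounded_imp_convergent_subsequence[of x] that by (auto simp: o_def)
qed

lemma tendsto_trace: "(x \<longlongrightarrow> l) F \<Longrightarrow> ((\<lambda>k. trace (x k :: real^'n^'n)) \<longlongrightarrow> trace l) F"
  by (rule bounded_linear.tendsto[OF bounded_linear_trace])

lemma invertible_if_mult_self_invertible: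
  fixes x :: "real^'n^'n"
  assumes "invertible (x ** x)"
  shows "invertible x"
  using matrix_inv_right[OF assms] by (intro invertible_if_right_inverse[of _ "x ** matrix_inv (x ** x)"])
    (simp add: matrix_mul_assoc)

text \<open>For self-adjoint \<open>x\<close> the squared norm \<open>ip x x\<close> is the trace of
  \<open>x ** x\<close>, so convergence of the squares bounds the roots. The limit is recorded as
  self-adjoint and invertible, which is enough to write \<open>a = star l ** l\<close>.\<close>

lemma Pos_square_convergent_subsequence:
  fixes x :: "nat \<Rightarrow> real^'n^'n"
  assumes x: "\<And>k. x k \<in> Pos" and lim: "(\<lambda>k. x k ** x k) \<longlonglongrightarrow> a" and a: "invertible a"
  obtains l r where "strict_mono (r :: nat \<Rightarrow> nat)" "(\<lambda>k. x (r k)) \<longlonglongrightarrow> l" "l ** l = a" "star l = l" "invertible l"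
proof -
  have "convergent (\<lambda>k. trace (x k ** x k))" using tendsto_trace[OF lim] by (rule convergentI)
  then obtain B where "\<And>k. norm (trace (x k ** x k)) \<le> B"
    using convergent_imp_Bseq BseqE by metis
  moreover have "ip (x k) (x k) = trace (x k ** x k)" for k
    by (simp add: ip_def Pos_star[OF x])
  ultimately have "ip (x k) (x k) \<le> B" for k by (metis abs_le_D1 real_norm_def)
  then obtain l r where r: "strict_mono (r :: nat \<Rightarrow> nat)" and l: "(\<lambda>k. x (r k)) \<longlonglongrightarrow> l"
    by (rule ip_bounded_imp_convergent_subsequence)
  have "(\<lambda>k. x (r k) ** x (r k)) \<longlonglongrightarrow> a" using LIMSEQ_subseq_LIMSEQ[OF lim r] by (simp add: o_def)
  then have ll: "l ** l = a" using mm.tendsto[OF l l] LIMSEQ_unique by blast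
  have "(\<lambda>k. star (x (r k))) \<longlonglongrightarrow> star l" by (rule tendsto_star[OF l])
  then have "star l = l" using l LIMSEQ_unique by (simp add: Pos_star[OF x])
  with r l ll a show ?thesis by (intro that[of r l]) (auto intro: invertible_if_mult_self_invertible)
qed

lemma Pos_closed:
  assumes "\<And>k. x k \<in> Pos" "x \<longlonglongrightarrow> a" "invertible a"
  shows "a \<in> Pos"
proof -
  have "\<forall>k. \<exists>y. y \<in> Pos \<and> y ** y = x k" using assms(1) Pos_sqrt by metis
  then obtain y where y: "\<And>k. y k \<in> Pos" "\<And>k. y k ** y k = x k" by metis
  obtain l r where "strict_mono (r :: nat \<Rightarrow> nat)" "(\<lambda>k. y (r k)) \<longlonglongrightarrow> l" "l ** l = a" "star l = l" "invertible l"
    by (rule Pos_square_convergent_subsequence[of y a]) (use y assms in auto)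
  then show ?thesis using star_mult_in_Pos[of l] by simp
qed

lemma star_Pos_inv:
  assumes "x \<in> Pos" shows "star (matrix_inv x) = matrix_inv x"
  using star_matrix_inv[OF Pos_invertible[OF assms]] Pos_star[OF assms] by simp

text \<open>Both numbers equal the squared norm of \<open>y ** v ** matrix_inv y\<close>, where
  \<open>y\<close> is the square root of \<open>x\<close>.\<close>

lemma ip_Pos_conj_nonneg:
  assumes x: "x \<in> Pos" and v: "star v = v"
  shows "ip (x ** v ** matrix_inv x) v \<ge> 0" "ip (matrix_inv x ** v ** x) v \<ge> 0"
proof -
  obtain y where y: "y \<in> Pos" "y ** y = x" using Pos_sqrt[OF x] by metis
  let ?i = "matrix_inv y"
  have "y ** ?i = mat 1" using y Pos_invertible matrix_inv_right by blast
  then have "x ** (?i ** ?i) = mat 1"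
    unfolding y(2)[symmetric] by (metis matrix_mul_assoc matrix_mul_rid)
  then have xi: "matrix_inv x = ?i ** ?i" by (rule matrix_inv_eq)
  have "0 \<le> ip (y ** v ** ?i) (y ** v ** ?i)" by (rule ip_nonneg)
  also have "\<dots> = trace (y ** (v ** ?i ** ?i ** v ** y))"
    by (simp add: ip_def star_mult v Pos_star[OF y(1)] star_Pos_inv[OF y(1)] matrix_mul_assoc)
  also have "\<dots> = trace ((v ** ?i ** ?i ** v ** y) ** y)" by (rule trace_mul_sym)
  also have "\<dots> = trace (v ** (matrix_inv x ** v ** x))"
    unfolding xi by (simp only: y(2)[symmetric] matrix_mul_assoc)
  finally have *: "0 \<le> trace (v ** (matrix_inv x ** v ** x))" .
  also have "\<dots> = trace ((matrix_inv x ** v ** x) ** v)" by (rule trace_mul_sym)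
  finally show "ip (matrix_inv x ** v ** x) v \<ge> 0" by (simp add: ip_def v)
  have "trace (v ** (matrix_inv x ** v ** x)) = trace ((v ** matrix_inv x) ** (v ** x))"
    by (simp only: matrix_mul_assoc)
  also have "\<dots> = trace ((v ** x) ** (v ** matrix_inv x))" by (rule trace_mul_sym)
  also have "\<dots> = trace (v ** (x ** v ** matrix_inv x))" by (simp only: matrix_mul_assoc)
  also have "\<dots> = trace ((x ** v ** matrix_inv x) ** v)" by (rule trace_mul_sym)
  finally show "ip (x ** v ** matrix_inv x) v \<ge> 0" using * by (simp add: ip_def v)
qed

end

context lie_group begin

definition KK :: "(real^'n^'n) set" where "KK = {k \<in> G. star k ** k = mat 1}"

definition pp :: "(real^'n^'n) set" where "pp = {X \<in> L. star X = X}"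

lemma subspace_pp: "subspace pp"
  using subspace_lie by (auto simp: pp_def subspace_def star_simps)

text \<open>The linear map on the left is positive definite on \<open>pp\<close>, hence injective
  and, by dimension, onto. Solving it is the linearised problem of following the square root
  \<open>x\<close> of \<open>star g ** g\<close> when \<open>g\<close> moves.\<close>

lemma pp_eq_symmetrized:
  assumes x: "x \<in> Pos" "x \<in> G" and W: "W \<in> pp"
  obtains v where "v \<in> pp" "2 *\<^sub>R v + x ** v ** matrix_inv x + matrix_inv x ** v ** x = W"
proof -
  define f where "f v = 2 *\<^sub>R v + x ** v ** matrix_inv x + matrix_inv x ** v ** x" for v
  have lin: "linear f" by (simp add: linear_iff f_def mat_ring algebra_simps)
  have xi: "matrix_inv (matrix_inv x) = x"
    using Pos_invertible[OF x(1)] by (intro matrix_inv_eq matrix_inv_left)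
  have f: "f ` pp \<subseteq> pp"
  proof safe
    fix v assume v: "v \<in> pp"
    then have "f v \<in> L" unfolding f_def pp_def
      using lie_Ad[OF x(2)] lie_Ad[OF G_inv[OF x(2)]] xi by (auto intro!: lie_add lie_scaleR)
    moreover have "star (f v) = f v" using v x(1)
      by (simp add: f_def pp_def star_simps Pos_star star_Pos_inv matrix_mul_assoc)
    ultimately show "f v \<in> pp" by (simp add: pp_def)
  qed
  have "v = 0" if v: "v \<in> pp" "f v = 0" for v
  proof -
    have sv: "star v = v" using v by (simp add: pp_def)
    have "0 = ip (f v) v" using v by (simp add: ip_def)
    also have "\<dots> = 2 * ip v v + ip (x ** v ** matrix_inv x) v + ip (matrix_inv x ** v ** x) v"
      by (simp add: f_def ip_add_left ip_scaleR_left)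
    finally have "ip v v \<le> 0" using ip_Pos_conj_nonneg[OF x(1) sv] by linarith
    then show "v = 0" using ip_pos[of v] by force
  qed
  then have inj: "inj_on f pp"
    using linear_injective_on_subspace_0[OF lin subspace_pp] by blast
  have "dim (f ` pp) = dim pp" using dim_image_eq[OF lin, of pp] inj span_eq_iff[THEN iffD2, OF subspace_pp] by simp
  then have "f ` pp = pp"
    using subspace_dim_equal[of "f ` pp" pp] linear_subspace_image[OF lin subspace_pp] subspace_pp f by simp
  then obtain v where "v \<in> pp" "f v = W" using W by (metis imageE)
  then show ?thesis using that by (simp add: f_def)
qed

text \<open>The set \<open>T\<close> of all \<open>g\<close> that have a root in \<open>Q\<close> is
  closed, as roots converge along subsequences. It is tangent to \<open>G\<close> because the root
  \<open>x\<close> can be moved to \<open>mexp v ** x ** mexp v\<close> while a skew exponential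
  corrects the orthogonal factor.\<close>

lemma star_mult_eq_square:
  assumes Q: "Q \<subseteq> G \<inter> Pos" "mat 1 \<in> Q"
    and closed: "\<And>s a. (\<And>k. s k \<in> Q) \<Longrightarrow> s \<longlonglongrightarrow> a \<Longrightarrow> invertible a \<Longrightarrow> a \<in> Q"
    and inv: "\<And>x v. x \<in> Q \<Longrightarrow> v \<in> pp \<Longrightarrow> mexp v ** x ** mexp v \<in> Q"
    and "g \<in> G"
  shows "\<exists>x\<in>Q. star g ** g = x ** x"
proof -
  define T where "T = {g \<in> G. \<exists>x\<in>Q. star g ** g = x ** x}"
  have limit: "\<exists>r x0. strict_mono (r :: nat \<Rightarrow> nat) \<and> (\<lambda>k. x (r k)) \<longlonglongrightarrow> x0 \<and> x0 \<in> Q \<and> star a ** a = x0 ** x0"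
    if s: "\<And>k. star (s k) ** s k = x k ** x k" "\<And>k. x k \<in> Q" "s \<longlonglongrightarrow> a" "invertible a" for s x a
  proof -
    have "invertible (star a)" using star_one star_mult matrix_inv_right[OF s(4)] matrix_inv_left[OF s(4)]
      unfolding invertible_def by metis
    then have inv: "invertible (star a ** a)" using s(4) by (rule invertible_mult)
    have "(\<lambda>k. star (s k) ** s k) \<longlonglongrightarrow> star a ** a"
      by (intro mm.tendsto tendsto_star s(3))
    then have lim: "(\<lambda>k. x k ** x k) \<longlonglongrightarrow> star a ** a" by (simp add: s(1))
    have "x k \<in> Pos" for k using s(2) Q by blast
    then obtain x0 r where x0: "strict_mono (r :: nat \<Rightarrow> nat)" "(\<lambda>k. x (r k)) \<longlonglongrightarrow> x0"
      "x0 ** x0 = star a ** a" "star x0 = x0" "invertible x0"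
      by (rule Pos_square_convergent_subsequence[OF _ lim inv])
    moreover have "x0 \<in> Q" by (rule closed[of "\<lambda>k. x (r k)" x0]) (use x0 s(2) in auto)
    ultimately show ?thesis by metis
  qed
  have "T = G"
  proof (rule closed_tangent_subset_eq)
    show "T \<subseteq> G" by (auto simp: T_def)
    have "mat 1 \<in> T" unfolding T_def using Q(2) G_one by (auto intro!: bexI[of _ "mat 1"])
    then show "T \<noteq> {}" by blast
  next
    fix s :: "nat \<Rightarrow> real^'n^'n" and a
    assume s: "\<And>k. s k \<in> T" "s \<longlonglongrightarrow> a" "invertible a"
    have "\<forall>k. \<exists>x. x \<in> Q \<and> star (s k) ** s k = x ** x" using s(1) by (auto simp: T_def)
    then obtain x where x: "\<And>k. x k \<in> Q" "\<And>k. star (s k) ** s k = x k ** x k" by metis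
    have "\<exists>x0\<in>Q. star a ** a = x0 ** x0" using limit[of s x a] x s by blast
    moreover have "a \<in> G" using s by (intro G_limit[of s a]) (auto simp: T_def)
    ultimately show "a \<in> T" by (simp add: T_def)
  next
    fix s :: "nat \<Rightarrow> real^'n^'n" and d :: "nat \<Rightarrow> real" and Z s0
    assume s: "\<And>k. s k \<in> T" "s \<longlonglongrightarrow> s0" "s0 \<in> T" and d: "\<And>k. d k > 0" "d \<longlonglongrightarrow> 0" and Z: "Z \<in> L"
    have sG: "s k \<in> G" "s0 \<in> G" for k using s by (auto simp: T_def)
    have "\<forall>k. \<exists>x. x \<in> Q \<and> star (s k) ** s k = x ** x" using s(1) by (auto simp: T_def)
    then obtain x where x: "\<And>k. x k \<in> Q" "\<And>k. star (s k) ** s k = x k ** x k" by metis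
    obtain r x0 where r: "strict_mono (r :: nat \<Rightarrow> nat)" and lim: "(\<lambda>k. x (r k)) \<longlonglongrightarrow> x0"
      and x0: "x0 \<in> Q" "star s0 ** s0 = x0 ** x0"
      using limit[OF x(2,1) s(2) G_invertible[OF sG(2)]] by blast
    have xP: "x k \<in> Pos" "x k \<in> G" "x0 \<in> Pos" "x0 \<in> G" for k using x x0 Q by auto
    let ?i = "matrix_inv x0"
    have ii: "x0 ** ?i = mat 1" "?i ** x0 = mat 1"
      using xP Pos_invertible by (auto intro: matrix_inv_left matrix_inv_right)
    have iii: "matrix_inv ?i = x0" using ii by (intro matrix_inv_eq)
    \<comment> \<open>The displacement \<open>s0 ** Z\<close> is sought as
      \<open>s0 ** ?i ** (Y ** x0 + v ** x0 + x0 ** v)\<close> with \<open>Y\<close> skew and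
      \<open>v\<close> in \<open>pp\<close>. Skewness of \<open>Y\<close> is an equation for
      \<open>v\<close> alone, with right side \<open>W\<close>.\<close>
    define W where "W = x0 ** Z ** ?i + ?i ** star Z ** x0"
    have "W \<in> pp"
    proof -
      have "W \<in> L" unfolding W_def
        using lie_Ad[OF xP(4) Z] lie_Ad[OF G_inv[OF xP(4)] lie_star[OF Z]] iii by (auto intro: lie_add)
      moreover have "star W = W"
        by (simp add: W_def star_simps Pos_star xP star_Pos_inv matrix_mul_assoc add.commute)
      ultimately show ?thesis by (simp add: pp_def)
    qed
    then obtain v where v: "v \<in> pp" "2 *\<^sub>R v + x0 ** v ** ?i + ?i ** v ** x0 = W"
      by (rule pp_eq_symmetrized[OF xP(3,4)])
    have vL: "v \<in> L" "star v = v" using v by (auto simp: pp_def)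
    define Y where "Y = x0 ** Z ** ?i - v - x0 ** v ** ?i"
    have YL: "Y \<in> L" unfolding Y_def
      by (intro subspace_diff[OF subspace_lie] lie_Ad xP Z vL)
    have "star Y = ?i ** star Z ** x0 - v - ?i ** v ** x0"
      by (simp add: Y_def star_simps Pos_star xP star_Pos_inv matrix_mul_assoc vL)
    also have "\<dots> = W - x0 ** Z ** ?i - v - ?i ** v ** x0" by (simp add: W_def)
    also have "\<dots> = - Y" unfolding v(2)[symmetric] Y_def by (simp add: scaleR_2)
    finally have starY: "star Y = - Y" .
    have Yx: "(Y + v) ** x0 + x0 ** v = x0 ** Z"
    proof -
      have "(Y + v) ** x0 = x0 ** Z ** (?i ** x0) - x0 ** v ** (?i ** x0)"
        unfolding Y_def by (simp add: mat_ring)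
      then show ?thesis by (simp add: ii)
    qed
    define D where "D k = d (r k)" for k
    have D: "D k > 0" "D \<longlonglongrightarrow> 0" for k
      using d(1) LIMSEQ_subseq_LIMSEQ[OF d(2) r] by (simp_all add: D_def[abs_def] o_def)
    have Dn: "D k \<noteq> 0" for k using D(1)[of k] by simp
    \<comment> \<open>The orthogonal factor of \<open>s (r k)\<close>; it is kept while the positive
      factor \<open>x (r k)\<close> moves to \<open>w k\<close>.\<close>
    define kk where "kk k = s (r k) ** matrix_inv (x (r k))" for k
    have xinv: "matrix_inv (x j) ** x j = mat 1" "x j ** matrix_inv (x j) = mat 1" for j
      using xP Pos_invertible by (auto intro: matrix_inv_left matrix_inv_right)
    have sk: "s (r k) = kk k ** x (r k)" for k
      by (simp add: kk_def xinv flip: matrix_mul_assoc)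
    have kkG: "kk k \<in> G" for k unfolding kk_def by (intro G_mult G_inv sG xP)
    have kkK: "star (kk k) ** kk k = mat 1" for k
    proof -
      have "star (kk k) ** kk k = matrix_inv (x (r k)) ** (star (s (r k)) ** s (r k)) ** matrix_inv (x (r k))"
        by (simp add: kk_def star_mult star_Pos_inv xP matrix_mul_assoc)
      also have "\<dots> = (matrix_inv (x (r k)) ** x (r k)) ** (x (r k) ** matrix_inv (x (r k)))"
        unfolding x(2) by (simp only: matrix_mul_assoc)
      finally show ?thesis by (simp add: xinv)
    qed
    define E where "E k M = mexp (D k *\<^sub>R M)" for k and M :: "real^'n^'n"
    define w where "w k = E k v ** x (r k) ** E k v" for k
    have wQ: "w k \<in> Q" for k
      unfolding w_def E_def by (intro inv x subspace_scale[OF subspace_pp] v)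
    define u where "u k = kk k ** E k Y ** w k" for k
    have uT: "u k \<in> T" for k
    proof -
      have "star (E k Y) ** E k Y = mat 1"
        by (simp add: E_def star_mexp star_scaleR starY)
      then have "star (kk k ** E k Y) ** (kk k ** E k Y) = mat 1"
        by (metis star_mult kkK matrix_mul_assoc matrix_mul_lid)
      then have "star (u k) ** u k = star (w k) ** w k"
        unfolding u_def star_mult[of "kk k ** E k Y"] by (metis matrix_mul_assoc matrix_mul_lid)
      also have "star (w k) = w k" using wQ Q Pos_star by blast
      finally have "star (u k) ** u k = w k ** w k" .
      moreover have "u k \<in> G" unfolding u_def E_def
        using wQ[of k] Q(1) by (intro G_mult kkG lie_mexp_scaleR YL) auto
      ultimately show ?thesis using wQ[of k] by (auto simp: T_def)
    qed
    have kklim: "kk \<longlonglongrightarrow> s0 ** ?i"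
      unfolding kk_def using LIMSEQ_subseq_LIMSEQ[OF s(2) r] Pos_invertible[OF xP(3)]
      by (intro mm.tendsto tendsto_matrix_inv lim) (auto simp: o_def)
    have E1: "(\<lambda>k. E k M) \<longlonglongrightarrow> mat 1" for M unfolding E_def by (rule mexp_scaleR_tendsto_one[OF D(2)])
    have Eq: "(\<lambda>k. (1 / D k) *\<^sub>R (E k M - mat 1)) \<longlonglongrightarrow> M" for M
      unfolding E_def by (rule mexp_difference_quotient[OF D(2) Dn])
    have "(\<lambda>k. kk k ** (((1 / D k) *\<^sub>R (E k Y - mat 1)) ** (E k v ** x (r k) ** E k v)
        + ((1 / D k) *\<^sub>R (E k v - mat 1)) ** (x (r k) ** E k v)
        + x (r k) ** ((1 / D k) *\<^sub>R (E k v - mat 1)))) \<longlonglongrightarrow>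
        s0 ** ?i ** (Y ** (mat 1 ** x0 ** mat 1) + v ** (x0 ** mat 1) + x0 ** v)"
      by (intro mm.tendsto tendsto_add kklim lim E1 Eq)
    moreover have "kk k ** (((1 / D k) *\<^sub>R (E k Y - mat 1)) ** (E k v ** x (r k) ** E k v)
        + ((1 / D k) *\<^sub>R (E k v - mat 1)) ** (x (r k) ** E k v)
        + x (r k) ** ((1 / D k) *\<^sub>R (E k v - mat 1))) = (1 / D k) *\<^sub>R (u k - s (r k))" for k
      unfolding u_def w_def sk by (simp add: mat_ring scaleR_diff_right)
    moreover have "s0 ** ?i ** (Y ** (mat 1 ** x0 ** mat 1) + v ** (x0 ** mat 1) + x0 ** v) = s0 ** Z"
    proof -
      have "Y ** (mat 1 ** x0 ** mat 1) + v ** (x0 ** mat 1) + x0 ** v = x0 ** Z"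
        using Yx by (simp add: mat_ring)
      then have "s0 ** ?i ** (Y ** (mat 1 ** x0 ** mat 1) + v ** (x0 ** mat 1) + x0 ** v) = s0 ** (?i ** x0) ** Z"
        by (simp only: matrix_mul_assoc)
      then show ?thesis by (simp add: ii)
    qed
    ultimately have "(\<lambda>k. (1 / D k) *\<^sub>R (u k - s (r k))) \<longlonglongrightarrow> s0 ** Z" by (simp only:)
    then show "\<exists>r u. strict_mono r \<and> (\<forall>k::nat. u k \<in> T) \<and>
        (\<lambda>k. (1 / d (r k)) *\<^sub>R (u k - s (r k))) \<longlonglongrightarrow> s0 ** Z"
      using r uT unfolding D_def by blast
  qed
  with \<open>g \<in> G\<close> show ?thesis by (auto simp: T_def)
qed

lemma G_star_mult: "g \<in> G \<Longrightarrow> star g ** g \<in> G \<inter> Pos"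
  using star_mult_in_Pos G_invertible by (auto intro: G_mult G_star)

text \<open>
  Applied to the positive elements of \<open>G\<close> and then to the elements \<open>star g ** g\<close>, the previous
  lemma shows that the latter are closed under square roots.
\<close>

lemma star_mult_square_root:
  assumes "g \<in> G"
  obtains h where "h \<in> G" "star g ** g = (star h ** h) ** (star h ** h)"
proof -
  have star_e: "star (mexp v) = mexp v" if "v \<in> pp" for v
    using that by (simp add: pp_def star_mexp)
  have eG: "mexp v \<in> G" if "v \<in> pp" for v using that lie_mexp by (simp add: pp_def)
  have 1: "\<exists>x\<in>G \<inter> Pos. star g ** g = x ** x" if "g \<in> G" for g
  proof (rule star_mult_eq_square)
    show "mexp v ** x ** mexp v \<in> G \<inter> Pos" if "x \<in> G \<inter> Pos" "v \<in> pp" for x v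
      using that Pos_conj[of x "mexp v"] eG[of v] star_e[of v] invertible_mexp[of v] by (auto intro: G_mult)
    show "a \<in> G \<inter> Pos" if "\<And>k. s k \<in> G \<inter> Pos" "s \<longlonglongrightarrow> a" "invertible a" for s a
      using that G_limit[of s a] Pos_closed[of s a] by auto
  qed (use that G_one one_in_Pos in auto)
  define Q where "Q = (\<lambda>g. star g ** g) ` G"
  have "\<exists>x\<in>Q. star g ** g = x ** x"
  proof (rule star_mult_eq_square[OF _ _ _ _ assms])
    show "Q \<subseteq> G \<inter> Pos" using G_star_mult by (auto simp: Q_def)
    show "mat 1 \<in> Q" unfolding Q_def using G_one by (intro image_eqI[of _ _ "mat 1"]) auto
    show "mexp v ** x ** mexp v \<in> Q" if xv: "x \<in> Q" "v \<in> pp" for x v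
    proof -
      obtain h where h: "h \<in> G" "x = star h ** h" using xv by (auto simp: Q_def)
      have "mexp v ** x ** mexp v = star (h ** mexp v) ** (h ** mexp v)"
        by (simp add: h star_mult star_e[OF xv(2)] matrix_mul_assoc)
      then show ?thesis unfolding Q_def using G_mult[OF h(1) eG[OF xv(2)]] by blast
    qed
    \<comment> \<open>Here the first application enters: the elements \<open>s k\<close> have roots
      in \<open>G \<inter> Pos\<close>, and a limit \<open>x0\<close> of these is self-adjoint, so
      \<open>a = x0 ** x0 = star x0 ** x0\<close>.\<close>
    show "a \<in> Q" if s: "\<And>k. s k \<in> Q" "s \<longlonglongrightarrow> a" "invertible a" for s a
    proof -
      have "\<exists>x. x \<in> G \<inter> Pos \<and> s k = x ** x" for k
      proof -
        obtain h where "h \<in> G" "s k = star h ** h" using s(1)[of k] by (auto simp: Q_def)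
        with 1[of h] show ?thesis by (simp add: Bex_def)
      qed
      then have "\<forall>k. \<exists>x. x \<in> G \<inter> Pos \<and> s k = x ** x" ..
      from choice[OF this] obtain x where x: "\<And>k. x k \<in> G \<inter> Pos" "\<And>k. s k = x k ** x k" by auto
      have xP: "x k \<in> Pos" for k using x by auto
      have lim: "(\<lambda>k. x k ** x k) \<longlonglongrightarrow> a" using s(2) by (simp add: x(2)[symmetric])
      obtain x0 r where x0: "strict_mono (r :: nat \<Rightarrow> nat)" "(\<lambda>k. x (r k)) \<longlonglongrightarrow> x0"
        "x0 ** x0 = a" "star x0 = x0" "invertible x0"
        by (rule Pos_square_convergent_subsequence[OF xP lim s(3)])
      have "x0 \<in> G" using x x0 by (intro G_limit[of "\<lambda>k. x (r k)" x0]) auto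
      then show ?thesis using x0 unfolding Q_def by (intro image_eqI[of _ _ x0]) auto
    qed
  qed
  then show ?thesis using that by (auto simp: Q_def)
qed

text \<open>Iterated square roots put \<open>mexp ((1 / 2 ^ m) *\<^sub>R X)\<close> into
  \<open>G\<close> for all \<open>m\<close>; rescaled by \<open>2 ^ m\<close>, their deviations from
  the identity tend to \<open>X\<close>, which is therefore in \<open>L\<close>.\<close>

lemma star_mult_eq_mexp:
  assumes "g \<in> G"
  obtains X where "X \<in> pp" "star g ** g = mexp X"
proof -
  obtain X where X: "star X = X" "star g ** g = mexp X"
    using star_mult_in_Pos[OF G_invertible[OF assms]] by (auto simp: Pos_def)
  have root: "\<exists>h\<in>G. star h ** h = mexp ((1 / 2 ^ m) *\<^sub>R X)" for m
  proof (induction m)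
    case 0
    then show ?case using assms X by auto
  next
    case (Suc m)
    then obtain h where h: "h \<in> G" "star h ** h = mexp ((1 / 2 ^ m) *\<^sub>R X)" by blast
    obtain h' where h': "h' \<in> G" "star h ** h = (star h' ** h') ** (star h' ** h')"
      using star_mult_square_root[OF h(1)] by metis
    have "star h' ** h' = mexp ((1 / 2) *\<^sub>R ((1 / 2 ^ m) *\<^sub>R X))"
    proof (rule Pos_sqrt_unique)
      show "star h' ** h' \<in> Pos" using G_star_mult[OF h'(1)] by simp
      show "mexp ((1 / 2) *\<^sub>R ((1 / 2 ^ m) *\<^sub>R X)) \<in> Pos" unfolding Pos_def
        by (rule imageI) (simp add: star_scaleR X)
    qed (simp only: h'(2)[symmetric] h(2) mexp_half)
    then show ?case using h' by (intro bexI[of _ h']) (simp_all add: field_simps)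
  qed
  have "X \<in> L"
  proof (rule lie_limit)
    show "mexp ((1 / 2 ^ m) *\<^sub>R X) \<in> G" for m
      using root[of m] G_star_mult by fastforce
    have half: "(\<lambda>m. (1 / (2::real)) ^ m) \<longlonglongrightarrow> 0" by (rule LIMSEQ_realpow_zero) auto
    then show "filterlim (\<lambda>m. (2::real) ^ m) at_top sequentially"
      using filterlim_inverse_at_top[OF half] by (simp add: power_one_over)
    from half have "(\<lambda>m. 1 / (2::real) ^ m) \<longlonglongrightarrow> 0" by (simp add: power_one_over)
    from mexp_difference_quotient[OF this, of X]
    show "(\<lambda>m. 2 ^ m *\<^sub>R (mexp ((1 / 2 ^ m) *\<^sub>R X) - mat 1)) \<longlonglongrightarrow> X" by simp
  qed
  with X that show ?thesis by (auto simp: pp_def)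
qed

theorem polar_decomposition:
  assumes "g \<in> G"
  obtains k X where "k \<in> KK" "X \<in> pp" "g = k ** mexp X"
proof -
  obtain Y where Y: "Y \<in> pp" "star g ** g = mexp Y" using star_mult_eq_mexp[OF assms] by metis
  define X where "X = (1/2) *\<^sub>R Y"
  have X: "X \<in> pp" using Y subspace_pp by (simp add: X_def subspace_scale)
  have XX: "mexp X ** mexp X = star g ** g" unfolding X_def Y(2) by (rule mexp_half)
  define k where "k = g ** mexp (- X)"
  have "- X \<in> pp" using X subspace_pp by (simp add: subspace_neg)
  then have kG: "k \<in> G" and s: "star (mexp (- X)) = mexp (- X)"
    unfolding k_def using assms lie_mexp by (auto simp: pp_def star_mexp intro: G_mult)
  have "star k ** k = mexp (- X) ** (star g ** g) ** mexp (- X)"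
    by (simp add: k_def star_mult s matrix_mul_assoc)
  also have "\<dots> = (mexp (- X) ** mexp X) ** (mexp X ** mexp (- X))"
    unfolding XX[symmetric] by (simp only: matrix_mul_assoc)
  finally have "star k ** k = mat 1" by simp
  moreover have "g = k ** mexp X" by (simp add: k_def flip: matrix_mul_assoc)
  ultimately show ?thesis using that X kG by (auto simp: KK_def)
qed

end

section \<open>Restricted roots and existence of the Cartan decomposition\<close>

lemma mexp_scaleR_commute: "mexp (t *\<^sub>R X) ** X = X ** mexp (t *\<^sub>R X)"
  using exp_times_scaleR_commute[of t "Abs_matalg X"]
  by (metis Abs_matalg_inverse UNIV_I mexp_eq times_matalg.rep_eq scaleR_matalg.abs_eq)

text \<open>The derivative has the same shape with \<open>M\<close> replaced by its bracket with
  \<open>Y\<close>, so the lemma also gives the second derivative.\<close>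

lemma has_derivative_trace_mexp_conj:
  fixes Y M N :: "real^'n^'n"
  shows "((\<lambda>t. trace (mexp (t *\<^sub>R Y) ** M ** mexp (t *\<^sub>R (- Y)) ** N)) has_real_derivative
    trace (mexp (t *\<^sub>R Y) ** (Y ** M - M ** Y) ** mexp (t *\<^sub>R (- Y)) ** N)) (at t)"
proof -
  let ?e = "\<lambda>t. mexp (t *\<^sub>R Y)" and ?f = "\<lambda>t. mexp (t *\<^sub>R (- Y))"
  have "((\<lambda>t. ?e t ** M) has_vector_derivative (?e t ** 0 + (?e t ** Y) ** M)) (at t)"
    by (intro mm.has_vector_derivative has_vector_derivative_mexp has_vector_derivative_const)
  from mm.has_vector_derivative[OF this has_vector_derivative_mexp[of "- Y"]]
  have "((\<lambda>t. ?e t ** M ** ?f t) has_vector_derivative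
      (?e t ** M ** (?f t ** (- Y)) + (?e t ** 0 + (?e t ** Y) ** M) ** ?f t)) (at t)" .
  from mm.has_vector_derivative[OF this has_vector_derivative_const[of N]]
  have "((\<lambda>t. ?e t ** M ** ?f t ** N) has_vector_derivative
      (?e t ** M ** ?f t ** 0 + (?e t ** M ** (?f t ** (- Y)) + (?e t ** 0 + (?e t ** Y) ** M) ** ?f t) ** N)) (at t)" .
  from bounded_linear.has_vector_derivative[OF bounded_linear_trace this]
  have d: "((\<lambda>t. trace (?e t ** M ** ?f t ** N)) has_vector_derivative
      trace ((?e t ** M ** (?f t ** (- Y)) + (?e t ** Y) ** M ** ?f t) ** N)) (at t)" by simp
  have "?f t ** (- Y) = - Y ** ?f t" by (rule mexp_scaleR_commute)
  then have "?e t ** M ** (?f t ** (- Y)) + (?e t ** Y) ** M ** ?f t = ?e t ** (Y ** M - M ** Y) ** ?f t"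
    by (simp add: mat_ring)
  with d show ?thesis by (simp add: has_real_derivative_iff_has_vector_derivative)
qed

lemma trace_neg: "trace (- A) = - trace (A :: real^'n^'n)"
  by (simp add: trace_def sum_negf)

lemma second_derivative_at_max:
  fixes f :: "real \<Rightarrow> real"
  assumes f: "\<And>t. (f has_real_derivative f' t) (at t)" and f': "(f' has_real_derivative c) (at 0)"
    and max: "\<And>t. f t \<le> f 0"
  shows "f' 0 = 0" "c \<le> 0"
proof -
  show 0: "f' 0 = 0" by (rule DERIV_local_max[OF f[of 0], of 1]) (use max in auto)
  show "c \<le> 0"
  proof (rule ccontr)
    assume "\<not> c \<le> 0"
    then obtain e where e: "e > 0" "\<And>h. 0 < h \<Longrightarrow> h < e \<Longrightarrow> f' 0 < f' h"
      using DERIV_pos_inc_right[OF f'] by auto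
    obtain z where z: "0 < z" "z < e / 2" "f (e / 2) - f 0 = (e / 2 - 0) * f' z"
      using MVT2[of 0 "e / 2" f f'] e f by auto
    have "f' z > 0" using e(2)[of z] z e(1) 0 by simp
    then have "(e / 2) * f' z > 0" using e(1) by simp
    then show False using z(3) max[of "e / 2"] by simp
  qed
qed

locale weyl_chamber = lie_group S Si G
  for S Si :: "real^'n^'n" and G :: "(real^'n^'n) set" +
  fixes A C :: "(real^'n^'n) set"
  assumes maximal_abelian: "maximal_abelian_subspace pp A"
    and chamber: "C \<in> components {X \<in> A. \<forall>\<alpha>. restricted_root G A \<alpha> \<longrightarrow> \<alpha> X \<noteq> 0}"
begin

definition regular where "regular = {X \<in> A. \<forall>\<alpha>. restricted_root G A \<alpha> \<longrightarrow> \<alpha> X \<noteq> 0}"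

lemma A_subspace: "subspace A" and A_pp: "X \<in> A \<Longrightarrow> X \<in> pp"
  and A_commute: "X \<in> A \<Longrightarrow> Y \<in> A \<Longrightarrow> X ** Y = Y ** X"
  using maximal_abelian
  by (auto simp: maximal_abelian_subspace_def abelian_subspace_def lie_bracket_def)

lemma A_star: "X \<in> A \<Longrightarrow> star X = X" and A_lie: "X \<in> A \<Longrightarrow> X \<in> L"
  using A_pp by (auto simp: pp_def)

lemma linear_lie_bracket: "linear (lie_bracket X)" "linear (\<lambda>X. lie_bracket X Y)"
  by (simp_all add: linear_iff lie_bracket_def mat_ring algebra_simps)

text \<open>For self-adjoint \<open>H\<close> the map \<open>lie_bracket H\<close> is self-adjoint
  with respect to \<open>ip\<close>, and these maps commute for \<open>H\<close> in
  \<open>A\<close>. The map \<open>cj\<close> moves the situation to the standard inner product, for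
  which the spectral theorem is stated.\<close>

lemma joint_eigenvectors_span:
  assumes W: "subspace W" and inv: "\<And>H X. H \<in> A \<Longrightarrow> X \<in> W \<Longrightarrow> lie_bracket H X \<in> W"
  shows "W \<subseteq> span {E \<in> W. \<forall>H\<in>A. \<exists>l. lie_bracket H E = l *\<^sub>R E}"
proof -
  define f where "f H M = lie_bracket (cj H) M" for H M
  have fcj: "f H (cj X) = cj (lie_bracket H X)" for H X
    by (simp add: f_def lie_bracket_def cj_mult linear_diff[OF linear_cj])
  have cross: "trace (a ** b ** c) = trace (b ** c ** a)" for a b c :: "real^'n^'n"
    using trace_mul_sym[of a "b ** c"] by (simp add: matrix_mul_assoc)
  interpret commuting_self_adjoint "f ` A" "cj ` W"
  proof (rule commuting_self_adjoint.intro)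
    show "subspace (cj ` W)" by (rule linear_subspace_image[OF linear_cj W])
    show "linear g" if "g \<in> f ` A" for g
      using that linear_lie_bracket(1) unfolding f_def by auto
    show "g ` cj ` W \<subseteq> cj ` W" if "g \<in> f ` A" for g
      using that inv by (auto simp: fcj)
    show "g x \<bullet> y = x \<bullet> g y" if g: "g \<in> f ` A" for g x y
    proof -
      obtain H where H: "H \<in> A" "g = f H" using g by auto
      have h: "transpose (cj H) = cj H" using A_star[OF H(1)] cj_star[of H] by simp
      have "trace (cj H ** x ** transpose y) = trace (x ** transpose y ** cj H)" by (rule cross)
      then show ?thesis
        by (simp add: H(2) f_def lie_bracket_def inner_eq_trace h mat_ring trace_sub
            matrix_transpose_mul linear_diff[OF linear_transpose])
    qed
    show "g (h x) = h (g x)" if gh: "g \<in> f ` A" "h \<in> f ` A" for g h x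
    proof -
      obtain H H' where H: "H \<in> A" "g = f H" "H' \<in> A" "h = f H'" using gh by auto
      have c: "cj H ** cj H' = cj H' ** cj H" using A_commute[OF H(1,3)] by (metis cj_mult)
      have c1: "cj H ** cj H' ** x = cj H' ** cj H ** x" "x ** cj H ** cj H' = x ** cj H' ** cj H"
        using c by (simp, metis c matrix_mul_assoc)
      show ?thesis by (simp add: H f_def lie_bracket_def mat_ring c1)
    qed
  qed
  define ci where "ci M = Si ** M ** S" for M
  have lci: "linear ci" by (simp add: linear_iff ci_def mat_ring)
  have cicj: "ci (cj X) = X" for X by (simp add: ci_def cj_def matrix_mul_assoc Si_S)
  let ?E = "{E \<in> W. \<forall>H\<in>A. \<exists>l. lie_bracket H E = l *\<^sub>R E}"
  have J: "ci ` joint_eigenvectors \<subseteq> ?E"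
  proof safe
    fix M assume M: "M \<in> joint_eigenvectors"
    then obtain E where E: "E \<in> W" "M = cj E" by (auto simp: joint_eigenvectors_def)
    then show "ci M \<in> W" by (simp add: cicj)
    fix H assume "H \<in> A"
    then obtain l where "f H M = l *\<^sub>R M" using M by (auto simp: joint_eigenvectors_def)
    then have "cj (lie_bracket H E) = cj (l *\<^sub>R E)" by (simp add: E fcj linear_scale[OF linear_cj])
    then show "\<exists>l. lie_bracket H (ci M) = l *\<^sub>R ci M" by (auto simp: cj_inj E cicj)
  qed
  show ?thesis
  proof
    fix X assume "X \<in> W"
    then have "cj X \<in> span joint_eigenvectors" using span_joint_eigenvectors by blast
    then have "ci (cj X) \<in> span (ci ` joint_eigenvectors)"
      using linear_span_image[OF lci, of joint_eigenvectors] by blast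
    then show "X \<in> span ?E" using span_mono[OF J] by (auto simp: cicj)
  qed
qed

lemma root_functional:
  assumes E: "E \<in> L" "E \<noteq> 0" "\<And>H. H \<in> A \<Longrightarrow> \<exists>l. lie_bracket H E = l *\<^sub>R E"
    and H: "H \<in> A" "lie_bracket H E \<noteq> 0"
  obtains \<alpha> where "restricted_root G A \<alpha>" "\<And>H. H \<in> A \<Longrightarrow> lie_bracket H E = \<alpha> H *\<^sub>R E"
proof -
  define \<alpha> where "\<alpha> H = (SOME l. lie_bracket H E = l *\<^sub>R E)" for H
  have \<alpha>: "lie_bracket H E = \<alpha> H *\<^sub>R E" if "H \<in> A" for H
    unfolding \<alpha>_def by (rule someI_ex) (rule E(3)[OF that])
  moreover have "\<alpha> H \<noteq> 0" using \<alpha>[OF H(1)] H(2) by auto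
  ultimately have "restricted_root G A \<alpha>"
    unfolding restricted_root_def using E(1,2) H(1) by blast
  with \<alpha> that show ?thesis by blast
qed

lemma regular_joint_eigenvector_centralizer:
  assumes T: "T \<in> regular" and E: "E \<in> L" "\<And>H. H \<in> A \<Longrightarrow> \<exists>l. lie_bracket H E = l *\<^sub>R E"
    and 0: "lie_bracket T E = 0" and H: "H \<in> A"
  shows "lie_bracket H E = 0"
proof (rule ccontr)
  assume n: "lie_bracket H E \<noteq> 0"
  then have "E \<noteq> 0" by (auto simp: lie_bracket_def)
  from root_functional[OF E(1) this E(2) H n]
  obtain \<alpha> where \<alpha>: "restricted_root G A \<alpha>" "\<And>H. H \<in> A \<Longrightarrow> lie_bracket H E = \<alpha> H *\<^sub>R E" by metis
  have "\<alpha> T = 0" using \<alpha>(2)[of T] T 0 \<open>E \<noteq> 0\<close> by (simp add: regular_def)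
  then show False using T \<alpha>(1) by (auto simp: regular_def)
qed

lemma lie_bracket_A_commute:
  assumes "H \<in> A" "H' \<in> A"
  shows "lie_bracket H (lie_bracket H' X) = lie_bracket H' (lie_bracket H X)"
proof -
  have c: "H ** H' = H' ** H" using assms by (rule A_commute)
  have "H ** H' ** X = H' ** H ** X" "X ** H ** H' = X ** H' ** H"
    using c by (simp, metis c matrix_mul_assoc)
  then show ?thesis by (simp add: lie_bracket_def mat_ring)
qed

lemma lie_bracket_lie: "X \<in> L \<Longrightarrow> Y \<in> L \<Longrightarrow> lie_bracket X Y \<in> L"
  unfolding lie_bracket_def by (rule lie_bracket_closed)

lemma subspace_ad_eigenspace: "subspace {X \<in> L. lie_bracket T X = t *\<^sub>R X}"
  using subspace_lie
  by (auto simp: subspace_def linear_0[OF linear_lie_bracket(1)] linear_add[OF linear_lie_bracket(1)]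
      linear_scale[OF linear_lie_bracket(1)] algebra_simps)

lemma ad_eigenspace_invariant:
  assumes "T \<in> A" "H \<in> A" "X \<in> {X \<in> L. lie_bracket T X = t *\<^sub>R X}"
  shows "lie_bracket H X \<in> {X \<in> L. lie_bracket T X = t *\<^sub>R X}"
  using assms lie_bracket_A_commute[OF assms(1,2)] A_lie lie_bracket_lie linear_scale[OF linear_lie_bracket(1)]
  by simp

text \<open>The kernel of \<open>lie_bracket T\<close> on \<open>L\<close> is spanned by joint
  eigenvectors of \<open>A\<close>; a root occurring among them would vanish at the regular element
  \<open>T\<close>.\<close>

lemma regular_centralizer:
  assumes T: "T \<in> regular" and Z: "Z \<in> L" "lie_bracket T Z = 0" and H: "H \<in> A"
  shows "lie_bracket H Z = 0"
proof -
  let ?W = "{X \<in> L. lie_bracket T X = 0 *\<^sub>R X}"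
  have TA: "T \<in> A" using T by (simp add: regular_def)
  have "?W \<subseteq> span {E \<in> ?W. \<forall>H\<in>A. \<exists>l. lie_bracket H E = l *\<^sub>R E}"
    by (rule joint_eigenvectors_span[OF subspace_ad_eigenspace ad_eigenspace_invariant[OF TA]])
  then have "Z \<in> span {E \<in> ?W. \<forall>H\<in>A. \<exists>l. lie_bracket H E = l *\<^sub>R E}" using Z by auto
  moreover have "lie_bracket H E = 0" if "E \<in> {E \<in> ?W. \<forall>H\<in>A. \<exists>l. lie_bracket H E = l *\<^sub>R E}" for E
    using that regular_joint_eigenvector_centralizer[OF T _ _ _ H, of E] by simp
  ultimately show ?thesis
    using linear_eq_0_on_span[OF linear_lie_bracket(1)] by blast
qed

text \<open>\<open>Z\<close> commutes with \<open>A\<close>, so together they span an abelian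
  subspace of \<open>pp\<close>, and \<open>A\<close> is maximal.\<close>

lemma regular_centralizer_pp:
  assumes T: "T \<in> regular" and Z: "Z \<in> pp" "lie_bracket T Z = 0"
  shows "Z \<in> A"
proof -
  have ZA: "H ** Z = Z ** H" if "H \<in> A" for H
    using regular_centralizer[OF T _ Z(2) that] Z(1) by (simp add: pp_def lie_bracket_def)
  let ?A = "span (insert Z A)"
  have decomp: "\<exists>a c. a \<in> A \<and> X = a + c *\<^sub>R Z" if X: "X \<in> ?A" for X
  proof -
    obtain c where "X - c *\<^sub>R Z \<in> span A" using X span_breakdown_eq by blast
    then have "X - c *\<^sub>R Z \<in> A" using A_subspace span_eq_iff by blast
    then show ?thesis by (intro exI[of _ "X - c *\<^sub>R Z"] exI[of _ c]) simp
  qed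
  have "lie_bracket X Y = 0" if X: "X \<in> ?A" and Y: "Y \<in> ?A" for X Y
  proof -
    obtain a c b d where "a \<in> A" "X = a + c *\<^sub>R Z" "b \<in> A" "Y = b + d *\<^sub>R Z"
      using decomp[OF X] decomp[OF Y] by auto
    then show ?thesis using A_commute[of a b] ZA[of a] ZA[of b]
      by (simp add: lie_bracket_def mat_ring algebra_simps)
  qed
  moreover have "?A \<subseteq> pp" using A_pp Z(1) by (intro span_minimal subspace_pp) auto
  ultimately have "abelian_subspace pp ?A" by (simp add: abelian_subspace_def)
  moreover have "A \<subseteq> ?A" using span_superset by blast
  ultimately have "?A = A" using maximal_abelian by (simp add: maximal_abelian_subspace_def)
  then show ?thesis using span_base[of Z "insert Z A"] by auto
qed

lemma C_regular: "C \<subseteq> regular" and C_nonempty: "C \<noteq> {}" and C_connected: "connected C"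
  using chamber in_components_subset in_components_nonempty in_components_connected
  unfolding regular_def by blast+

lemma C_maximal: "connected D \<Longrightarrow> D \<subseteq> regular \<Longrightarrow> T \<in> D \<Longrightarrow> T \<in> C \<Longrightarrow> D \<subseteq> C"
  using components_maximal[OF chamber, of D] unfolding regular_def by blast

lemma closure_C_A: "closure C \<subseteq> A"
proof (rule closure_minimal[OF _ closed_subspace[OF A_subspace]])
  show "C \<subseteq> A" using C_regular unfolding regular_def by blast
qed

lemma root_linear:
  assumes \<alpha>: "restricted_root G A \<alpha>" and X: "X \<in> A" "Y \<in> A"
  shows "\<alpha> (a *\<^sub>R X + b *\<^sub>R Y) = a * \<alpha> X + b * \<alpha> Y"
proof -
  obtain E where E: "E \<noteq> 0" "\<And>H. H \<in> A \<Longrightarrow> lie_bracket H E = \<alpha> H *\<^sub>R E"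
    using \<alpha> by (auto simp: restricted_root_def)
  have "a *\<^sub>R X + b *\<^sub>R Y \<in> A" using X A_subspace by (intro subspace_add subspace_scale)
  from E(2)[OF this] have "\<alpha> (a *\<^sub>R X + b *\<^sub>R Y) *\<^sub>R E = (a * \<alpha> X + b * \<alpha> Y) *\<^sub>R E"
    using E(2)[OF X(1)] E(2)[OF X(2)]
    by (simp add: linear_add[OF linear_lie_bracket(2)] linear_scale[OF linear_lie_bracket(2)] algebra_simps)
  then show ?thesis using E(1) by simp
qed

text \<open>A positive multiple of \<open>T\<close> added to a nonnegative multiple of
  \<open>Z\<close> is regular, since each root has the sign there that it has at \<open>T\<close>.
  So the segment from \<open>T\<close> to \<open>Z + s *\<^sub>R T\<close> stays in the component
  \<open>C\<close>; then \<open>s\<close> tends to 0.\<close>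

lemma in_closure_C:
  assumes T: "T \<in> C" and Z: "Z \<in> A"
    and pos: "\<And>\<alpha>. restricted_root G A \<alpha> \<Longrightarrow> \<alpha> Z * \<alpha> T \<ge> 0"
  shows "Z \<in> closure C"
proof -
  have Tr: "T \<in> regular" using T C_regular by blast
  then have TA: "T \<in> A" by (simp add: regular_def)
  have reg: "a *\<^sub>R Z + b *\<^sub>R T \<in> regular" if "a \<ge> 0" "b > 0" for a b
  proof -
    have "\<alpha> (a *\<^sub>R Z + b *\<^sub>R T) \<noteq> 0" if \<alpha>: "restricted_root G A \<alpha>" for \<alpha>
    proof -
      have "\<alpha> T \<noteq> 0" using Tr \<alpha> by (auto simp: regular_def)
      then have "b * (\<alpha> T * \<alpha> T) > 0" using \<open>b > 0\<close> by (simp add: zero_less_mult_iff) linarith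
      moreover have "a * (\<alpha> Z * \<alpha> T) \<ge> 0" using \<open>a \<ge> 0\<close> pos[OF \<alpha>] by simp
      ultimately have "(a * \<alpha> Z + b * \<alpha> T) * \<alpha> T > 0" by (simp add: algebra_simps)
      then show ?thesis unfolding root_linear[OF \<alpha> Z TA] by auto
    qed
    moreover have "a *\<^sub>R Z + b *\<^sub>R T \<in> A" using Z TA A_subspace by (intro subspace_add subspace_scale)
    ultimately show ?thesis by (simp add: regular_def)
  qed
  have inC: "Z + s *\<^sub>R T \<in> C" if s: "s > 0" for s
  proof -
    have "closed_segment T (Z + s *\<^sub>R T) \<subseteq> regular"
    proof
      fix x assume "x \<in> closed_segment T (Z + s *\<^sub>R T)"
      then obtain u where u: "0 \<le> u" "u \<le> 1" "x = (1 - u) *\<^sub>R T + u *\<^sub>R (Z + s *\<^sub>R T)"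
        by (auto simp: in_segment)
      have "x = u *\<^sub>R Z + ((1 - u) + u * s) *\<^sub>R T" by (simp add: u algebra_simps)
      moreover have "(1 - u) + u * s > 0"
        using u s by (cases "u = 1") (auto intro: add_pos_nonneg)
      ultimately show "x \<in> regular" using reg[of u] u by simp
    qed
    from C_maximal[OF connected_segment(1) this _ T] show ?thesis by auto
  qed
  have "(\<lambda>k. Z + inverse (real (Suc k)) *\<^sub>R T) \<longlonglongrightarrow> Z + 0 *\<^sub>R T"
    by (intro tendsto_intros LIMSEQ_inverse_real_of_nat)
  then have "(\<lambda>k. Z + inverse (real (Suc k)) *\<^sub>R T) \<longlonglongrightarrow> Z" by simp
  moreover have "\<forall>k. Z + inverse (real (Suc k)) *\<^sub>R T \<in> C" by (simp add: inC)
  ultimately show ?thesis unfolding closure_sequential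
    by (intro exI[of _ "\<lambda>k. Z + inverse (real (Suc k)) *\<^sub>R T"]) auto
qed

text \<open>The values of \<open>\<alpha>\<close> outside \<open>A\<close> are arbitrary, so
  continuity is argued for the linear functional \<open>b\<close>, which on \<open>A\<close> is a
  positive multiple of \<open>\<alpha>\<close>. It has no zero on the connected set
  \<open>C\<close>.\<close>

lemma root_nonneg_on_closure_C:
  assumes \<alpha>: "restricted_root G A \<alpha>" and T: "T \<in> C" "\<alpha> T > 0" and X: "X \<in> closure C"
  shows "\<alpha> X \<ge> 0"
proof -
  obtain E where E: "E \<noteq> 0" "\<And>H. H \<in> A \<Longrightarrow> lie_bracket H E = \<alpha> H *\<^sub>R E"
    using \<alpha> by (auto simp: restricted_root_def)
  define b where "b H = ip (lie_bracket H E) E" for H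
  have "linear b" unfolding b_def
    by (simp add: linear_iff ip_add_left ip_scaleR_left linear_add[OF linear_lie_bracket(2)]
        linear_scale[OF linear_lie_bracket(2)])
  then have cont: "continuous_on UNIV b" by (simp add: linear_continuous_on linear_conv_bounded_linear)
  have b: "b H = \<alpha> H * ip E E" if "H \<in> A" for H by (simp add: b_def E(2)[OF that] ip_scaleR_left)
  have pE: "ip E E > 0" using E(1) by (rule ip_pos)
  have CA: "C \<subseteq> A" using C_regular unfolding regular_def by blast
  have conn: "connected (b ` C)"
    using C_connected cont by (intro connected_continuous_image) (auto intro: continuous_on_subset)
  have nz: "0 \<notin> b ` C"
  proof
    assume "0 \<in> b ` C"
    then obtain H where "H \<in> C" "b H = 0" by auto
    then have "\<alpha> H = 0" "H \<in> regular" using b[of H] CA pE E(1) C_regular by auto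
    then show False using \<alpha> by (auto simp: regular_def)
  qed
  have bT: "b T \<in> b ` C" "b T > 0" using T CA b[of T] pE by auto
  have "b H > 0" if "H \<in> C" for H
  proof (rule ccontr)
    assume "\<not> b H > 0"
    then have "0 \<in> b ` C"
      using connectedD_interval[OF conn, of "b H" "b T" 0] that bT by auto
    with nz show False by simp
  qed
  then have "C \<subseteq> b -` {0..}" by (auto intro: less_imp_le)
  moreover have "closed (b -` {0..})" by (intro closed_vimage cont closed_atLeast)
  ultimately have "X \<in> b -` {0..}" using X closure_minimal by blast
  then have "\<alpha> X * ip E E \<ge> 0" using b[of X] X closure_C_A by auto
  then show ?thesis using pE by (simp add: zero_le_mult_iff)
qed

lemma KK_group:
  assumes "k \<in> KK"
  shows "k \<in> G" "star k ** k = mat 1" "k ** star k = mat 1" "star k \<in> KK" "matrix_inv k = star k"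
proof -
  show 1: "k \<in> G" "star k ** k = mat 1" using assms by (auto simp: KK_def)
  then show 2: "k ** star k = mat 1" using matrix_left_right_inverse by blast
  show "star k \<in> KK" using 1 2 G_star by (simp add: KK_def)
  show "matrix_inv k = star k" by (rule matrix_inv_eq[OF 2])
qed

lemma KK_mult: "k \<in> KK \<Longrightarrow> l \<in> KK \<Longrightarrow> k ** l \<in> KK"
  unfolding KK_def by (auto simp: star_mult intro: G_mult) (metis matrix_mul_assoc matrix_mul_lid)

lemma KK_one: "mat 1 \<in> KK" using G_one by (simp add: KK_def)

lemma mexp_in_KK: "Y \<in> L \<Longrightarrow> star Y = - Y \<Longrightarrow> mexp Y \<in> KK"
  by (simp add: KK_def lie_mexp star_mexp)

lemma compact_KK: "compact KK"
proof -
  have "bounded KK"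
  proof -
    obtain c where c: "c > 0" "\<And>X. norm X \<le> c * sqrt (ip X X)" using norm_le_ip by auto
    have "norm k \<le> c * sqrt (trace (mat 1 :: real^'n^'n))" if "k \<in> KK" for k
      using c(2)[of k] KK_group[OF that] by (simp add: ip_def)
    then show ?thesis unfolding bounded_iff by blast
  qed
  moreover have "closed KK"
    unfolding closed_sequential_limits
  proof safe
    fix x l assume x: "\<forall>k. x k \<in> KK" "x \<longlonglongrightarrow> l"
    have "(\<lambda>k. star (x k) ** x k) \<longlonglongrightarrow> star l ** l" by (intro mm.tendsto tendsto_star x)
    moreover have "(\<lambda>k. star (x k) ** x k) = (\<lambda>k. mat 1)" using x(1) KK_group(2) by auto
    ultimately have l: "star l ** l = mat 1" using LIMSEQ_unique tendsto_const by metis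
    then have "invertible l" using matrix_left_right_inverse unfolding invertible_def by blast
    then have "l \<in> G" using x KK_group(1) by (intro G_limit[of x l]) auto
    with l show "l \<in> KK" by (simp add: KK_def)
  qed
  ultimately show ?thesis by (simp add: compact_eq_bounded_closed)
qed

lemma KK_conj_pp:
  assumes "k \<in> KK" "X \<in> pp"
  shows "k ** X ** star k \<in> pp"
  using assms lie_Ad[OF KK_group(1)[OF assms(1)], of X] KK_group(5)[OF assms(1)]
  by (simp add: pp_def star_mult matrix_mul_assoc)

text \<open>
  The conjugate of \<open>X\<close> in the closed chamber is the one that maximizes \<open>trace (k X k\<^sup>* T)\<close> for a
  fixed element \<open>T\<close> of the open chamber: the first derivative gives membership in \<open>A\<close>, the second
  one the sign of the roots.
\<close>

lemma pp_conj_closure_C: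
  assumes X: "X \<in> pp"
  obtains k where "k \<in> KK" "k ** X ** star k \<in> closure C"
proof -
  obtain T where T: "T \<in> C" using C_nonempty by blast
  then have Tr: "T \<in> regular" using C_regular by blast
  then have TA: "T \<in> A" by (simp add: regular_def)
  have cont: "continuous_on KK (\<lambda>k. trace (k ** X ** star k ** T))"
    by (intro bounded_linear.continuous_on[OF bounded_linear_trace] mm.continuous_on continuous_on_const
        continuous_on_id bounded_linear.continuous_on[OF bounded_linear_star])
  have "KK \<noteq> {}" using KK_one by auto
  from continuous_attains_sup[OF compact_KK this cont] obtain k where k: "k \<in> KK"
    and max: "\<And>l. l \<in> KK \<Longrightarrow> trace (l ** X ** star l ** T) \<le> trace (k ** X ** star k ** T)"
    by auto
  define Z where "Z = k ** X ** star k"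
  have Zpp: "Z \<in> pp" unfolding Z_def by (rule KK_conj_pp[OF k X])
  then have Zs: "star Z = Z" "Z \<in> L" by (auto simp: pp_def)
  have Ts: "star T = T" "T \<in> L" using TA A_star A_lie by auto
  have tr3: "trace (a ** b ** c) = trace (b ** c ** a)" for a b c :: "real^'n^'n"
    using trace_mul_sym[of a "b ** c"] by (simp add: matrix_mul_assoc)
  have crit: "trace ((Y ** Z - Z ** Y) ** T) = 0"
    "trace ((Y ** (Y ** Z - Z ** Y) - (Y ** Z - Z ** Y) ** Y) ** T) \<le> 0"
    if Y: "Y \<in> L" "star Y = - Y" for Y
  proof -
    define f where "f t = trace (mexp (t *\<^sub>R Y) ** Z ** mexp (t *\<^sub>R (- Y)) ** T)" for t
    define f' where "f' t = trace (mexp (t *\<^sub>R Y) ** (Y ** Z - Z ** Y) ** mexp (t *\<^sub>R (- Y)) ** T)" for t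
    have le: "f t \<le> f 0" for t
    proof -
      have s: "star (t *\<^sub>R Y) = - (t *\<^sub>R Y)" by (simp add: star_scaleR Y)
      have m: "mexp (t *\<^sub>R Y) \<in> KK" by (rule mexp_in_KK[OF lie_scaleR[OF Y(1)] s])
      have "mexp (t *\<^sub>R Y) ** Z ** mexp (t *\<^sub>R (- Y)) =
          (mexp (t *\<^sub>R Y) ** k) ** X ** star (mexp (t *\<^sub>R Y) ** k)"
        by (simp add: Z_def star_mult star_mexp s matrix_mul_assoc)
      then show ?thesis using max[OF KK_mult[OF m k]] by (simp add: f_def Z_def)
    qed
    have d1: "(f has_real_derivative f' t) (at t)" for t
      unfolding f_def f'_def by (rule has_derivative_trace_mexp_conj)
    have d2: "(f' has_real_derivative trace (mexp (0 *\<^sub>R Y) **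
        (Y ** (Y ** Z - Z ** Y) - (Y ** Z - Z ** Y) ** Y) ** mexp (0 *\<^sub>R (- Y)) ** T)) (at 0)"
      unfolding f'_def by (rule has_derivative_trace_mexp_conj)
    show "trace ((Y ** Z - Z ** Y) ** T) = 0"
      using second_derivative_at_max(1)[OF d1 d2 le] by (simp add: f'_def)
    show "trace ((Y ** (Y ** Z - Z ** Y) - (Y ** Z - Z ** Y) ** Y) ** T) \<le> 0"
      using second_derivative_at_max(2)[OF d1 d2 le] by simp
  qed
  have "lie_bracket T Z = 0"
  proof -
    \<comment> \<open>A bracket of self-adjoint matrices is skew, hence an admissible direction, and
      the first derivative along it is its squared norm.\<close>
    define Y where "Y = lie_bracket T Z"
    have Y: "Y \<in> L" "star Y = - Y"
      using lie_bracket_lie[OF Ts(2) Zs(2)] by (auto simp: Y_def lie_bracket_def star_simps Zs Ts)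
    have "trace ((Y ** Z - Z ** Y) ** T) = trace (Y ** Z ** T) - trace (Y ** T ** Z)"
      using tr3[of Z Y T] by (simp add: mat_ring trace_sub)
    also have "\<dots> = trace (Y ** star Y)"
      by (simp add: Y(2)) (simp add: Y_def lie_bracket_def mat_ring trace_sub)
    finally have "ip Y Y = 0" using crit(1)[OF Y] by (simp add: ip_def)
    then show ?thesis by (simp add: Y_def)
  qed
  then have ZA: "Z \<in> A" by (rule regular_centralizer_pp[OF Tr Zpp])
  have "\<alpha> Z * \<alpha> T \<ge> 0" if \<alpha>: "restricted_root G A \<alpha>" for \<alpha>
  proof -
    obtain E where E: "E \<in> L" "E \<noteq> 0" "\<And>H. H \<in> A \<Longrightarrow> lie_bracket H E = \<alpha> H *\<^sub>R E"
      using \<alpha> by (auto simp: restricted_root_def)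
    have sE: "lie_bracket H (star E) = (- \<alpha> H) *\<^sub>R star E" if "H \<in> A" for H
    proof -
      have "lie_bracket H (star E) = - star (lie_bracket H E)"
        by (simp add: lie_bracket_def star_simps A_star[OF that])
      then show ?thesis by (simp add: E(3)[OF that] star_scaleR)
    qed
    \<comment> \<open>The root vector is split into a skew part \<open>Y\<close>, tangent to
      \<open>KK\<close>, and a self-adjoint part \<open>P\<close>; an element of \<open>A\<close>
      exchanges them, up to the value of the root. The second derivative along \<open>Y\<close> is
      then \<open>- (\<alpha> Z * \<alpha> T * ip P P)\<close>.\<close>
    define Y where "Y = E - star E"
    define P where "P = E + star E"
    have Y: "Y \<in> L" "star Y = - Y"
      using E(1) lie_star subspace_diff[OF subspace_lie] by (auto simp: Y_def star_simps)
    have HY: "lie_bracket H Y = \<alpha> H *\<^sub>R P" if "H \<in> A" for H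
      by (simp add: Y_def P_def linear_diff[OF linear_lie_bracket(1)] E(3) sE that scaleR_add_right)
    have HP: "lie_bracket H P = \<alpha> H *\<^sub>R Y" if "H \<in> A" for H
      by (simp add: Y_def P_def linear_add[OF linear_lie_bracket(1)] E(3) sE that scaleR_diff_right)
    have sP: "star P = P" by (simp add: P_def star_simps)
    have "\<alpha> T \<noteq> 0" using Tr \<alpha> by (auto simp: regular_def)
    have "P \<noteq> 0"
    proof
      assume "P = 0"
      then have "Y = 0" using HP[OF TA] \<open>\<alpha> T \<noteq> 0\<close> by (simp add: lie_bracket_def)
      moreover have "2 *\<^sub>R E = Y + P" by (simp add: Y_def P_def scaleR_2)
      ultimately have "E = 0" using \<open>P = 0\<close> by simp
      with E(2) show False by simp
    qed
    define M where "M = Y ** Z - Z ** Y"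
    have "M = - lie_bracket Z Y" by (simp add: M_def lie_bracket_def)
    then have M: "M = - (\<alpha> Z *\<^sub>R P)" by (simp add: HY[OF ZA])
    have "trace ((Y ** M - M ** Y) ** T) = trace (M ** lie_bracket T Y)"
      using tr3[of Y M T] by (simp add: lie_bracket_def mat_ring trace_sub)
    also have "\<dots> = - (\<alpha> Z * \<alpha> T * ip P P)"
      unfolding HY[OF TA] M by (simp add: mat_ring trace_scaleR ip_def sP trace_neg)
    finally have "\<alpha> Z * \<alpha> T * ip P P \<ge> 0" using crit(2)[OF Y] by (simp add: M_def)
    then show ?thesis using ip_pos[OF \<open>P \<noteq> 0\<close>] by (simp add: zero_le_mult_iff)
  qed
  from in_closure_C[OF T ZA this] show ?thesis using that k by (simp add: Z_def)
qed

theorem cartan_decomposition: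
  assumes "g \<in> G"
  obtains k l Z where "k \<in> KK" "l \<in> KK" "Z \<in> closure C" "g = k ** mexp Z ** l"
proof -
  obtain k X where k: "k \<in> KK" "X \<in> pp" "g = k ** mexp X" by (rule polar_decomposition[OF assms])
  obtain l where l: "l \<in> KK" "l ** X ** star l \<in> closure C" by (rule pp_conj_closure_C[OF k(2)])
  have "star l ** mexp (l ** X ** star l) ** l = (star l ** l) ** mexp X ** (star l ** l)"
    unfolding mexp_conj[OF KK_group(3,2)[OF l(1)]] by (simp only: matrix_mul_assoc)
  then have "g = (k ** star l) ** mexp (l ** X ** star l) ** l"
    by (simp add: k(3) KK_group[OF l(1)] flip: matrix_mul_assoc)
  then show ?thesis using that[OF KK_mult[OF k(1) KK_group(4)[OF l(1)]] l] by blast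
qed

end

section \<open>Polynomial functions of a matrix and left-invariant derivations\<close>

text \<open>Polynomials in the entries, presented without coordinates; the class contains
  determinants and is stable under the derivations \<open>ldiff\<close>.\<close>

inductive matpoly :: "(real^'n^'n \<Rightarrow> real) \<Rightarrow> bool" where
  const: "matpoly (\<lambda>_. c)"
| linear: "linear f \<Longrightarrow> matpoly f"
| add: "matpoly f \<Longrightarrow> matpoly h \<Longrightarrow> matpoly (\<lambda>g. f g + h g)"
| mult: "matpoly f \<Longrightarrow> matpoly h \<Longrightarrow> matpoly (\<lambda>g. f g * h g)"

definition ldiff :: "real^'n^'n \<Rightarrow> (real^'n^'n \<Rightarrow> real) \<Rightarrow> real^'n^'n \<Rightarrow> real" where
  "ldiff Z f g = frechet_derivative f (at g) (g ** Z)"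

lemma matpoly_sum: "finite I \<Longrightarrow> (\<And>i. i \<in> I \<Longrightarrow> matpoly (f i)) \<Longrightarrow> matpoly (\<lambda>g. \<Sum>i\<in>I. f i g)"
  by (induction rule: finite_induct) (auto intro: matpoly.intros)

lemma matpoly_prod: "finite I \<Longrightarrow> (\<And>i. i \<in> I \<Longrightarrow> matpoly (f i)) \<Longrightarrow> matpoly (\<lambda>g. \<Prod>i\<in>I. f i g)"
  by (induction rule: finite_induct) (auto intro: matpoly.intros)

lemma linear_matrix_entry: "linear F \<Longrightarrow> linear (\<lambda>g. (F g :: real^'n^'m) $ i $ j)"
  by (simp add: linear_iff)

lemma matpoly_det_affine:
  assumes "linear F"
  shows "matpoly (\<lambda>g. det (F g + M))"
proof -
  have "matpoly (\<lambda>g. (F g + M) $ i $ j)" for i j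
    using matpoly.add[OF matpoly.linear[OF linear_matrix_entry[OF assms]] matpoly.const] by simp
  then show ?thesis unfolding det_def
    by (intro matpoly_sum matpoly_prod matpoly.mult matpoly.const finite_permutations finite)
qed

lemma matpoly_differentiable: "matpoly f \<Longrightarrow> f differentiable (at g)"
  by (induction rule: matpoly.induct) (auto intro: linear_imp_differentiable)

lemma matpoly_has_derivative: "matpoly f \<Longrightarrow> (f has_derivative frechet_derivative f (at g)) (at g)"
  using matpoly_differentiable frechet_derivative_works by blast

lemma matpoly_continuous: "matpoly f \<Longrightarrow> continuous_on UNIV f"
  by (simp add: continuous_at_imp_continuous_on differentiable_imp_continuous_within matpoly_differentiable)

lemma ldiff_unique: "(f has_derivative f') (at g) \<Longrightarrow> ldiff Z f g = f' (g ** Z)"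
  unfolding ldiff_def by (metis frechet_derivative_at)

lemma ldiff_const [simp]: "ldiff Z (\<lambda>_. c) = (\<lambda>_. 0)"
  by (rule ext, rule ldiff_unique) (rule has_derivative_const)

lemma ldiff_linear: "linear f \<Longrightarrow> ldiff Z f = (\<lambda>g. f (g ** Z))"
  by (rule ext, rule ldiff_unique, rule linear_imp_has_derivative)

lemma ldiff_add:
  assumes "matpoly f" "matpoly h"
  shows "ldiff Z (\<lambda>g. f g + h g) = (\<lambda>g. ldiff Z f g + ldiff Z h g)"
proof
  fix g
  show "ldiff Z (\<lambda>g. f g + h g) g = ldiff Z f g + ldiff Z h g"
    using ldiff_unique[OF has_derivative_add[OF matpoly_has_derivative[OF assms(1), of g]
        matpoly_has_derivative[OF assms(2), of g]], of Z]
    by (simp add: ldiff_def)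
qed

lemma ldiff_mult:
  assumes "matpoly f" "matpoly h"
  shows "ldiff Z (\<lambda>g. f g * h g) = (\<lambda>g. f g * ldiff Z h g + ldiff Z f g * h g)"
proof
  fix g
  show "ldiff Z (\<lambda>g. f g * h g) g = f g * ldiff Z h g + ldiff Z f g * h g"
    using ldiff_unique[OF has_derivative_mult[OF matpoly_has_derivative[OF assms(1), of g]
        matpoly_has_derivative[OF assms(2), of g]], of Z]
    by (simp add: ldiff_def)
qed

lemma linear_mult_right:
  fixes f :: "real^'n^'n \<Rightarrow> real" and Z :: "real^'n^'n"
  assumes "linear f" shows "linear (\<lambda>g. f (g ** Z))"
proof -
  have "linear (\<lambda>g :: real^'n^'n. g ** Z)" by (simp add: linear_iff mat_ring)
  from linear_compose[OF this assms] show ?thesis by (simp add: o_def)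
qed

lemma matpoly_ldiff: "matpoly f \<Longrightarrow> matpoly (ldiff Z f)"
proof (induction rule: matpoly.induct)
  case (linear f)
  then show ?case by (simp add: ldiff_linear matpoly.linear linear_mult_right)
qed (auto simp: ldiff_add ldiff_mult intro: matpoly.intros)

lemma ldiff_cmult:
  assumes "matpoly f" shows "ldiff Z (\<lambda>g. c * f g) = (\<lambda>g. c * ldiff Z f g)"
  using ldiff_mult[OF matpoly.const assms] by simp

lemma ldiff_add_vector:
  assumes "matpoly f" shows "ldiff (Y + Z) f g = ldiff Y f g + ldiff Z f g"
  using linear_frechet_derivative[OF matpoly_differentiable[OF assms, of g]]
  by (simp add: ldiff_def mm.add_right linear_add)

text \<open>A commutator of derivations is a derivation, so the identity spreads from linear
  functions, where it is the definition of the bracket.\<close>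

lemma ldiff_commutator:
  assumes "matpoly f"
  shows "ldiff Y (ldiff Z f) g = ldiff Z (ldiff Y f) g + ldiff (lie_bracket Y Z) f g"
  using assms
proof (induction arbitrary: g rule: matpoly.induct)
  case (linear f)
  then show ?case
    by (simp add: ldiff_linear linear_mult_right lie_bracket_def mm.diff_right linear_diff matrix_mul_assoc)
next
  case (add f h)
  then show ?case by (simp add: ldiff_add matpoly_ldiff)
next
  case (mult f h)
  then show ?case
    by (simp add: ldiff_mult ldiff_add matpoly_ldiff matpoly.mult algebra_simps)
qed simp

lemma ldiff_left_mult:
  assumes "matpoly f"
  shows "ldiff Z (\<lambda>g. f (b ** g)) g = ldiff Z f (b ** g)"
proof -
  have "((\<lambda>g. b ** g) has_derivative (\<lambda>h. b ** h)) (at g)"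
    by (rule bounded_linear_imp_has_derivative) (rule mm.bounded_linear_right)
  from has_derivative_compose[OF this matpoly_has_derivative[OF assms]]
  have "ldiff Z (\<lambda>g. f (b ** g)) g = frechet_derivative f (at (b ** g)) (b ** (g ** Z))"
    by (rule ldiff_unique)
  then show ?thesis by (simp add: ldiff_def matrix_mul_assoc)
qed

lemma has_real_derivative_along:
  assumes f: "matpoly f" and c: "(c has_vector_derivative (c t ** Z)) (at t)"
  shows "((\<lambda>t. f (c t)) has_real_derivative ldiff Z f (c t)) (at t)"
proof -
  have "((\<lambda>t. f (c t)) has_derivative (\<lambda>s. frechet_derivative f (at (c t)) (s *\<^sub>R (c t ** Z)))) (at t)"
    using has_derivative_compose[OF c[unfolded has_vector_derivative_def] matpoly_has_derivative[OF f]] .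
  then show ?thesis
    using linear_frechet_derivative[OF matpoly_differentiable[OF f, of "c t"]]
    by (simp add: has_field_derivative_def ldiff_def linear_scale mult_commute_abs)
qed

text \<open>The straight line has the initial velocity of the one-parameter subgroup, and its
  compression by a projection stays affine in \<open>t\<close>, which suits determinants.\<close>

lemma has_real_derivative_ldiff:
  assumes "matpoly f"
  shows "((\<lambda>t. f (g ** (mat 1 + t *\<^sub>R Z))) has_real_derivative ldiff Z f g) (at 0)"
proof -
  have "((\<lambda>t. g ** (mat 1 + t *\<^sub>R Z)) has_vector_derivative
      g ** (0 + (0 *\<^sub>R 0 + 1 *\<^sub>R Z)) + 0 ** (mat 1 + 0 *\<^sub>R Z)) (at 0)"
    by (intro mm.has_vector_derivative has_vector_derivative_const has_vector_derivative_add
        has_vector_derivative_scaleR DERIV_ident)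
  then have "((\<lambda>t. g ** (mat 1 + t *\<^sub>R Z)) has_vector_derivative (g ** (mat 1 + 0 *\<^sub>R Z)) ** Z) (at 0)"
    by simp
  from has_real_derivative_along[OF assms this] show ?thesis by simp
qed

lemma has_real_derivative_ldiff_mexp:
  assumes "matpoly f"
  shows "((\<lambda>t. f (g ** mexp (t *\<^sub>R Y))) has_real_derivative ldiff Y f (g ** mexp (t *\<^sub>R Y))) (at t)"
proof -
  have "((\<lambda>t. g ** mexp (t *\<^sub>R Y)) has_vector_derivative
      g ** (mexp (t *\<^sub>R Y) ** Y) + 0 ** mexp (t *\<^sub>R Y)) (at t)"
    by (intro mm.has_vector_derivative has_vector_derivative_const has_vector_derivative_mexp)
  then have "((\<lambda>t. g ** mexp (t *\<^sub>R Y)) has_vector_derivative (g ** mexp (t *\<^sub>R Y)) ** Y) (at t)"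
    by (simp add: matrix_mul_assoc)
  from has_real_derivative_along[OF assms this] show ?thesis .
qed

lemma matpoly_funpow_ldiff: "matpoly f \<Longrightarrow> matpoly ((ldiff Y ^^ k) f)"
  by (induction k) (auto intro: matpoly_ldiff)

lemma funpow_ldiff_add:
  assumes "matpoly f" "matpoly h"
  shows "(ldiff Y ^^ k) (\<lambda>g. f g + h g) = (\<lambda>g. (ldiff Y ^^ k) f g + (ldiff Y ^^ k) h g)"
  by (induction k) (simp_all add: ldiff_add matpoly_funpow_ldiff assms)

lemma ldiff_sum:
  assumes "finite I" "\<And>i. i \<in> I \<Longrightarrow> matpoly (f i)"
  shows "ldiff Z (\<lambda>g. \<Sum>i\<in>I. f i g) = (\<lambda>g. \<Sum>i\<in>I. ldiff Z (f i) g)"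
  using assms
proof (induction rule: finite_induct)
  case (insert i I)
  then show ?case
    using ldiff_add[of "f i" "\<lambda>g. \<Sum>i\<in>I. f i g" Z] matpoly_sum[of I f] by simp
qed simp

lemma funpow_ldiff_mult:
  assumes "matpoly f" "matpoly h"
  shows "(ldiff Y ^^ k) (\<lambda>g. f g * h g) =
    (\<lambda>g. \<Sum>i\<le>k. real (k choose i) * ((ldiff Y ^^ i) f g * (ldiff Y ^^ (k - i)) h g))"
proof (induction k)
  case (Suc k)
  let ?f = "\<lambda>i. (ldiff Y ^^ i) f" and ?h = "\<lambda>i. (ldiff Y ^^ i) h"
  have P: "matpoly (?f i)" "matpoly (?h i)" for i by (simp_all add: matpoly_funpow_ldiff assms)
  have "(ldiff Y ^^ Suc k) (\<lambda>g. f g * h g) =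
      ldiff Y (\<lambda>g. \<Sum>i\<le>k. real (k choose i) * (?f i g * ?h (k - i) g))"
    by (simp add: Suc)
  also have "\<dots> = (\<lambda>g. \<Sum>i\<le>k. real (k choose i) * (?f i g * ?h (Suc (k - i)) g + ?f (Suc i) g * ?h (k - i) g))"
  proof -
    have P2: "matpoly (\<lambda>g. real c * (?f i g * ?h j g))" for c i j
      by (intro matpoly.mult matpoly.const P)
    show ?thesis by (subst ldiff_sum) (simp_all add: P2 ldiff_cmult ldiff_mult P matpoly.mult)
  qed
  also have "\<dots> = (\<lambda>g. \<Sum>i\<le>Suc k. real (Suc k choose i) * (?f i g * ?h (Suc k - i) g))"
  proof
    fix g
    let ?t = "\<lambda>i. ?f i g * ?h (Suc k - i) g"
    have "(\<Sum>i\<le>Suc k. real (Suc k choose i) * ?t i) =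
        ?t 0 + (\<Sum>i\<le>k. real (Suc k choose Suc i) * ?t (Suc i))"
      by (subst sum.atMost_Suc_shift) simp
    also have "\<dots> = ?t 0 + (\<Sum>i\<le>k. real (k choose Suc i) * ?t (Suc i)) + (\<Sum>i\<le>k. real (k choose i) * ?t (Suc i))"
      by (simp add: sum.distrib[symmetric] algebra_simps)
    also have "?t 0 + (\<Sum>i\<le>k. real (k choose Suc i) * ?t (Suc i)) = (\<Sum>i\<le>Suc k. real (k choose i) * ?t i)"
      using sum.atMost_Suc_shift[of "\<lambda>i. real (k choose i) * ?t i" k] by simp
    also have "\<dots> = (\<Sum>i\<le>k. real (k choose i) * ?t i)" by simp
    also have "\<dots> = (\<Sum>i\<le>k. real (k choose i) * (?f i g * ?h (Suc (k - i)) g))"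
      by (rule sum.cong) (auto simp: Suc_diff_le)
    finally show "(\<Sum>i\<le>k. real (k choose i) * (?f i g * ?h (Suc (k - i)) g + ?f (Suc i) g * ?h (k - i) g)) =
        (\<Sum>i\<le>Suc k. real (Suc k choose i) * ?t i)"
      by (simp add: sum.distrib algebra_simps)
  qed
  finally show ?case .
qed simp

text \<open>Geometric growth in the order of differentiation is what makes \<open>f\<close> analytic
  along one-parameter subgroups. For products, the Leibniz and binomial formulas add the two growth
  rates.\<close>

lemma funpow_ldiff_bound:
  assumes "matpoly f" "bounded U"
  shows "\<exists>B M. B \<ge> 0 \<and> M \<ge> 0 \<and> (\<forall>k. \<forall>g\<in>U. \<bar>(ldiff Y ^^ k) f g\<bar> \<le> B * M ^ k)"
  using assms(1)
proof (induction rule: matpoly.induct)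
  case (const c)
  have "\<bar>(ldiff Y ^^ k) (\<lambda>_. c) g\<bar> \<le> \<bar>c\<bar> * 1 ^ k" for k g
  proof (cases k)
    case (Suc j)
    have "(ldiff Y ^^ Suc j) (\<lambda>_. c) = (\<lambda>_. 0)" by (induction j) simp_all
    then show ?thesis by (simp add: Suc)
  qed simp
  then show ?case by (intro exI[of _ "\<bar>c\<bar>"] exI[of _ 1]) auto
next
  case (linear f)
  obtain K where K: "K > 0" "\<And>(a :: real^'a^'a) (b :: real^'a^'a). norm (a ** b) \<le> norm a * norm b * K"
    using mm.pos_bounded by blast
  obtain c where c: "c > 0" "\<And>x. norm (f x) \<le> norm x * c"
    using bounded_linear.pos_bounded[of f] linear linear_conv_bounded_linear by blast
  obtain b where b: "b > 0" "\<And>g. g \<in> U \<Longrightarrow> norm g \<le> b" using assms(2) bounded_pos by blast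
  define M where "M = norm Y * K"
  have M: "M \<ge> 0" using K by (simp add: M_def)
  define w where "w k g = ((\<lambda>x. x ** Y) ^^ k) g" for k and g :: "real^'a^'a"
  have eq: "(ldiff Y ^^ k) f = (\<lambda>g. f (w k g)) \<and> linear (\<lambda>g. f (w k g))" for k
  proof (induction k)
    case (Suc k)
    have "w k (g ** Y) = w (Suc k) g" for g
      using funpow_swap1[of "\<lambda>x. x ** Y" k g] by (simp add: w_def)
    with Suc show ?case using ldiff_linear[of "\<lambda>g. f (w k g)" Y] linear_mult_right[of "\<lambda>g. f (w k g)" Y] by simp
  qed (simp add: w_def linear)
  have wn: "norm (w k g) \<le> norm g * M ^ k" for k g
  proof (induction k)
    case (Suc k)
    have "norm (w (Suc k) g) \<le> norm (w k g) * M"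
      using K(2)[of "w k g" Y] by (simp add: w_def M_def mult.assoc)
    also have "\<dots> \<le> norm g * M ^ k * M" using Suc M by (rule mult_right_mono)
    finally show ?case by (simp add: mult_ac)
  qed (simp add: w_def)
  have "\<bar>(ldiff Y ^^ k) f g\<bar> \<le> (b * c) * M ^ k" if "g \<in> U" for k g
  proof -
    have "\<bar>(ldiff Y ^^ k) f g\<bar> \<le> norm (w k g) * c" using eq[of k] c(2)[of "w k g"] by simp
    also have "\<dots> \<le> (norm g * M ^ k) * c" using wn c by (intro mult_right_mono) auto
    also have "\<dots> \<le> (b * M ^ k) * c" using b(2)[OF that] c M by (intro mult_right_mono) auto
    finally show ?thesis by (simp add: mult_ac)
  qed
  then show ?case using b c M by (intro exI[of _ "b * c"] exI[of _ M]) auto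
next
  case (add f h)
  then obtain B M B' M' where f: "B \<ge> 0" "M \<ge> 0" "\<And>k g. g \<in> U \<Longrightarrow> \<bar>(ldiff Y ^^ k) f g\<bar> \<le> B * M ^ k"
    and h: "B' \<ge> 0" "M' \<ge> 0" "\<And>k g. g \<in> U \<Longrightarrow> \<bar>(ldiff Y ^^ k) h g\<bar> \<le> B' * M' ^ k" by blast
  have "\<bar>(ldiff Y ^^ k) (\<lambda>g. f g + h g) g\<bar> \<le> (B + B') * (M + M') ^ k" if "g \<in> U" for k g
  proof -
    have "\<bar>(ldiff Y ^^ k) (\<lambda>g. f g + h g) g\<bar> \<le> B * M ^ k + B' * M' ^ k"
      using f(3)[OF that, of k] h(3)[OF that, of k] by (simp add: funpow_ldiff_add add.hyps)
    also have "\<dots> \<le> B * (M + M') ^ k + B' * (M + M') ^ k"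
      using f h by (intro add_mono mult_left_mono power_mono) auto
    finally show ?thesis by (simp add: algebra_simps)
  qed
  then show ?case using f h by (intro exI[of _ "B + B'"] exI[of _ "M + M'"]) auto
next
  case (mult f h)
  then obtain B M B' M' where f: "B \<ge> 0" "M \<ge> 0" "\<And>k g. g \<in> U \<Longrightarrow> \<bar>(ldiff Y ^^ k) f g\<bar> \<le> B * M ^ k"
    and h: "B' \<ge> 0" "M' \<ge> 0" "\<And>k g. g \<in> U \<Longrightarrow> \<bar>(ldiff Y ^^ k) h g\<bar> \<le> B' * M' ^ k" by blast
  have "\<bar>(ldiff Y ^^ k) (\<lambda>g. f g * h g) g\<bar> \<le> (B * B') * (M + M') ^ k" if "g \<in> U" for k g
  proof -
    have "\<bar>(ldiff Y ^^ k) (\<lambda>g. f g * h g) g\<bar> \<le>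
        (\<Sum>i\<le>k. real (k choose i) * ((B * M ^ i) * (B' * M' ^ (k - i))))"
      unfolding funpow_ldiff_mult[OF mult.hyps]
    proof (rule order_trans[OF sum_abs], rule sum_mono)
      fix i
      have "\<bar>(ldiff Y ^^ i) f g\<bar> * \<bar>(ldiff Y ^^ (k - i)) h g\<bar> \<le> (B * M ^ i) * (B' * M' ^ (k - i))"
        using f(1,2) f(3)[OF that] h(3)[OF that] by (intro mult_mono) auto
      then show "\<bar>real (k choose i) * ((ldiff Y ^^ i) f g * (ldiff Y ^^ (k - i)) h g)\<bar>
          \<le> real (k choose i) * ((B * M ^ i) * (B' * M' ^ (k - i)))"
        by (simp add: abs_mult mult_left_mono)
    qed
    also have "\<dots> = (B * B') * (\<Sum>i\<le>k. real (k choose i) * M ^ i * M' ^ (k - i))"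
      by (simp add: sum_distrib_left mult_ac)
    also have "\<dots> = (B * B') * (M + M') ^ k" by (simp add: binomial_ring)
    finally show ?thesis .
  qed
  then show ?case using f h by (intro exI[of _ "B * B'"] exI[of _ "M + M'"]) auto
qed

text \<open>All Taylor coefficients in \<open>t\<close> at 0 vanish, and the remainder of order
  \<open>k\<close> is at most \<open>B * M ^ k / fact k\<close>.\<close>

lemma matpoly_eq_0_along_mexp:
  assumes f: "matpoly f" and 0: "\<And>k. (ldiff Y ^^ k) f g = 0"
  shows "f (g ** mexp Y) = 0"
proof -
  define U where "U = (\<lambda>t. g ** mexp (t *\<^sub>R Y)) ` {-1..1::real}"
  have "continuous_on {-1..1::real} (\<lambda>t. g ** mexp (t *\<^sub>R Y))"
    by (intro mm.continuous_on continuous_on_const continuous_at_imp_continuous_on ballI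
        has_vector_derivative_continuous[OF has_vector_derivative_mexp])
  then have "bounded U" unfolding U_def by (intro compact_imp_bounded compact_continuous_image) auto
  then obtain B M where B: "B \<ge> 0" "M \<ge> 0" "\<And>k h. h \<in> U \<Longrightarrow> \<bar>(ldiff Y ^^ k) f h\<bar> \<le> B * M ^ k"
    using funpow_ldiff_bound[OF f] by metis
  define d where "d k t = (ldiff Y ^^ k) f (g ** mexp (t *\<^sub>R Y))" for k t
  have der: "\<forall>m x. (d m has_real_derivative d (Suc m) x) (at x)"
    unfolding d_def using has_real_derivative_ldiff_mexp[OF matpoly_funpow_ldiff[OF f]] by simp
  have le: "\<bar>d 0 1\<bar> \<le> B * (M ^ k / fact k)" for k
  proof -
    obtain t where t: "\<bar>t\<bar> \<le> \<bar>1\<bar>" "d 0 1 = (\<Sum>m<k. d m 0 / fact m * 1 ^ m) + d k t / fact k * 1 ^ k"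
      using Maclaurin_all_le[OF refl der, of 1 k] by blast
    have "d m 0 = 0" for m by (simp add: d_def 0)
    then have "\<bar>d 0 1\<bar> = \<bar>d k t\<bar> / fact k" using t(2) by simp
    also have "\<bar>d k t\<bar> \<le> B * M ^ k" unfolding d_def by (rule B(3)) (use t(1) in \<open>auto simp: U_def abs_le_iff intro!: imageI\<close>)
    finally show ?thesis by (simp add: divide_right_mono)
  qed
  have "(\<lambda>k. M ^ k / fact k) \<longlonglongrightarrow> 0"
    using summable_LIMSEQ_zero[OF summable_exp[of M]] by (simp add: divide_inverse mult.commute)
  from tendsto_mult_left[OF this, of B] have "(\<lambda>k. B * (M ^ k / fact k)) \<longlonglongrightarrow> 0" by simp
  then have "\<bar>d 0 1\<bar> \<le> 0" using le by (intro LIMSEQ_le_const) auto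
  then show ?thesis by (simp add: d_def)
qed

lemma matpoly_foldr_ldiff: "matpoly f \<Longrightarrow> matpoly (foldr ldiff ws f)"
  by (induction ws) (auto intro: matpoly_ldiff)

lemma foldr_ldiff_add:
  assumes "matpoly f" "matpoly h"
  shows "foldr ldiff ws (\<lambda>g. f g + h g) = (\<lambda>g. foldr ldiff ws f g + foldr ldiff ws h g)"
  by (induction ws) (simp_all add: ldiff_add matpoly_foldr_ldiff assms)

lemma foldr_ldiff_cmult:
  assumes "matpoly f"
  shows "foldr ldiff ws (\<lambda>g. c * f g) = (\<lambda>g. c * foldr ldiff ws f g)"
  by (induction ws) (simp_all add: ldiff_cmult matpoly_foldr_ldiff assms)

text \<open>
  In the universal enveloping algebra, every word is a combination of words in which the letters
  from \<open>B\<^sub>1\<close> come first and those from \<open>B\<^sub>2\<close> last.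
\<close>

lemma ldiff_words_vanish:
  assumes m: "matpoly m" "m (mat 1) = 0"
    and bracket: "\<And>Y Z. Y \<in> \<L> \<Longrightarrow> Z \<in> \<L> \<Longrightarrow> lie_bracket Y Z \<in> \<L>"
    and sub: "B\<^sub>1 \<subseteq> \<L>" "B\<^sub>2 \<subseteq> \<L>"
    and decomp: "\<And>Z. Z \<in> \<L> \<Longrightarrow> \<exists>Z\<^sub>1\<in>B\<^sub>1. \<exists>Z\<^sub>2\<in>B\<^sub>2. Z = Z\<^sub>1 + Z\<^sub>2"
    and left: "\<And>Z t. Z \<in> B\<^sub>1 \<Longrightarrow> \<exists>c. \<forall>g. m ((mat 1 + t *\<^sub>R Z) ** g) = c * m g"
    and right: "\<And>Z. Z \<in> B\<^sub>2 \<Longrightarrow> \<exists>c. ldiff Z m = (\<lambda>g. c * m g)"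
  shows "set ws \<subseteq> \<L> \<Longrightarrow> foldr ldiff ws m (mat 1) = 0"
proof (induction "length ws" arbitrary: ws rule: less_induct)
  case less
  have moved: "foldr ldiff (us @ Z # vs) m (mat 1) = 0"
    if "Z \<in> B\<^sub>2" "set us \<subseteq> \<L>" "set vs \<subseteq> \<L>" "length us + length vs < length ws" for us Z vs
    using that
  proof (induction vs arbitrary: us)
    case Nil
    then obtain c where "ldiff Z m = (\<lambda>g. c * m g)" using right by blast
    moreover have "foldr ldiff us m (mat 1) = 0" using Nil less by auto
    ultimately show ?case by (simp add: foldr_ldiff_cmult m)
  next
    case (Cons Y vs)
    let ?f = "foldr ldiff vs m"
    have f: "matpoly ?f" by (rule matpoly_foldr_ldiff[OF m(1)])
    have ZY: "Z \<in> \<L>" "Y \<in> \<L>" using Cons.prems sub by auto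
    have eq: "ldiff Z (ldiff Y ?f) = (\<lambda>g. ldiff Y (ldiff Z ?f) g + ldiff (lie_bracket Z Y) ?f g)"
      using ldiff_commutator[OF f] by blast
    have "foldr ldiff ((us @ [Y]) @ Z # vs) m (mat 1) = 0"
      using Cons.prems by (intro Cons.IH) auto
    moreover have "foldr ldiff (us @ lie_bracket Z Y # vs) m (mat 1) = 0"
      using Cons.prems bracket[OF ZY] by (intro less.hyps) auto
    ultimately show ?case
      by (simp add: eq foldr_ldiff_add matpoly_ldiff f)
  qed
  show ?case
  proof (cases ws)
    case Nil
    then show ?thesis by (simp add: m)
  next
    case (Cons Z vs)
    let ?f = "foldr ldiff vs m"
    have f: "matpoly ?f" by (rule matpoly_foldr_ldiff[OF m(1)])
    obtain Z\<^sub>1 Z\<^sub>2 where Z: "Z\<^sub>1 \<in> B\<^sub>1" "Z\<^sub>2 \<in> B\<^sub>2" "Z = Z\<^sub>1 + Z\<^sub>2" using decomp[of Z] less.prems Cons by auto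
    have "ldiff Z\<^sub>2 ?f (mat 1) = 0"
      using moved[of Z\<^sub>2 "[]" vs] Z less.prems Cons by simp
    moreover have "ldiff Z\<^sub>1 ?f (mat 1) = 0"
    proof -
      \<comment> \<open>Left translation by \<open>mat 1 + t *\<^sub>R Z\<^sub>1\<close> multiplies
        \<open>m\<close>, and with it all left-invariant derivatives of \<open>m\<close>, by a
        constant. So \<open>?f\<close> vanishes along this line because it vanishes at the
        identity.\<close>
      have f1: "?f (mat 1) = 0" using less.hyps[of vs] less.prems Cons by simp
      have "?f (mat 1 + t *\<^sub>R Z\<^sub>1) = 0" for t
      proof -
        obtain c where c: "\<And>g. m ((mat 1 + t *\<^sub>R Z\<^sub>1) ** g) = c * m g" using left[OF Z(1)] by metis
        have "foldr ldiff us m ((mat 1 + t *\<^sub>R Z\<^sub>1) ** g) = c * foldr ldiff us m g" for us g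
        proof (induction us arbitrary: g)
          case (Cons U us)
          have p: "matpoly (foldr ldiff us m)" by (rule matpoly_foldr_ldiff[OF m(1)])
          have "ldiff U (foldr ldiff us m) ((mat 1 + t *\<^sub>R Z\<^sub>1) ** g) =
              ldiff U (\<lambda>g. foldr ldiff us m ((mat 1 + t *\<^sub>R Z\<^sub>1) ** g)) g"
            by (rule ldiff_left_mult[OF p, symmetric])
          also have "\<dots> = c * ldiff U (foldr ldiff us m) g" by (simp add: Cons ldiff_cmult p)
          finally show ?case by simp
        qed (simp add: c)
        from this[of vs "mat 1"] f1 show ?thesis by simp
      qed
      then have "(\<lambda>t. ?f (mat 1 ** (mat 1 + t *\<^sub>R Z\<^sub>1))) = (\<lambda>t. 0)" by simp
      with has_real_derivative_ldiff[OF f, of "mat 1" Z\<^sub>1]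
      have "((\<lambda>t. 0) has_real_derivative ldiff Z\<^sub>1 ?f (mat 1)) (at (0::real))" by simp
      then show ?thesis using DERIV_unique DERIV_const by blast
    qed
    ultimately show ?thesis by (simp add: Cons Z(3) ldiff_add_vector[OF f])
  qed
qed

text \<open>A permutation other than the identity moves at least two points, so after
  differentiating one factor an off-diagonal factor vanishing at \<open>t = 0\<close>
  remains.\<close>

lemma has_real_derivative_det:
  "((\<lambda>t. det (mat 1 + t *\<^sub>R M)) has_real_derivative trace (M :: real^'n^'n)) (at 0)"
proof -
  let ?P = "{p. p permutes (UNIV :: 'n set)}"
  let ?e = "\<lambda>p i t. (mat 1 + t *\<^sub>R M) $ i $ (p i)"
  have e: "((\<lambda>t. ?e p i t) has_real_derivative M $ i $ (p i)) (at 0)" for p i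
    by (auto intro!: derivative_eq_intros)
  have "((\<lambda>t. \<Sum>p\<in>?P. of_int (sign p) * (\<Prod>i\<in>UNIV. ?e p i t)) has_real_derivative
      (\<Sum>p\<in>?P. of_int (sign p) * (\<Sum>i\<in>UNIV. M $ i $ (p i) * (\<Prod>j\<in>UNIV - {i}. ?e p j 0)))) (at 0)"
    by (intro DERIV_sum DERIV_cmult has_field_derivative_prod e)
  moreover have "(\<Sum>p\<in>?P. of_int (sign p) * (\<Sum>i\<in>UNIV. M $ i $ (p i) * (\<Prod>j\<in>UNIV - {i}. ?e p j 0))) = trace M"
  proof -
    have z: "(\<Prod>j\<in>UNIV - {i}. ?e p j 0) = 0" if p: "p \<in> ?P" "p \<noteq> id" for p i
    proof -
      obtain a where a: "p a \<noteq> a" using p(2) by (auto simp: fun_eq_iff)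
      have "inj p" using p(1) permutes_inj by blast
      then have "p (p a) \<noteq> p a" using a by (auto dest: injD)
      then obtain j where "j \<noteq> i" "p j \<noteq> j" using a by (cases "a = i") auto
      then show ?thesis by (intro prod_zero) (auto simp: mat_def intro!: bexI[of _ j])
    qed
    have "(\<Sum>p\<in>?P. of_int (sign p) * (\<Sum>i\<in>UNIV. M $ i $ (p i) * (\<Prod>j\<in>UNIV - {i}. ?e p j 0))) =
        (\<Sum>p\<in>{id}. of_int (sign p) * (\<Sum>i\<in>UNIV. M $ i $ (p i) * (\<Prod>j\<in>UNIV - {i}. ?e p j 0)))"
    proof (rule sum.mono_neutral_right)
      show "\<forall>p\<in>?P - {id}. of_int (sign p) * (\<Sum>i\<in>UNIV. M $ i $ (p i) * (\<Prod>j\<in>UNIV - {i}. ?e p j 0)) = 0"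
      proof
        fix p assume "p \<in> ?P - {id}"
        then have p: "p \<in> ?P" "p \<noteq> id" by auto
        have "M $ i $ (p i) * (\<Prod>j\<in>UNIV - {i}. ?e p j 0) = 0" for i
          by (simp only: z[OF p] mult_zero_right)
        then show "of_int (sign p) * (\<Sum>i\<in>UNIV. M $ i $ (p i) * (\<Prod>j\<in>UNIV - {i}. ?e p j 0)) = 0"
          by (simp only: sum.neutral_const mult_zero_right)
      qed
    qed (auto simp: permutes_id finite_permutations)
    also have "\<dots> = trace M" by (simp add: trace_def mat_def sign_id)
    finally show ?thesis .
  qed
  ultimately show ?thesis unfolding det_def by simp
qed

section \<open>Uniqueness of the Cartan projection\<close>

text \<open>A new largest value needs only a coefficient for its own indicator. Applied to the
  eigenvalues of a matrix, this expresses the matrix through its spectral projections for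
  eigenvalues at least \<open>s\<close>.\<close>

lemma linear_combination_of_indicators:
  fixes F :: "real set"
  assumes "finite F"
  shows "\<exists>c. \<forall>x\<in>F. x = (\<Sum>s\<in>F. c s * (if s \<le> x then 1 else 0))"
  using assms
proof (induction rule: finite_linorder_max_induct)
  case (insert m F)
  then obtain c where c: "\<And>x. x \<in> F \<Longrightarrow> x = (\<Sum>s\<in>F. c s * (if s \<le> x then 1 else 0))" by auto
  have m: "m \<notin> F" using insert by auto
  define c' where "c' = c(m := m - (\<Sum>s\<in>F. c s))"
  have "x = (\<Sum>s\<in>insert m F. c' s * (if s \<le> x then 1 else 0))" if "x \<in> insert m F" for x
  proof (cases "x = m")
    case True
    have "(\<Sum>s\<in>F. c' s * (if s \<le> m then 1 else 0)) = (\<Sum>s\<in>F. c s)"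
      using insert(2) m by (intro sum.cong) (auto simp: c'_def)
    then show ?thesis using True insert(1) m by (simp add: c'_def)
  next
    case False
    then have "x \<in> F" "x < m" using that insert(2) by auto
    moreover have "(\<Sum>s\<in>F. c' s * (if s \<le> x then 1 else 0)) = (\<Sum>s\<in>F. c s * (if s \<le> x then 1 else 0))"
      using m by (intro sum.cong) (auto simp: c'_def)
    ultimately show ?thesis using insert(1) m c[of x] by simp
  qed
  then show ?case by blast
qed simp

text \<open>An eigenvector of \<open>ad X\<close> for a nonnegative eigenvalue raises the eigenvalues of \<open>X\<close>.\<close>

lemma ad_eigenvector_raises:
  fixes J Ji :: "real^'n^'n"
  assumes J: "J ** Ji = mat 1" "Ji ** J = mat 1" and X: "X = J ** diagm x ** Ji"
    and P: "P = J ** diagm (\<lambda>i. if s \<le> x i then 1 else 0) ** Ji"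
    and E: "lie_bracket X E = a *\<^sub>R E" "a \<ge> 0"
  shows "E ** P = P ** E ** P"
proof -
  let ?d = "\<lambda>i. if s \<le> x i then 1 else 0 :: real"
  define M where "M = Ji ** E ** J"
  have EM: "E = J ** M ** Ji"
  proof -
    have "J ** M ** Ji = (J ** Ji) ** E ** (J ** Ji)" by (simp only: M_def matrix_mul_assoc)
    then show ?thesis by (simp add: J)
  qed
  have JJ: "Y ** Ji ** J = Y" for Y using J(2) by (metis matrix_mul_assoc matrix_mul_rid)
  have "Ji ** lie_bracket X E ** J = diagm x ** M - M ** diagm x"
    unfolding lie_bracket_def X EM by (simp add: mat_ring JJ J(2))
  moreover have "Ji ** (a *\<^sub>R E) ** J = a *\<^sub>R M" by (simp add: M_def mat_ring)
  ultimately have "diagm x ** M - M ** diagm x = a *\<^sub>R M" using E(1) by simp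
  then have "(diagm x ** M - M ** diagm x) $ i $ j = (a *\<^sub>R M) $ i $ j" for i j by simp
  then have e: "x i * M $ i $ j - M $ i $ j * x j = a * M $ i $ j" for i j by simp
  have "M ** diagm ?d = diagm ?d ** (M ** diagm ?d)"
  proof -
    have "M $ i $ j * ?d j = ?d i * (M $ i $ j * ?d j)" for i j
    proof (cases "M $ i $ j = 0")
      case False
      have "(x i - x j) * M $ i $ j = a * M $ i $ j" using e[of i j] by (simp add: algebra_simps)
      with False have "x i - x j = a" by simp
      then show ?thesis using E(2) by auto
    qed simp
    then show ?thesis by (simp add: vec_eq_iff)
  qed
  then have "J ** (M ** diagm ?d) ** Ji = J ** (diagm ?d ** (M ** diagm ?d)) ** Ji" by simp
  then show ?thesis unfolding P EM by (simp add: matrix_mul_assoc JJ)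
qed

context weyl_chamber begin

text \<open>
  The determinant of the \<open>Q\<close>-block of \<open>g\<close> is a highest weight matrix coefficient of an exterior power.
\<close>

lemma trace_projection_eq:
  assumes T: "T \<in> C" and k: "k \<in> KK"
    and P: "star P = P" "P ** P = P" and Q: "Q = k ** P ** star k"
    and TP: "T ** P = P ** T ** P" and TQ: "T ** Q = Q ** T ** Q"
    and decomp: "\<And>Z. Z \<in> L \<Longrightarrow> \<exists>Z\<^sub>1 Z\<^sub>2. Z\<^sub>1 \<in> L \<and> Z\<^sub>2 \<in> L \<and> Z = Z\<^sub>1 + Z\<^sub>2 \<and>
      star Z\<^sub>1 ** Q = Q ** star Z\<^sub>1 ** Q \<and> Z\<^sub>2 ** P = P ** Z\<^sub>2 ** P"
  shows "trace (T ** P) = trace (T ** Q)"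
proof (rule ccontr)
  assume ne: "trace (T ** P) \<noteq> trace (T ** Q)"
  note kk = KK_group[OF k]
  have kc: "Y ** star k ** k = Y" "Y ** k ** star k = Y" for Y
    using kk(2,3) by (metis matrix_mul_assoc matrix_mul_rid)+
  have QQ: "Q ** Q = Q" by (simp add: Q matrix_mul_assoc kc) (metis P(2) matrix_mul_assoc)
  have QQ': "Y ** Q ** Q = Y ** Q" for Y using QQ by (metis matrix_mul_assoc)
  have Qs: "star Q = Q" by (simp add: Q star_mult P matrix_mul_assoc)
  \<comment> \<open>The block is completed by the identity so that its determinant is one of a full
    matrix. It is multiplicative when the left factor preserves the kernel of \<open>Q\<close>, or
    the right factor its range.\<close>
  define blk where "blk M = Q ** M ** Q + (mat 1 - Q)" for M
  have blk_left: "blk (b ** M) = blk b ** blk M" if "Q ** b = Q ** b ** Q" for b M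
  proof -
    have "blk b ** blk M = Q ** b ** Q ** M ** Q + (mat 1 - Q)"
      by (simp add: blk_def mat_ring QQ QQ')
    then show ?thesis using that by (simp add: blk_def matrix_mul_assoc)
  qed
  have blk_right: "blk (M ** c) = blk M ** blk c" if "c ** Q = Q ** c ** Q" for c M
  proof -
    have "blk M ** blk c = Q ** M ** (Q ** c ** Q) + (mat 1 - Q)"
      by (simp add: blk_def mat_ring QQ QQ')
    then show ?thesis unfolding that[symmetric] by (simp add: blk_def matrix_mul_assoc)
  qed
  \<comment> \<open>The factor \<open>star k\<close> normalises the coefficient to 1 at
    \<open>k\<close>; the contradiction will be that \<open>m\<close> vanishes on all of
    \<open>G\<close>.\<close>
  define m where "m g = det (blk (g ** star k))" for g
  have m: "matpoly m"
  proof -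
    have "linear (\<lambda>g. Q ** (g ** star k) ** Q)" by (simp add: linear_iff mat_ring)
    from matpoly_det_affine[OF this, of "mat 1 - Q"] show ?thesis by (simp add: m_def[abs_def] blk_def)
  qed
  have mk: "m k = 1" by (simp add: m_def kk blk_def QQ)
  have left: "m ((mat 1 + t *\<^sub>R Z) ** g) = det (blk (mat 1 + t *\<^sub>R Z)) * m g"
    if "star Z ** Q = Q ** star Z ** Q" for Z t g
  proof -
    have "star (star Z ** Q) = star (Q ** star Z ** Q)" using that by simp
    then have "Q ** Z = Q ** Z ** Q" by (simp add: star_mult Qs matrix_mul_assoc)
    then have "Q ** (mat 1 + t *\<^sub>R Z) = Q ** (mat 1 + t *\<^sub>R Z) ** Q" by (simp add: mat_ring QQ)
    from blk_left[OF this, of "g ** star k"] show ?thesis by (simp add: m_def matrix_mul_assoc det_mul)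
  qed
  have right: "m (g ** (mat 1 + t *\<^sub>R Z)) = m g * det (blk (mat 1 + t *\<^sub>R (k ** Z ** star k)))"
    if "Z ** P = P ** Z ** P" for Z t g
  proof -
    let ?c = "mat 1 + t *\<^sub>R (k ** Z ** star k)"
    have "(k ** Z ** star k) ** Q = k ** (Z ** P) ** star k" by (simp add: Q matrix_mul_assoc kc)
    also have "\<dots> = Q ** (k ** Z ** star k) ** Q" unfolding that by (simp add: Q matrix_mul_assoc kc)
    finally have "?c ** Q = Q ** ?c ** Q" by (simp add: mat_ring QQ)
    from blk_right[OF this, of "g ** star k"]
    have "blk (g ** star k) ** blk ?c = blk (g ** star k ** ?c)" by simp
    also have "g ** star k ** ?c = g ** (mat 1 + t *\<^sub>R Z) ** star k" by (simp add: mat_ring kc)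
    finally show ?thesis by (simp add: m_def flip: det_mul)
  qed
  have right': "\<exists>c. ldiff Z m = (\<lambda>g. c * m g)" if Z: "Z ** P = P ** Z ** P" for Z
  proof -
    have eq: "ldiff Z m g = m g * ldiff Z m k" for g
    proof -
      have "m (g ** (mat 1 + t *\<^sub>R Z)) = m g * m (k ** (mat 1 + t *\<^sub>R Z))" for t
        unfolding right[OF Z] mk by simp
      then have "((\<lambda>t. m g * m (k ** (mat 1 + t *\<^sub>R Z))) has_real_derivative ldiff Z m g) (at 0)"
        using has_real_derivative_ldiff[OF m, of g Z] by simp
      moreover have "((\<lambda>t. m g * m (k ** (mat 1 + t *\<^sub>R Z))) has_real_derivative m g * ldiff Z m k) (at 0)"
        by (intro DERIV_cmult has_real_derivative_ldiff m)
      ultimately show ?thesis by (rule DERIV_unique)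
    qed
    have "ldiff Z m g = ldiff Z m k * m g" for g by (subst mult.commute) (rule eq)
    then show ?thesis by (intro exI[of _ "ldiff Z m k"] ext)
  qed
  have TA: "T \<in> A" using T C_regular by (auto simp: regular_def)
  \<comment> \<open>To first order, \<open>T\<close> acts on \<open>m\<close> from the left by
    \<open>trace (T ** Q)\<close> and from the right by \<open>trace (T ** P)\<close>. At the
    identity both translations agree, so a nonzero value there would make the two traces
    equal.\<close>
  have "m (mat 1) = 0"
  proof (rule ccontr)
    assume m1: "m (mat 1) \<noteq> 0"
    have "det (blk (mat 1 + t *\<^sub>R T)) = det (blk (mat 1 + t *\<^sub>R (k ** T ** star k)))" for t
      using left[of T t "mat 1"] right[OF TP, of "mat 1" t] TQ m1 by (simp add: A_star[OF TA])
    moreover have "blk (mat 1 + t *\<^sub>R M) = mat 1 + t *\<^sub>R (Q ** M ** Q)" for t M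
      by (simp add: blk_def mat_ring QQ)
    ultimately have eq: "det (mat 1 + t *\<^sub>R (Q ** T ** Q)) = det (mat 1 + t *\<^sub>R (Q ** (k ** T ** star k) ** Q))" for t
      by simp
    have "trace (Q ** T ** Q) = trace (Q ** (k ** T ** star k) ** Q)"
      using has_real_derivative_det[of "Q ** T ** Q"] has_real_derivative_det[of "Q ** (k ** T ** star k) ** Q"]
      unfolding eq by (rule DERIV_unique)
    moreover have "trace (Q ** M ** Q) = trace (M ** Q)" for M
      using trace_mul_sym[of Q "M ** Q"] by (simp add: matrix_mul_assoc QQ')
    moreover have "trace (k ** T ** star k ** Q) = trace (T ** P)"
    proof -
      have "k ** T ** star k ** Q = k ** (T ** P) ** star k" by (simp add: Q matrix_mul_assoc kc)
      then show ?thesis by (simp add: trace_conj[OF kk(2)])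
    qed
    ultimately show False using ne by simp
  qed
  let ?B1 = "{Z \<in> L. star Z ** Q = Q ** star Z ** Q}" and ?B2 = "{Z \<in> L. Z ** P = P ** Z ** P}"
  have words: "foldr ldiff ws m (mat 1) = 0" if "set ws \<subseteq> L" for ws
  proof (rule ldiff_words_vanish[OF m \<open>m (mat 1) = 0\<close> _ _ _ _ _ _ that])
    show "\<exists>Z\<^sub>1\<in>?B1. \<exists>Z\<^sub>2\<in>?B2. Z = Z\<^sub>1 + Z\<^sub>2" if "Z \<in> L" for Z
      using decomp[OF that] by blast
    show "\<exists>c. \<forall>g. m ((mat 1 + t *\<^sub>R Z) ** g) = c * m g" if "Z \<in> ?B1" for Z t
      using left that by blast
    show "\<exists>c. ldiff Z m = (\<lambda>g. c * m g)" if "Z \<in> ?B2" for Z using right' that by blast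
  qed (auto intro: lie_bracket_lie)
  \<comment> \<open>The points where \<open>m\<close> vanishes with all its left-invariant
    derivatives along \<open>L\<close>. Analyticity along one-parameter subgroups makes this set
    stable under exponentials.\<close>
  define U where "U = {g \<in> G. \<forall>ws. set ws \<subseteq> L \<longrightarrow> foldr ldiff ws m g = 0}"
  have "U = G"
  proof (rule closed_mexp_invariant_subset_eq)
    show "U \<subseteq> G" by (auto simp: U_def)
    show "U \<noteq> {}" using words G_one by (auto simp: U_def)
    show "a \<in> U" if s: "\<And>k. s k \<in> U" "s \<longlonglongrightarrow> a" "invertible a" for s a
    proof -
      have "foldr ldiff ws m a = 0" if ws: "set ws \<subseteq> L" for ws
      proof -
        have "isCont (foldr ldiff ws m) a"
          using matpoly_continuous[OF matpoly_foldr_ldiff[OF m]] by (simp add: continuous_on_eq_continuous_at)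
        from isCont_tendsto_compose[OF this s(2)]
        have "(\<lambda>k. foldr ldiff ws m (s k)) \<longlonglongrightarrow> foldr ldiff ws m a" .
        moreover have "foldr ldiff ws m (s k) = 0" for k using s(1)[of k] ws by (simp add: U_def)
        ultimately show ?thesis by (simp add: LIMSEQ_const_iff)
      qed
      moreover have "a \<in> G" using s by (intro G_limit[of s a]) (auto simp: U_def)
      ultimately show ?thesis by (simp add: U_def)
    qed
    show "s ** mexp X \<in> U" if s: "s \<in> U" "X \<in> L" for s X
    proof -
      have "foldr ldiff ws m (s ** mexp X) = 0" if ws: "set ws \<subseteq> L" for ws
      proof (rule matpoly_eq_0_along_mexp[OF matpoly_foldr_ldiff[OF m]])
        fix j
        have "(ldiff X ^^ j) (foldr ldiff ws m) = foldr ldiff (replicate j X @ ws) m"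
          by (induction j) simp_all
        moreover have "set (replicate j X @ ws) \<subseteq> L" using ws s(2) by auto
        ultimately show "(ldiff X ^^ j) (foldr ldiff ws m) s = 0" using s(1) by (simp only: U_def mem_Collect_eq)
      qed
      moreover have "s ** mexp X \<in> G" using s lie_mexp by (auto simp: U_def intro: G_mult)
      ultimately show ?thesis by (simp add: U_def)
    qed
  qed
  then have "k \<in> U" using kk(1) by simp
  then have "foldr ldiff [] m k = 0" unfolding U_def by (metis (mono_tags, lifting) empty_iff list.set(1) mem_Collect_eq subsetI)
  then show False using mk by simp
qed

text \<open>If \<open>T\<close> centralises \<open>E\<close>, then so does all of \<open>A\<close>,
  by regularity of \<open>T\<close>. Otherwise \<open>E\<close> belongs to a root that is positive
  at \<open>T\<close>, hence nonnegative on the closed chamber.\<close>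

lemma lie_bracket_raises:
  assumes E: "E \<in> L" "\<And>H. H \<in> A \<Longrightarrow> \<exists>l. lie_bracket H E = l *\<^sub>R E"
    and T: "T \<in> C" "lie_bracket T E = a *\<^sub>R E" "a \<ge> 0" and X: "X \<in> closure C"
  shows "\<exists>b\<ge>0. lie_bracket X E = b *\<^sub>R E"
proof (cases "lie_bracket T E = 0")
  case True
  have "T \<in> regular" using T C_regular by auto
  from regular_joint_eigenvector_centralizer[OF this E True] X closure_C_A
  show ?thesis by (intro exI[of _ 0]) auto
next
  case False
  have TA: "T \<in> A" using T C_regular by (auto simp: regular_def)
  have "E \<noteq> 0" using False T(2) by auto
  from root_functional[OF E(1) this E(2) TA False]
  obtain \<alpha> where \<alpha>: "restricted_root G A \<alpha>" "\<And>H. H \<in> A \<Longrightarrow> lie_bracket H E = \<alpha> H *\<^sub>R E" by metis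
  have "\<alpha> T = a" "a \<noteq> 0" using \<alpha>(2)[OF TA] T(2) \<open>E \<noteq> 0\<close> False by auto
  then have "\<alpha> X \<ge> 0" using root_nonneg_on_closure_C[OF \<alpha>(1) T(1) _ X] T(3) by simp
  then show ?thesis using \<alpha>(2) X closure_C_A by blast
qed

text \<open>No \<open>T\<close> in the chamber distinguishes the spectral projections of
  \<open>X\<close> from those of \<open>X'\<close>, so
  \<open>trace (T ** X) = trace (T ** X')\<close>. By continuity this holds for
  \<open>T = X\<close>; as \<open>X\<close> and \<open>X'\<close> have equal norms, their difference
  has norm 0.\<close>

theorem closure_C_conj_unique:
  assumes X: "X \<in> closure C" and X': "X' \<in> closure C" and k: "k \<in> KK" "X' = k ** X ** star k"
  shows "X' = X"
proof -
  note kk = KK_group[OF k(1)]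
  have XA: "X \<in> A" "X' \<in> A" using X X' closure_C_A by auto
  obtain J Ji :: "real^'n^'n" and x where J: "J ** Ji = mat 1" "Ji ** J = mat 1" "X = J ** diagm x ** Ji"
    "\<forall>y. star (J ** diagm y ** Ji) = J ** diagm y ** Ji"
    using self_adjoint_diagonalization[OF A_star[OF XA(1)]] by metis
  let ?d = "\<lambda>s i. if s \<le> x i then 1 else 0 :: real"
  define P where "P s = J ** diagm (?d s) ** Ji" for s
  define Q where "Q s = k ** P s ** star k" for s
  have J': "(k ** J) ** (Ji ** star k) = mat 1" "(Ji ** star k) ** (k ** J) = mat 1"
    using J(1,2) kk(2,3) by (metis matrix_mul_assoc matrix_mul_rid)+
  have X'd: "X' = (k ** J) ** diagm x ** (Ji ** star k)" by (simp add: k(2) J(3) matrix_mul_assoc)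
  have Qd: "Q s = (k ** J) ** diagm (?d s) ** (Ji ** star k)" for s
    by (simp add: Q_def P_def matrix_mul_assoc)
  have PP: "P s ** P s = P s" for s
  proof -
    have "P s ** P s = J ** diagm (?d s) ** (Ji ** J) ** diagm (?d s) ** Ji"
      by (simp only: P_def matrix_mul_assoc)
    also have "\<dots> = J ** (diagm (?d s) ** diagm (?d s)) ** Ji" by (simp add: J(2) matrix_mul_assoc)
    also have "diagm (?d s) ** diagm (?d s) = diagm (?d s)"
      unfolding diagm_mult_diagm by (rule arg_cong[of _ _ diagm]) auto
    finally show ?thesis by (simp add: P_def)
  qed
  have Ps: "star (P s) = P s" for s using J(4) by (simp add: P_def)
  have raises: "E ** P s = P s ** E ** P s \<and> E ** Q s = Q s ** E ** Q s"
    if E: "E \<in> L" "\<And>H. H \<in> A \<Longrightarrow> \<exists>l. lie_bracket H E = l *\<^sub>R E"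
      and T: "T \<in> C" "lie_bracket T E = a *\<^sub>R E" "a \<ge> 0" for E T a s
  proof -
    obtain b where b: "b \<ge> 0" "lie_bracket X E = b *\<^sub>R E" using lie_bracket_raises[OF E T X] by auto
    obtain c where c: "c \<ge> 0" "lie_bracket X' E = c *\<^sub>R E" using lie_bracket_raises[OF E T X'] by auto
    show ?thesis
      using ad_eigenvector_raises[OF J(1,2,3) P_def b(2,1)] ad_eigenvector_raises[OF J' X'd Qd c(2,1)] by simp
  qed
  have tr: "trace (T ** P s) = trace (T ** Q s)" if T: "T \<in> C" for T s
  proof (rule trace_projection_eq[OF T k(1) Ps PP Q_def])
    have TA: "T \<in> A" using T C_regular by (auto simp: regular_def)
    have "lie_bracket H T = 0 *\<^sub>R T" if "H \<in> A" for H
      using A_commute[OF that TA] by (simp add: lie_bracket_def)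
    then have "T ** P s = P s ** T ** P s \<and> T ** Q s = Q s ** T ** Q s"
      using TA by (intro raises[of T T 0]) (auto intro: A_lie T)
    then show "T ** P s = P s ** T ** P s" "T ** Q s = Q s ** T ** Q s" by auto
    \<comment> \<open>A joint eigenvector with nonnegative eigenvalue for \<open>T\<close> preserves
      the range of \<open>P s\<close>. If the eigenvalue is negative, the adjoint has a positive one
      and preserves the range of \<open>Q s\<close>. Such vectors span \<open>L\<close>.\<close>
    let ?sum = "{Z. \<exists>Z\<^sub>1 Z\<^sub>2. Z\<^sub>1 \<in> L \<and> Z\<^sub>2 \<in> L \<and> Z = Z\<^sub>1 + Z\<^sub>2 \<and>
      star Z\<^sub>1 ** Q s = Q s ** star Z\<^sub>1 ** Q s \<and> Z\<^sub>2 ** P s = P s ** Z\<^sub>2 ** P s}"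
    have "subspace ?sum"
    proof (rule subspaceI)
      show "0 \<in> ?sum"
        using subspace_0[OF subspace_lie] by (intro CollectI exI[of _ 0]) (simp add: star_0)
    next
      fix Z W assume "Z \<in> ?sum" "W \<in> ?sum"
      then obtain Z\<^sub>1 Z\<^sub>2 W\<^sub>1 W\<^sub>2 where "Z\<^sub>1 \<in> L" "Z\<^sub>2 \<in> L" "Z = Z\<^sub>1 + Z\<^sub>2"
        "star Z\<^sub>1 ** Q s = Q s ** star Z\<^sub>1 ** Q s" "Z\<^sub>2 ** P s = P s ** Z\<^sub>2 ** P s"
        "W\<^sub>1 \<in> L" "W\<^sub>2 \<in> L" "W = W\<^sub>1 + W\<^sub>2"
        "star W\<^sub>1 ** Q s = Q s ** star W\<^sub>1 ** Q s" "W\<^sub>2 ** P s = P s ** W\<^sub>2 ** P s" by blast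
      then show "Z + W \<in> ?sum"
        by (intro CollectI exI[of _ "Z\<^sub>1 + W\<^sub>1"] exI[of _ "Z\<^sub>2 + W\<^sub>2"])
           (simp add: lie_add star_add mm.add_left mm.add_right)
    next
      fix c Z assume "Z \<in> ?sum"
      then obtain Z\<^sub>1 Z\<^sub>2 where "Z\<^sub>1 \<in> L" "Z\<^sub>2 \<in> L" "Z = Z\<^sub>1 + Z\<^sub>2"
        "star Z\<^sub>1 ** Q s = Q s ** star Z\<^sub>1 ** Q s" "Z\<^sub>2 ** P s = P s ** Z\<^sub>2 ** P s" by blast
      then show "c *\<^sub>R Z \<in> ?sum"
        by (intro CollectI exI[of _ "c *\<^sub>R Z\<^sub>1"] exI[of _ "c *\<^sub>R Z\<^sub>2"])
           (simp add: lie_scaleR star_scaleR mm.scaleR_left mm.scaleR_right scaleR_right_distrib)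
    qed
    moreover have "{E \<in> L. \<forall>H\<in>A. \<exists>l. lie_bracket H E = l *\<^sub>R E} \<subseteq> ?sum"
    proof
      fix E assume "E \<in> {E \<in> L. \<forall>H\<in>A. \<exists>l. lie_bracket H E = l *\<^sub>R E}"
      then have E: "E \<in> L" "\<And>H. H \<in> A \<Longrightarrow> \<exists>l. lie_bracket H E = l *\<^sub>R E" by auto
      then obtain a where a: "lie_bracket T E = a *\<^sub>R E" using TA by blast
      show "E \<in> ?sum"
      proof (cases "a \<ge> 0")
        case True
        then have "E ** P s = P s ** E ** P s" using raises[OF E T a] by blast
        then show ?thesis using E(1) subspace_0[OF subspace_lie]
          by (intro CollectI exI[of _ 0] exI[of _ E]) (simp add: star_0)
      next
        case False
        have sE: "lie_bracket H (star E) = - star (lie_bracket H E)" if "H \<in> A" for H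
          by (simp add: lie_bracket_def star_simps A_star[OF that])
        have "star E ** Q s = Q s ** star E ** Q s"
        proof (rule raises[THEN conjunct2])
          show "star E \<in> L" using E lie_star by blast
          show "\<exists>l. lie_bracket H (star E) = l *\<^sub>R star E" if H: "H \<in> A" for H
          proof -
            obtain l where "lie_bracket H E = l *\<^sub>R E" using E(2)[OF H] by auto
            then show ?thesis by (intro exI[of _ "- l"]) (simp add: sE[OF H] star_scaleR)
          qed
          show "lie_bracket T (star E) = (- a) *\<^sub>R star E" by (simp add: sE[OF TA] a star_scaleR)
          show "- a \<ge> 0" using False by simp
        qed (rule T)
        then show ?thesis using E(1) subspace_0[OF subspace_lie]
          by (intro CollectI exI[of _ E] exI[of _ 0]) simp
      qed
    qed
    ultimately have "span {E \<in> L. \<forall>H\<in>A. \<exists>l. lie_bracket H E = l *\<^sub>R E} \<subseteq> ?sum"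
      by (rule span_minimal[rotated])
    then have "L \<subseteq> ?sum"
      using joint_eigenvectors_span[OF subspace_lie lie_bracket_lie[OF A_lie]] by (rule order_trans[rotated])
    then show "\<And>Z. Z \<in> L \<Longrightarrow> \<exists>Z\<^sub>1 Z\<^sub>2. Z\<^sub>1 \<in> L \<and> Z\<^sub>2 \<in> L \<and> Z = Z\<^sub>1 + Z\<^sub>2 \<and>
      star Z\<^sub>1 ** Q s = Q s ** star Z\<^sub>1 ** Q s \<and> Z\<^sub>2 ** P s = P s ** Z\<^sub>2 ** P s" by blast
  qed
  obtain c where c: "\<And>y. y \<in> range x \<Longrightarrow> y = (\<Sum>s\<in>range x. c s * (if s \<le> y then 1 else 0))"
    using linear_combination_of_indicators[of "range x"] by auto
  have "diagm x = (\<Sum>s\<in>range x. c s *\<^sub>R diagm (?d s))"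
  proof -
    have "diagm x $ i $ j = (\<Sum>s\<in>range x. c s *\<^sub>R diagm (?d s)) $ i $ j" for i j
      using c[of "x i", OF rangeI] by (cases "i = j") (simp_all add: diagm_def)
    then show ?thesis by (simp add: vec_eq_iff)
  qed
  then have XP: "X = (\<Sum>s\<in>range x. c s *\<^sub>R P s)" and XQ: "X' = (\<Sum>s\<in>range x. c s *\<^sub>R Q s)"
    unfolding J(3) X'd by (simp_all add: P_def Qd mm.sum_left mm.sum_right mm.scaleR_left mm.scaleR_right)
  have lin: "linear (\<lambda>T. trace (T ** X) - trace (T ** X'))"
    by (simp add: linear_iff mat_ring trace_add trace_scaleR algebra_simps)
  have trC: "trace (T ** X) - trace (T ** X') = 0" if "T \<in> C" for T
  proof -
    have "trace (T ** (\<Sum>s\<in>range x. c s *\<^sub>R M s)) = (\<Sum>s\<in>range x. c s * trace (T ** M s))" for M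
      by (simp add: mm.sum_right mm.scaleR_right linear_sum[OF bounded_linear.linear[OF bounded_linear_trace]] trace_scaleR)
    then show ?thesis using tr[OF that] unfolding XP XQ by simp
  qed
  have "C \<subseteq> (\<lambda>T. trace (T ** X) - trace (T ** X')) -` {0}" using trC by auto
  moreover have "closed ((\<lambda>T. trace (T ** X) - trace (T ** X')) -` {0})"
    using lin by (intro closed_vimage linear_continuous_on) (auto simp: linear_conv_bounded_linear)
  ultimately have "X \<in> (\<lambda>T. trace (T ** X) - trace (T ** X')) -` {0}" using X closure_minimal by blast
  then have e1: "trace (X ** X) = trace (X ** X')" by simp
  have "X' ** X' = k ** (X ** (star k ** k) ** X) ** star k" by (simp only: k(2) matrix_mul_assoc)
  then have e2: "trace (X' ** X') = trace (X ** X)" by (simp add: kk(2) trace_conj[OF kk(2)])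
  have "ip (X' - X) (X' - X) = trace (X' ** X') - trace (X' ** X) - trace (X ** X') + trace (X ** X)"
    by (simp add: ip_def star_diff A_star XA mat_ring trace_sub)
  also have "\<dots> = 0" using e1 e2 trace_mul_sym[of X X'] by simp
  finally show ?thesis by simp
qed

text \<open>Passing to \<open>star g ** g\<close> removes the left factors and shows that
  \<open>mexp (2 *\<^sub>R Z)\<close> and \<open>mexp (2 *\<^sub>R Z')\<close> are conjugate under
  \<open>KK\<close>; taking logarithms reduces to conjugate elements of the closed chamber.\<close>

lemma cartan_projection_unique:
  assumes "Z \<in> closure C" "Z' \<in> closure C" "k \<in> KK" "l \<in> KK" "k' \<in> KK" "l' \<in> KK"
    and eq: "k ** mexp Z ** l = k' ** mexp Z' ** l'"
  shows "Z' = Z"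
proof -
  have ZA: "Z \<in> A" "Z' \<in> A" using assms closure_C_A by auto
  have sq: "star (a ** mexp W ** b) ** (a ** mexp W ** b) = star b ** mexp (2 *\<^sub>R W) ** b"
    if "W \<in> A" "a \<in> KK" for W a b
  proof -
    have "star (a ** mexp W ** b) ** (a ** mexp W ** b) =
        star b ** mexp W ** (star a ** a) ** mexp W ** b"
      by (simp add: star_mult star_mexp A_star[OF that(1)] matrix_mul_assoc)
    also have "\<dots> = star b ** (mexp W ** mexp W) ** b"
      by (simp add: KK_group(2)[OF that(2)] matrix_mul_assoc)
    finally show ?thesis using mexp_half[of "2 *\<^sub>R W"] by simp
  qed
  define h where "h = l' ** star l"
  have h: "h \<in> KK" unfolding h_def using assms by (intro KK_mult KK_group(4))
  have "star l ** mexp (2 *\<^sub>R Z) ** l = star l' ** mexp (2 *\<^sub>R Z') ** l'"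
    using sq[OF ZA(1) assms(3), of l] sq[OF ZA(2) assms(5), of l'] eq by simp
  then have "l' ** (star l ** mexp (2 *\<^sub>R Z) ** l) ** star l' = (l' ** star l') ** mexp (2 *\<^sub>R Z') ** (l' ** star l')"
    by (simp only: matrix_mul_assoc)
  also have "\<dots> = mexp (2 *\<^sub>R Z')" by (simp add: KK_group(3)[OF assms(6)])
  also have "l' ** (star l ** mexp (2 *\<^sub>R Z) ** l) ** star l' = h ** mexp (2 *\<^sub>R Z) ** star h"
    by (simp add: h_def star_mult matrix_mul_assoc)
  also have "\<dots> = mexp (h ** (2 *\<^sub>R Z) ** star h)"
    by (rule mexp_conj[symmetric]) (use KK_group[OF h] in auto)
  finally have "h ** (2 *\<^sub>R Z) ** star h = 2 *\<^sub>R Z'"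
    by (rule mexp_inj_self_adjoint[rotated 2]) (simp_all add: star_simps A_star ZA matrix_mul_assoc)
  then have "Z' = h ** Z ** star h" by (simp add: mat_ring)
  from closure_C_conj_unique[OF assms(1,2) h this] show ?thesis .
qed

end

section \<open>A size function that can be decreased by conjugates of small elements\<close>

text \<open>Let \<open>M\<close> be the largest absolute value. The sum of the cosh is at most
  \<open>n * cosh M\<close>, so the hypothesis forces \<open>M > 1\<close>, where
  \<open>cosh M \<le> 2 * sinh M\<close>; the norm of \<open>x\<close> is at most
  \<open>sqrt n * M\<close>. The three losses multiply to \<open>2 * n * sqrt n\<close>.\<close>

lemma sum_sinh_ge_sum_cosh:
  fixes x :: "'n::finite \<Rightarrow> real"
  defines "n \<equiv> real CARD('n)"
  assumes large: "2 * (\<Sum>i\<in>UNIV. cosh (x i)) > 2 * n * cosh 1"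
  shows "2 * (\<Sum>i\<in>UNIV. x i * sinh (x i)) \<ge> (1 / (2 * n * sqrt n)) * sqrt (\<Sum>i\<in>UNIV. x i ^ 2) * (2 * (\<Sum>i\<in>UNIV. cosh (x i)))"
proof -
  have n: "n > 0" by (simp add: n_def)
  define M where "M = Max (range (\<lambda>i. \<bar>x i\<bar>))"
  have xM: "\<bar>x i\<bar> \<le> M" for i unfolding M_def by (rule Max_ge) auto
  have "M \<in> range (\<lambda>i. \<bar>x i\<bar>)" unfolding M_def by (rule Max_in) auto
  then obtain i0 where i0: "M = \<bar>x i0\<bar>" by auto
  have M0: "M \<ge> 0" using i0 by simp
  have ca: "cosh \<bar>y\<bar> = cosh y" "\<bar>y\<bar> * sinh \<bar>y\<bar> = y * sinh y" for y :: real
    by (simp_all add: abs_if)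
  have cM: "cosh (x i) \<le> cosh M" for i
    using xM[of i] cosh_real_nonneg_le_iff[of "\<bar>x i\<bar>" M] M0 ca(1)[of "x i"] by simp
  have sc: "(\<Sum>i\<in>UNIV. cosh (x i)) \<le> n * cosh M"
    using sum_bounded_above[of UNIV "\<lambda>i. cosh (x i)" "cosh M"] cM by (simp add: n_def)
  have M1: "M > 1"
  proof (rule ccontr)
    assume "\<not> M > 1"
    then have "cosh M \<le> cosh 1" using cosh_real_nonneg_le_iff[of M 1] M0 by simp
    then have "n * cosh M \<le> n * cosh 1" using n by simp
    then show False using large sc by linarith
  qed
  have "exp M \<ge> 2" using exp_ge_add_one_self[of M] M1 by linarith
  then have "exp (- M) \<le> 1 / 2" by (simp add: exp_minus field_simps)
  have cs: "cosh M \<le> 2 * sinh M"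
    using \<open>exp M \<ge> 2\<close> \<open>exp (- M) \<le> 1 / 2\<close> unfolding cosh_field_def sinh_field_def by simp
  have nonneg: "x i * sinh (x i) \<ge> 0" for i
    unfolding ca(2)[of "x i", symmetric] by (intro mult_nonneg_nonneg) auto
  have "M * sinh M = x i0 * sinh (x i0)" unfolding i0 by (rule ca(2))
  also have "\<dots> \<le> (\<Sum>i\<in>UNIV. x i * sinh (x i))"
    by (rule member_le_sum) (use nonneg in auto)
  finally have 1: "M * sinh M \<le> (\<Sum>i\<in>UNIV. x i * sinh (x i))" .
  have "(\<Sum>i\<in>UNIV. x i ^ 2) \<le> n * M ^ 2"
    using sum_bounded_above[of UNIV "\<lambda>i. x i ^ 2" "M ^ 2"] xM abs_le_square_iff[of _ M] M0
    by (simp add: n_def)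
  then have "sqrt (\<Sum>i\<in>UNIV. x i ^ 2) \<le> sqrt (n * M ^ 2)" by (rule real_sqrt_le_mono)
  then have s2: "sqrt (\<Sum>i\<in>UNIV. x i ^ 2) \<le> sqrt n * M" using M0 by (simp add: real_sqrt_mult)
  have "sqrt (\<Sum>i\<in>UNIV. x i ^ 2) * (2 * (\<Sum>i\<in>UNIV. cosh (x i))) \<le> (sqrt n * M) * (2 * (n * cosh M))"
    using s2 sc n M0 by (intro mult_mono) (auto intro!: sum_nonneg cosh_real_nonneg mult_nonneg_nonneg)
  also have "\<dots> \<le> (sqrt n * M) * (2 * (n * (2 * sinh M)))"
    using cs n M0 by (intro mult_left_mono) auto
  also have "\<dots> = (2 * n * sqrt n) * (2 * (M * sinh M))" by simp
  also have "\<dots> \<le> (2 * n * sqrt n) * (2 * (\<Sum>i\<in>UNIV. x i * sinh (x i)))"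
    using 1 n by (intro mult_left_mono) auto
  finally show ?thesis using n by (simp add: field_simps)
qed

context adjoint begin

text \<open>The second term makes the size invariant under inversion and keeps limits of sequences
  of bounded size invertible.\<close>

definition \<tau> :: "real^'n^'n \<Rightarrow> real" where "\<tau> g = ip g g + ip (matrix_inv g) (matrix_inv g)"

definition \<rho> :: "real^'n^'n \<Rightarrow> real" where "\<rho> g = ln (\<tau> g)"

lemma \<tau>_pos: "invertible g \<Longrightarrow> \<tau> g > 0"
proof -
  assume "invertible g"
  have "g \<noteq> 0"
  proof
    assume "g = 0"
    with matrix_inv_right[OF \<open>invertible g\<close>] have "(mat 1 :: real^'n^'n) = 0" by simp
    then have "(mat 1 :: real^'n^'n) $ i $ i = 0" for i by simp
    then show False by (simp add: mat_def)
  qed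
  then show ?thesis using ip_pos[of g] ip_nonneg[of "matrix_inv g"] by (simp add: \<tau>_def)
qed

lemma \<tau>_matrix_inv: "invertible g \<Longrightarrow> \<tau> (matrix_inv g) = \<tau> g"
  unfolding \<tau>_def using matrix_inv_eq[OF matrix_inv_left[of g]] by simp

lemma ip_self_trace: "ip g g = trace (star g ** g)"
  unfolding ip_def by (rule trace_mul_sym)

lemma matrix_inv_mult:
  fixes g h :: "real^'n^'n"
  assumes "invertible g" "invertible h"
  shows "matrix_inv (g ** h) = matrix_inv h ** matrix_inv g"
proof (rule matrix_inv_eq)
  have "g ** h ** (matrix_inv h ** matrix_inv g) = g ** (h ** matrix_inv h) ** matrix_inv g"
    by (simp only: matrix_mul_assoc)
  then show "g ** h ** (matrix_inv h ** matrix_inv g) = mat 1"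
    by (simp add: matrix_inv_right assms)
qed

lemma matrix_inv_mexp: "matrix_inv (mexp X) = mexp (- X)"
  by (rule matrix_inv_eq) (rule mexp_minus)

lemma \<tau>_diagonal:
  fixes J Ji :: "real^'n^'n"
  assumes g: "star g ** g = J ** diagm (\<lambda>i. exp (x i)) ** Ji" "J ** Ji = mat 1" "Ji ** J = mat 1" "invertible g"
  shows "\<tau> g = 2 * (\<Sum>i\<in>UNIV. cosh (x i))"
proof -
  let ?i = "matrix_inv g"
  have "(star g ** g) ** (?i ** star ?i) = star g ** (g ** ?i) ** star ?i" by (simp only: matrix_mul_assoc)
  also have "\<dots> = star (?i ** g)" by (simp add: matrix_inv_right g(4) star_mult)
  finally have 1: "matrix_inv (star g ** g) = ?i ** star ?i"
    using matrix_inv_left[OF g(4)] by (intro matrix_inv_eq) simp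
  have "(J ** diagm (\<lambda>i. exp (x i)) ** Ji) ** (J ** diagm (\<lambda>i. exp (- x i)) ** Ji) =
      J ** diagm (\<lambda>i. exp (x i)) ** (Ji ** J) ** diagm (\<lambda>i. exp (- x i)) ** Ji"
    by (simp only: matrix_mul_assoc)
  also have "\<dots> = J ** (diagm (\<lambda>i. exp (x i)) ** diagm (\<lambda>i. exp (- x i))) ** Ji"
    by (simp add: g(3) matrix_mul_assoc)
  also have "\<dots> = mat 1" by (simp add: diagm_mult_diagm g(2) flip: exp_add)
  finally have 2: "matrix_inv (star g ** g) = J ** diagm (\<lambda>i. exp (- x i)) ** Ji"
    unfolding g(1) by (rule matrix_inv_eq)
  have "trace (?i ** star ?i) = (\<Sum>i\<in>UNIV. exp (- x i))"
    unfolding 1[symmetric] 2 by (simp add: trace_conj[OF g(3)] trace_diagm)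
  moreover have "trace (star g ** g) = (\<Sum>i\<in>UNIV. exp (x i))"
    unfolding g(1) by (simp add: trace_conj[OF g(3)] trace_diagm)
  moreover have "\<tau> g = trace (star g ** g) + trace (?i ** star ?i)"
    by (simp add: \<tau>_def ip_self_trace[of g]) (simp add: ip_def)
  ultimately show ?thesis
    by (simp add: sum.distrib[symmetric] sum_distrib_left cosh_field_def add_divide_distrib)
qed

text \<open>\<open>W\<close> is the orthogonal projection of \<open>M\<close> to \<open>V\<close>.
  Both \<open>V\<close> and \<open>ip\<close> are invariant under \<open>star\<close>, so the
  projection commutes with \<open>star\<close>.\<close>

lemma self_adjoint_projection:
  assumes "subspace V" "\<And>Y. Y \<in> V \<Longrightarrow> star Y \<in> V" "star M = M"
  obtains W where "W \<in> V" "star W = W" "\<And>Y. Y \<in> V \<Longrightarrow> ip M Y = ip W Y"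
proof -
  have sV: "span (cj ` V) = cj ` V"
    using linear_subspace_image[OF linear_cj assms(1)] by (simp add: span_eq_iff)
  obtain y z where yz: "y \<in> span (cj ` V)" "\<And>w. w \<in> span (cj ` V) \<Longrightarrow> orthogonal z w" "cj M = y + z"
    using orthogonal_subspace_decomp_exists[of "cj ` V" "cj M"] by metis
  obtain W where W: "W \<in> V" "y = cj W" using yz(1) sV by auto
  have proj: "ip M Y = ip W Y" if "Y \<in> V" for Y
    using yz(2)[of "cj Y"] that by (simp add: ip_eq yz(3) W inner_add_left orthogonal_def sV)
  have WV: "star W - W \<in> V" using assms W by (intro subspace_diff) auto
  have "ip (star W) Y = ip W Y" if "Y \<in> V" for Y
  proof -
    have "ip (star W) Y = ip W (star Y)" using ip_star[of W "star Y"] by simp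
    also have "\<dots> = ip M (star Y)" using proj assms(2)[OF that] by simp
    also have "\<dots> = ip M Y" using ip_star[of M Y] assms(3) by simp
    finally show ?thesis using proj[OF that] by simp
  qed
  from this[OF WV] have "ip (star W - W) (star W - W) = 0" by (simp add: ip_diff_left)
  then have "star W = W" by simp
  with W(1) proj that show ?thesis by blast
qed

lemma ip_scaleR_right: "ip X (c *\<^sub>R Y) = c * ip X Y"
  by (simp only: ip_commute[of X] ip_scaleR_left)

lemma norm_ip: "norm (cj X) = sqrt (ip X X)"
  by (simp add: ip_eq norm_eq_sqrt_inner)

lemma \<rho>_mult_le: "\<exists>c\<ge>0. \<forall>g h. invertible g \<longrightarrow> invertible h \<longrightarrow> \<rho> (g ** h) \<le> \<rho> g + \<rho> h + c"
proof -
  have "\<exists>K>0. \<forall>(A :: real^'n^'n) (B :: real^'n^'n). norm (A ** B) \<le> norm A * norm B * K"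
    by (rule mm.pos_bounded)
  then obtain K0 where K0: "K0 > 0" "\<And>(A :: real^'n^'n) (B :: real^'n^'n). norm (A ** B) \<le> norm A * norm B * K0"
    by auto
  \<comment> \<open>At least 1, so that the constant \<open>ln (K\<^sup>2)\<close> is
    nonnegative.\<close>
  define K where "K = max 1 K0"
  have K: "K \<ge> 1" by (simp add: K_def)
  have le: "ip (X ** Y) (X ** Y) \<le> ip X X * ip Y Y * K\<^sup>2" for X Y
  proof -
    have "norm (cj (X ** Y)) \<le> norm (cj X) * norm (cj Y) * K0" unfolding cj_mult by (rule K0)
    also have "\<dots> \<le> norm (cj X) * norm (cj Y) * K" by (intro mult_left_mono) (auto simp: K_def)
    finally have "(norm (cj (X ** Y)))\<^sup>2 \<le> (norm (cj X) * norm (cj Y) * K)\<^sup>2" by (intro power_mono) auto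
    then show ?thesis by (simp add: norm_ip ip_nonneg power_mult_distrib)
  qed
  have "\<rho> (g ** h) \<le> \<rho> g + \<rho> h + ln (K\<^sup>2)" if gh: "invertible g" "invertible h" for g h
  proof -
    let ?a = "ip g g" and ?b = "ip (matrix_inv g) (matrix_inv g)"
      and ?c = "ip h h" and ?d = "ip (matrix_inv h) (matrix_inv h)"
    have "\<tau> (g ** h) \<le> ?a * ?c * K\<^sup>2 + ?d * ?b * K\<^sup>2"
      unfolding \<tau>_def matrix_inv_mult[OF gh] by (intro add_mono le)
    also have "\<dots> \<le> (?a + ?b) * (?c + ?d) * K\<^sup>2"
      using ip_nonneg[of g] ip_nonneg[of h] ip_nonneg[of "matrix_inv g"] ip_nonneg[of "matrix_inv h"] K
      by (simp add: algebra_simps mult_nonneg_nonneg)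
    finally have "\<tau> (g ** h) \<le> \<tau> g * \<tau> h * K\<^sup>2" by (simp add: \<tau>_def)
    then have "ln (\<tau> (g ** h)) \<le> ln (\<tau> g * \<tau> h * K\<^sup>2)"
      using \<tau>_pos[OF invertible_mult[OF gh]] by (intro ln_mono) auto
    then show ?thesis using \<tau>_pos[OF gh(1)] \<tau>_pos[OF gh(2)] K by (simp add: \<rho>_def ln_mult)
  qed
  then show ?thesis using K by (intro exI[of _ "ln (K\<^sup>2)"]) auto
qed

lemma \<tau>_continuous:
  fixes y q :: "real^'n^'n"
  assumes "\<And>u. u \<in> U \<Longrightarrow> invertible (y ** u ** q)"
  shows "continuous_on U (\<lambda>u. \<tau> (y ** u ** q))"
  unfolding continuous_on_sequentially
proof (intro allI ballI impI)
  fix x a assume a: "a \<in> U" and x: "(\<forall>n. x n \<in> U) \<and> x \<longlonglongrightarrow> a"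
  have l: "(\<lambda>n. y ** x n ** q) \<longlonglongrightarrow> y ** a ** q" by (intro mm.tendsto tendsto_const x[THEN conjunct2])
  have "(\<lambda>n. trace ((y ** x n ** q) ** star (y ** x n ** q)) +
      trace (matrix_inv (y ** x n ** q) ** star (matrix_inv (y ** x n ** q)))) \<longlonglongrightarrow>
      trace ((y ** a ** q) ** star (y ** a ** q)) + trace (matrix_inv (y ** a ** q) ** star (matrix_inv (y ** a ** q)))"
    by (intro tendsto_add tendsto_trace mm.tendsto[OF _ tendsto_star] l tendsto_matrix_inv assms a)
  then show "((\<lambda>u. \<tau> (y ** u ** q)) \<circ> x) \<longlonglongrightarrow> \<tau> (y ** a ** q)" by (simp add: \<tau>_def ip_def o_def)
qed

end

context lie_group begin

text \<open>
  Writing \<open>star g ** g = mexp X\<close>, the derivative of \<open>\<rho>\<close> along \<open>g exp (t Y)\<close> is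
  \<open>2 trace ((mexp X - mexp (-X)) Y) / \<tau> g\<close>. Only the projection \<open>W\<close> of \<open>mexp X - mexp (-X)\<close>
  to the Lie algebra matters, and conjugation does not decrease the norm of the self-adjoint \<open>W\<close>.
\<close>

lemma \<rho>_descent_direction:
  assumes g: "g \<in> G" and q: "q \<in> G" and large: "\<tau> g > 2 * real CARD('n) * cosh 1"
  shows "\<exists>Z d. Z \<in> L \<and> ip Z Z = 1 \<and> d \<le> - (1 / (real CARD('n) * sqrt (real CARD('n)))) \<and>
    ((\<lambda>t. \<rho> (g ** matrix_inv q ** mexp (t *\<^sub>R Z) ** q)) has_real_derivative d) (at 0)"
proof -
  define n where "n = real CARD('n)"
  have n: "n > 0" by (simp add: n_def)
  have gi: "invertible g" "invertible q" using g q G_invertible by auto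
  obtain X where X: "X \<in> pp" "star g ** g = mexp X" by (rule star_mult_eq_mexp[OF g])
  have Xs: "star X = X" "X \<in> L" using X by (auto simp: pp_def)
  obtain J Ji :: "real^'n^'n" and x where J: "J ** Ji = mat 1" "Ji ** J = mat 1" "X = J ** diagm x ** Ji"
    using self_adjoint_diagonalization[OF Xs(1)] by metis
  have eX: "mexp X = J ** diagm (\<lambda>i. exp (x i)) ** Ji"
    by (simp add: J(3) mexp_conj_diagm J(1,2))
  have "- X = J ** diagm (\<lambda>i. - x i) ** Ji"
  proof -
    have "diagm (\<lambda>i. - x i) = - diagm x" by (simp add: diagm_def vec_eq_iff)
    then show ?thesis by (simp add: J(3) mm.minus_left mm.minus_right)
  qed
  then have eX': "mexp (- X) = J ** diagm (\<lambda>i. exp (- x i)) ** Ji"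
    by (simp add: mexp_conj_diagm J(1,2))
  have \<tau>x: "\<tau> g = 2 * (\<Sum>i\<in>UNIV. cosh (x i))"
    using \<tau>_diagonal[OF _ J(1,2) gi(1)] X(2) eX by simp
  have \<tau>0: "\<tau> g > 0" by (rule \<tau>_pos[OF gi(1)])
  define D where "D = mexp X - mexp (- X)"
  have Ds: "star D = D" by (simp add: D_def star_simps star_mexp Xs)
  obtain W where W: "W \<in> L" "star W = W" "\<And>Y. Y \<in> L \<Longrightarrow> ip D Y = ip W Y"
    using self_adjoint_projection[OF subspace_lie lie_star Ds] by metis
  have jj: "Y ** Ji ** J = Y" for Y using J(2) by (metis matrix_mul_assoc matrix_mul_rid)
  have ipX: "ip X X = (\<Sum>i\<in>UNIV. (x i)\<^sup>2)"
  proof -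
    have "ip X X = trace (J ** (diagm x ** diagm x) ** Ji)"
      by (simp add: ip_def Xs) (simp add: J(3) matrix_mul_assoc jj)
    then show ?thesis by (simp add: trace_conj[OF J(2)] diagm_mult_diagm trace_diagm power2_eq_square)
  qed
  have ipDX: "ip D X = 2 * (\<Sum>i\<in>UNIV. x i * sinh (x i))"
  proof -
    have "ip D X = trace (mexp X ** X) - trace (mexp (- X) ** X)"
      by (simp add: ip_def D_def Xs mm.diff_left trace_sub)
    also have "\<dots> = trace (J ** (diagm (\<lambda>i. exp (x i)) ** diagm x) ** Ji) - trace (J ** (diagm (\<lambda>i. exp (- x i)) ** diagm x) ** Ji)"
      unfolding eX eX' by (simp add: J(3) matrix_mul_assoc jj)
    also have "\<dots> = (\<Sum>i\<in>UNIV. exp (x i) * x i) - (\<Sum>i\<in>UNIV. exp (- x i) * x i)"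
      by (simp add: trace_conj[OF J(2)] diagm_mult_diagm trace_diagm)
    also have "\<dots> = 2 * (\<Sum>i\<in>UNIV. x i * sinh (x i))"
      by (simp add: sum_subtractf[symmetric] sum_distrib_left sinh_field_def diff_divide_distrib right_diff_distrib mult.commute[of "exp _"])
    finally show ?thesis .
  qed
  have large': "2 * (\<Sum>i\<in>UNIV. cosh (x i)) > 2 * real CARD('n) * cosh 1" using large by (simp add: \<tau>x)
  have key: "ip D X \<ge> (1 / (2 * n * sqrt n)) * sqrt (ip X X) * \<tau> g"
    unfolding ipDX ipX \<tau>x n_def by (rule sum_sinh_ge_sum_cosh[OF large'])
  have "X \<noteq> 0"
  proof
    assume "X = 0"
    then have "ip X X = 0" by simp
    then have "(\<Sum>i\<in>UNIV. (x i)\<^sup>2) = 0" using ipX by simp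
    then have "x i = 0" for i by (simp add: sum_nonneg_eq_0_iff)
    then have "\<tau> g = 2 * n" by (simp add: \<tau>x n_def)
    moreover have "cosh 1 \<ge> (1::real)" by (rule cosh_real_ge_1)
    then have "n * cosh 1 \<ge> n" using n by simp
    ultimately show False using large by (simp add: n_def)
  qed
  then have X0: "sqrt (ip X X) > 0" using ip_pos by simp
  define w where "w = sqrt (ip W W)"
  have "(1 / (2 * n * sqrt n)) * \<tau> g * sqrt (ip X X) \<le> w * sqrt (ip X X)"
    using key W(3)[OF Xs(2)] ip_cauchy_schwarz[of W X] by (simp add: w_def mult_ac)
  then have w\<tau>: "(1 / (2 * n * sqrt n)) * \<tau> g \<le> w" using X0 by (rule mult_right_le_imp_le)
  then have w0: "w > 0" using \<tau>0 n by (auto intro: less_le_trans[of 0 "(1 / (2 * n * sqrt n)) * \<tau> g"])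
  let ?q = "matrix_inv q"
  have qq: "q ** ?q = mat 1" "?q ** q = mat 1" "Y ** q ** ?q = Y" "Y ** ?q ** q = Y" for Y
    using matrix_inv_right[OF gi(2)] matrix_inv_left[OF gi(2)] by (auto simp: matrix_mul_assoc[symmetric])
  \<comment> \<open>The trace of the square does not change under conjugation: it equals
    \<open>ip W W\<close> for the self-adjoint \<open>W\<close>, while for \<open>V\<close> it is at
    most \<open>ip V V\<close>.\<close>
  define V where "V = q ** W ** ?q"
  define v where "v = sqrt (ip V V)"
  have VL: "V \<in> L" unfolding V_def by (rule lie_Ad[OF q W(1)])
  have "ip W W = trace (V ** V)"
  proof -
    have "V ** V = q ** (W ** W) ** ?q" by (simp add: V_def matrix_mul_assoc qq)
    then show ?thesis by (simp add: trace_conj[OF qq(2)] ip_def W(2))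
  qed
  also have "\<dots> = ip V (star V)" by (simp add: ip_def)
  also have "\<dots> \<le> sqrt (ip V V) * sqrt (ip (star V) (star V))" by (rule ip_cauchy_schwarz)
  also have "\<dots> = v\<^sup>2" by (simp add: v_def ip_star power2_eq_square)
  finally have "w\<^sup>2 \<le> v\<^sup>2" by (simp add: w_def ip_nonneg)
  then have wv: "w \<le> v" by (rule power2_le_imp_le) (simp add: v_def ip_nonneg)
  \<comment> \<open>The steepest unit direction, because the derivative depends on \<open>Z\<close>
    through \<open>trace (V ** Z)\<close>. Only \<open>Z\<close> is normalised; its conjugate
    \<open>Y\<close> may be arbitrarily long.\<close>
  define Z where "Z = (- (1 / v)) *\<^sub>R star V"
  have v0: "v > 0" using w0 wv by simp
  have ZL: "Z \<in> L" unfolding Z_def by (intro lie_scaleR lie_star VL)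
  have "ip Z Z = (1 / v) * (1 / v) * ip V V"
    unfolding Z_def ip_scaleR_left ip_scaleR_right ip_star by simp
  also have "ip V V = v\<^sup>2" by (simp add: v_def ip_nonneg)
  finally have Z1: "ip Z Z = 1" using v0 by (simp add: power2_eq_square)
  define Y where "Y = ?q ** Z ** q"
  have YL: "Y \<in> L"
    using lie_Ad[OF G_inv[OF q] ZL] matrix_inv_eq[OF qq(2)] by (simp add: Y_def)
  have DY: "trace (D ** Y) = - v"
  proof -
    have "trace (D ** Y) = ip D (star Y)" by (simp add: ip_def)
    also have "\<dots> = ip W (star Y)" by (rule W(3)[OF lie_star[OF YL]])
    also have "\<dots> = trace (W ** ?q ** Z ** q)" by (simp add: ip_def Y_def matrix_mul_assoc)
    also have "\<dots> = trace (q ** (W ** ?q ** Z))" by (rule trace_mul_sym)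
    also have "\<dots> = trace (V ** Z)" by (simp add: V_def matrix_mul_assoc)
    also have "\<dots> = - (1 / v) * ip V V"
      unfolding Z_def mm.scaleR_right trace_scaleR ip_def ..
    also have "ip V V = v\<^sup>2" by (simp add: v_def ip_nonneg)
    finally show ?thesis using v0 by (simp add: power2_eq_square)
  qed
  have path: "g ** ?q ** mexp (t *\<^sub>R Z) ** q = g ** mexp (t *\<^sub>R Y)" for t
    using mexp_conj[OF qq(2,1), of "t *\<^sub>R Z"] by (simp add: Y_def mat_ring)
  have \<tau>path: "\<tau> (g ** mexp (t *\<^sub>R Y)) =
      trace (mexp (t *\<^sub>R star Y) ** (mexp X ** mexp (t *\<^sub>R Y))) +
      trace (mexp (t *\<^sub>R (- Y)) ** (mexp (- X) ** mexp (t *\<^sub>R (- star Y))))" for t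
  proof -
    have "matrix_inv (star g ** g) = matrix_inv g ** matrix_inv (star g)"
      using gi(1) G_invertible[OF G_star[OF g]] by (intro matrix_inv_mult)
    then have pi: "matrix_inv g ** star (matrix_inv g) = mexp (- X)"
      by (simp add: X(2) matrix_inv_mexp star_matrix_inv gi(1))
    have "matrix_inv (g ** mexp (t *\<^sub>R Y)) = mexp (t *\<^sub>R (- Y)) ** matrix_inv g"
      using matrix_inv_mult[OF gi(1) invertible_mexp] by (simp add: matrix_inv_mexp)
    then have "ip (matrix_inv (g ** mexp (t *\<^sub>R Y))) (matrix_inv (g ** mexp (t *\<^sub>R Y))) =
        trace (mexp (t *\<^sub>R (- Y)) ** (matrix_inv g ** star (matrix_inv g)) ** mexp (t *\<^sub>R (- star Y)))"
      by (simp add: ip_def star_mult star_mexp star_simps matrix_mul_assoc)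
    moreover have "ip (g ** mexp (t *\<^sub>R Y)) (g ** mexp (t *\<^sub>R Y)) =
        trace (mexp (t *\<^sub>R star Y) ** (star g ** g) ** mexp (t *\<^sub>R Y))"
      by (simp add: ip_self_trace star_mult star_mexp star_simps matrix_mul_assoc)
    ultimately show ?thesis by (simp add: \<tau>_def pi X(2) matrix_mul_assoc)
  qed
  have tr_der: "((\<lambda>t. trace (mexp (t *\<^sub>R A) ** (M ** mexp (t *\<^sub>R B)))) has_real_derivative trace (A ** M) + trace (M ** B)) (at 0)"
    for A M B :: "real^'n^'n"
  proof -
    have "((\<lambda>t. mexp (t *\<^sub>R A) ** (M ** mexp (t *\<^sub>R B))) has_vector_derivative
        mexp (0 *\<^sub>R A) ** (M ** (mexp (0 *\<^sub>R B) ** B) + 0 ** mexp (0 *\<^sub>R B)) + (mexp (0 *\<^sub>R A) ** A) ** (M ** mexp (0 *\<^sub>R B))) (at 0)"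
      by (intro mm.has_vector_derivative has_vector_derivative_const has_vector_derivative_mexp)
    from bounded_linear.has_vector_derivative[OF bounded_linear_trace this]
    show ?thesis by (simp add: trace_add add.commute has_real_derivative_iff_has_vector_derivative)
  qed
  have \<tau>der: "((\<lambda>t. \<tau> (g ** mexp (t *\<^sub>R Y))) has_real_derivative - 2 * v) (at 0)"
  proof -
    have s: "trace (star Y ** mexp X) = trace (mexp X ** Y)"
      "trace (mexp (- X) ** star Y) = trace (Y ** mexp (- X))"
      using trace_star[of "star Y ** mexp X"] trace_star[of "mexp (- X) ** star Y"]
      by (simp_all add: star_mult star_mexp Xs star_minus)
    have "(trace (star Y ** mexp X) + trace (mexp X ** Y)) + (trace (- Y ** mexp (- X)) + trace (mexp (- X) ** (- star Y)))
        = 2 * (trace (mexp X ** Y) - trace (Y ** mexp (- X)))"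
      by (simp add: mm.minus_left mm.minus_right trace_neg s)
    also have "\<dots> = 2 * trace (D ** Y)"
      using trace_mul_sym[of Y "mexp (- X)"] by (simp add: D_def mm.diff_left trace_sub)
    finally show ?thesis
      using DERIV_add[OF tr_der[of "star Y" "mexp X" Y] tr_der[of "- Y" "mexp (- X)" "- star Y"]]
      unfolding \<tau>path by (simp add: DY)
  qed
  have "((\<lambda>t. ln (\<tau> (g ** mexp (t *\<^sub>R Y)))) has_real_derivative (1 / \<tau> (g ** mexp (0 *\<^sub>R Y))) * (- 2 * v)) (at 0)"
    by (rule DERIV_chain2[OF DERIV_ln_divide \<tau>der]) (use \<tau>0 in simp)
  then have der: "((\<lambda>t. \<rho> (g ** ?q ** mexp (t *\<^sub>R Z) ** q)) has_real_derivative - (2 * v / \<tau> g)) (at 0)"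
    unfolding path \<rho>_def by simp
  have "1 / (n * sqrt n) = 2 * ((1 / (2 * n * sqrt n)) * \<tau> g) / \<tau> g" using \<tau>0 n by (simp add: field_simps)
  also have "\<dots> \<le> 2 * v / \<tau> g" using w\<tau> wv \<tau>0 by (intro divide_right_mono mult_left_mono) auto
  finally have "- (2 * v / \<tau> g) \<le> - (1 / (n * sqrt n))" by simp
  with der ZL Z1 show ?thesis unfolding n_def by blast
qed

text \<open>The infinitesimal descent becomes finite by minimising \<open>\<rho>\<close> plus the
  penalty \<open>\<kappa> * norm (u - mat 1)\<close> over a compact ball of \<open>G\<close>. Where
  \<open>\<rho>\<close> exceeds \<open>R\<close>, a minimum inside the ball would contradict the
  descent direction; on the boundary the penalty has grown by \<open>\<kappa> * r\<close>, and
  \<open>\<rho>\<close> has dropped by as much.\<close>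

theorem \<rho>_descent:
  obtains r \<epsilon> R where "r > 0" "\<epsilon> > 0" "cball (mat 1) r \<subseteq> {A :: real^'n^'n. invertible A}"
    "\<And>g q. g \<in> G \<Longrightarrow> q \<in> G \<Longrightarrow>
      \<exists>u\<in>G. dist (mat 1) u \<le> r \<and> \<rho> (g ** matrix_inv q ** u ** q) \<le> max R (\<rho> g - \<epsilon>)"
proof -
  define c where "c = 1 / (real CARD('n) * sqrt (real CARD('n)))"
  have c: "c > 0" by (simp add: c_def)
  define R where "R = ln (2 * real CARD('n) * cosh 1)"
  have "invertible (mat 1 :: real^'n^'n)" by (simp add: invertible_if_right_inverse[of _ "mat 1"])
  then obtain r where r: "r > 0" "cball (mat 1) r \<subseteq> {A :: real^'n^'n. invertible A}"
    using open_contains_cball[THEN iffD1, OF open_invertible] by blast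
  obtain C1 where C1: "C1 > 0" "\<And>X. norm X \<le> C1 * sqrt (ip X X)" using norm_le_ip by auto
  have "\<exists>K>0. \<forall>(A :: real^'n^'n) (B :: real^'n^'n). norm (A ** B) \<le> norm A * norm B * K"
    by (rule mm.pos_bounded)
  then obtain K where K: "K > 0" "\<And>(A :: real^'n^'n) (B :: real^'n^'n). norm (A ** B) \<le> norm A * norm B * K"
    by auto
  \<comment> \<open>Bounds \<open>norm (u ** Z)\<close> for \<open>u\<close> in the ball and a unit
    vector \<open>Z\<close>; the penalty with slope \<open>c / (2 * b)\<close> then consumes at most
    half of the descent rate \<open>c\<close>.\<close>
  define b where "b = (norm (mat 1 :: real^'n^'n) + r) * C1 * K"
  have b: "b > 0" unfolding b_def using r(1) C1(1) K(1) by (intro mult_pos_pos add_nonneg_pos) auto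
  define \<kappa> where "\<kappa> = c / (2 * b)"
  have \<kappa>: "\<kappa> > 0" using b c by (simp add: \<kappa>_def)
  have main: "\<exists>u\<in>G. dist (mat 1) u \<le> r \<and> \<rho> (g ** matrix_inv q ** u ** q) \<le> max R (\<rho> g - \<kappa> * r)"
    if g: "g \<in> G" and q: "q \<in> G" for g q
  proof -
    let ?q = "matrix_inv q"
    have qq: "Y ** q ** ?q = Y" "Y ** ?q ** q = Y" for Y
      using matrix_inv_right[OF G_invertible[OF q]] matrix_inv_left[OF G_invertible[OF q]]
      by (auto simp: matrix_mul_assoc[symmetric])
    define y where "y = g ** ?q"
    define U where "U = {u \<in> G. dist (mat 1) u \<le> r}"
    have yuq: "y ** u ** q \<in> G" if "u \<in> G" for u unfolding y_def by (intro G_mult G_inv g q that)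
    have "compact U"
    proof -
      have "closed U" unfolding closed_sequential_limits
      proof safe
        fix x l assume x: "\<forall>n. x n \<in> U" "x \<longlonglongrightarrow> l"
        then have l: "l \<in> cball (mat 1) r"
          using closed_sequentially[of "cball (mat 1) r" x l] by (auto simp: U_def)
        then have "invertible l" using r by auto
        then have "l \<in> G" using x by (intro G_limit[of x l]) (auto simp: U_def)
        with l show "l \<in> U" by (simp add: U_def)
      qed
      moreover have "bounded U" by (rule bounded_subset[of "cball (mat 1) r"]) (auto simp: U_def)
      ultimately show ?thesis by (simp add: compact_eq_bounded_closed)
    qed
    define F where "F u = \<rho> (y ** u ** q) + \<kappa> * norm (u - mat 1)" for u
    have contF: "continuous_on U F"
    proof -
      have inv: "invertible (y ** u ** q)" if "u \<in> U" for u
        using yuq that G_invertible by (auto simp: U_def)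
      have cl: "continuous_on U (\<lambda>u. ln (\<tau> (y ** u ** q)))"
        by (intro continuous_on_ln \<tau>_continuous inv) (use \<tau>_pos[OF inv] in \<open>auto simp: less_imp_neq[THEN not_sym]\<close>)
      show ?thesis unfolding F_def \<rho>_def by (rule continuous_on_add[OF cl]) (intro continuous_intros)
    qed
    have 1: "mat 1 \<in> U" using G_one r by (simp add: U_def)
    then have "U \<noteq> {}" by auto
    from continuous_attains_inf[OF \<open>compact U\<close> this contF] obtain u where u: "u \<in> U"
      and min: "\<And>u'. u' \<in> U \<Longrightarrow> F u \<le> F u'" by auto
    have uG: "u \<in> G" "dist (mat 1) u \<le> r" using u by (auto simp: U_def)
    define h where "h = y ** u ** q"
    have hG: "h \<in> G" unfolding h_def by (rule yuq[OF uG(1)])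
    show ?thesis
    proof (cases "\<rho> h \<le> R")
      case True
      then show ?thesis using uG by (intro bexI[of _ u]) (auto simp: h_def y_def)
    next
      case False
      have "\<tau> h > 2 * real CARD('n) * cosh 1"
      proof -
        have "ln (2 * real CARD('n) * cosh 1) < ln (\<tau> h)" using False by (simp add: R_def \<rho>_def)
        then show ?thesis using \<tau>_pos[OF G_invertible[OF hG]] by (simp add: cosh_real_pos)
      qed
      from \<rho>_descent_direction[OF hG q this] obtain Z d where Z: "Z \<in> L" "ip Z Z = 1" and d: "d \<le> - c"
        and der: "((\<lambda>t. \<rho> (h ** ?q ** mexp (t *\<^sub>R Z) ** q)) has_real_derivative d) (at 0)"
        unfolding c_def by auto
      have "dist (mat 1) u = r"
      proof (rule ccontr)
        assume "dist (mat 1) u \<noteq> r"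
        then have ur: "dist u (mat 1) < r" using uG by (simp add: dist_commute)
        define t where "t k = inverse (real (Suc k))" for k
        have t: "t \<longlonglongrightarrow> 0" "\<And>k. t k > 0" "\<And>k. t k \<noteq> 0"
          unfolding t_def using LIMSEQ_inverse_real_of_nat by auto
        define e where "e k = mexp (t k *\<^sub>R Z)" for k
        have e1: "e \<longlonglongrightarrow> mat 1" unfolding e_def by (rule mexp_scaleR_tendsto_one[OF t(1)])
        have eq: "(\<lambda>k. (1 / t k) *\<^sub>R (e k - mat 1)) \<longlonglongrightarrow> Z"
          unfolding e_def by (rule mexp_difference_quotient[OF t(1,3)])
        have ueG: "u ** e k \<in> G" for k unfolding e_def by (intro G_mult uG lie_mexp_scaleR Z)
        have "(\<lambda>k. u ** e k) \<longlonglongrightarrow> u ** mat 1" by (intro mm.tendsto tendsto_const e1)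
        then have ue: "(\<lambda>k. u ** e k) \<longlonglongrightarrow> u" by simp
        have "(\<lambda>k. dist (u ** e k) (mat 1)) \<longlonglongrightarrow> dist u (mat 1)" by (intro tendsto_dist ue tendsto_const)
        from order_tendstoD(2)[OF this ur]
        have "\<forall>\<^sub>F k in sequentially. u ** e k \<in> U"
          by eventually_elim (simp add: U_def ueG dist_commute less_imp_le)
        then have ev: "\<forall>\<^sub>F k in sequentially. 0 \<le> (\<rho> (h ** ?q ** e k ** q) - \<rho> h) / t k
            + \<kappa> * norm (u ** ((1 / t k) *\<^sub>R (e k - mat 1)))"
        proof eventually_elim
          case (elim k)
          have p: "h ** ?q ** e k ** q = y ** (u ** e k) ** q" by (simp add: h_def matrix_mul_assoc qq)
          have n: "norm (u ** e k - mat 1) \<le> norm (u - mat 1) + norm (u ** (e k - mat 1))"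
            using norm_triangle_ineq[of "u - mat 1" "u ** (e k - mat 1)"] by (simp add: mat_ring)
          have "F u \<le> F (u ** e k)" by (rule min[OF elim])
          then have "0 \<le> \<rho> (h ** ?q ** e k ** q) - \<rho> h + \<kappa> * (norm (u ** e k - mat 1) - norm (u - mat 1))"
            unfolding F_def p[symmetric] h_def[symmetric] by (simp add: algebra_simps)
          also have "\<dots> \<le> \<rho> (h ** ?q ** e k ** q) - \<rho> h + \<kappa> * norm (u ** (e k - mat 1))"
            using n \<kappa> by (intro add_left_mono mult_left_mono) auto
          finally have "0 \<le> (\<rho> (h ** ?q ** e k ** q) - \<rho> h + \<kappa> * norm (u ** (e k - mat 1))) / t k"
            using t(2)[of k] by simp
          then show ?case using t(2)[of k] by (simp add: add_divide_distrib mm.scaleR_right)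
        qed
        have "((\<lambda>s. (\<rho> (h ** ?q ** mexp (s *\<^sub>R Z) ** q) - \<rho> (h ** ?q ** mexp (0 *\<^sub>R Z) ** q)) / (s - 0)) \<longlongrightarrow> d) (at 0)"
          using der by (simp add: has_field_derivative_iff)
        moreover have "filterlim t (at 0) sequentially" using t by (simp add: filterlim_at)
        ultimately have "(\<lambda>k. (\<rho> (h ** ?q ** mexp (t k *\<^sub>R Z) ** q) - \<rho> (h ** ?q ** mexp (0 *\<^sub>R Z) ** q)) / (t k - 0)) \<longlonglongrightarrow> d"
          by (rule filterlim_compose)
        then have "(\<lambda>k. (\<rho> (h ** ?q ** e k ** q) - \<rho> h) / t k) \<longlonglongrightarrow> d"
          by (simp add: e_def qq)
        then have "(\<lambda>k. (\<rho> (h ** ?q ** e k ** q) - \<rho> h) / t k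
            + \<kappa> * norm (u ** ((1 / t k) *\<^sub>R (e k - mat 1)))) \<longlonglongrightarrow> d + \<kappa> * norm (u ** Z)"
          by (intro tendsto_add tendsto_mult_left tendsto_norm mm.tendsto tendsto_const eq)
        from tendsto_lowerbound[OF this ev] have "0 \<le> d + \<kappa> * norm (u ** Z)" by simp
        also have "norm (u ** Z) \<le> b"
        proof -
          have "norm u \<le> norm (mat 1 :: real^'n^'n) + r"
            using ur norm_triangle_ineq[of "mat 1" "u - mat 1"] by (simp add: dist_norm)
          moreover have "norm Z \<le> C1" using C1(2)[of Z] Z(2) by simp
          ultimately have "norm u * norm Z * K \<le> (norm (mat 1 :: real^'n^'n) + r) * C1 * K"
            using K(1) C1(1) r(1) by (intro mult_right_mono mult_mono) auto
          then show ?thesis using K(2)[of u Z] by (simp add: b_def)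
        qed
        also have "\<kappa> * b = c / 2" using b by (simp add: \<kappa>_def)
        finally show False using d c \<kappa> by (simp add: mult_left_mono)
      qed
      then have "F u = \<rho> h + \<kappa> * r" by (simp add: F_def h_def dist_norm norm_minus_commute)
      moreover have "F (mat 1) = \<rho> g" by (simp add: F_def y_def qq)
      ultimately have "\<rho> h \<le> \<rho> g - \<kappa> * r" using min[OF 1] by simp
      then show ?thesis using uG by (intro bexI[of _ u]) (auto simp: h_def y_def)
    qed
  qed
  show ?thesis using that[OF r(1) _ r(2) main] \<kappa> r(1) by simp
qed

end

section \<open>Word length and the size function\<close>

context weyl_chamber begin

lemma \<tau>_cartan:
  assumes Z: "star Z = Z" and kl: "k \<in> KK" "l \<in> KK"
  obtains z :: "'n \<Rightarrow> real" where "\<tau> (k ** mexp Z ** l) = 2 * (\<Sum>i\<in>UNIV. cosh (2 * z i))" "ip Z Z = (\<Sum>i\<in>UNIV. (z i)\<^sup>2)"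
proof -
  obtain J Ji :: "real^'n^'n" and z where J: "J ** Ji = mat 1" "Ji ** J = mat 1" "Z = J ** diagm z ** Ji"
    using self_adjoint_diagonalization[OF Z] by metis
  have jj: "Y ** Ji ** J = Y" for Y using J(2) by (metis matrix_mul_assoc matrix_mul_rid)
  have "2 *\<^sub>R Z = J ** diagm (\<lambda>i. 2 * z i) ** Ji"
  proof -
    have "diagm (\<lambda>i. 2 * z i) = 2 *\<^sub>R diagm z" by (simp add: diagm_def vec_eq_iff)
    then show ?thesis by (simp add: J(3) mm.scaleR_left mm.scaleR_right)
  qed
  then have e2: "mexp (2 *\<^sub>R Z) = J ** diagm (\<lambda>i. exp (2 * z i)) ** Ji"
    by (simp add: mexp_conj_diagm J(1,2))
  have "star (k ** mexp Z ** l) ** (k ** mexp Z ** l) = star l ** mexp Z ** (star k ** k) ** mexp Z ** l"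
    by (simp add: star_mult star_mexp Z matrix_mul_assoc)
  also have "\<dots> = star l ** (mexp Z ** mexp Z) ** l" by (simp add: KK_group(2)[OF kl(1)] matrix_mul_assoc)
  also have "mexp Z ** mexp Z = mexp (2 *\<^sub>R Z)" using mexp_half[of "2 *\<^sub>R Z"] by simp
  also have "star l ** mexp (2 *\<^sub>R Z) ** l = (star l ** J) ** diagm (\<lambda>i. exp (2 * z i)) ** (Ji ** l)"
    by (simp add: e2 matrix_mul_assoc)
  finally have s: "star (k ** mexp Z ** l) ** (k ** mexp Z ** l) =
    (star l ** J) ** diagm (\<lambda>i. exp (2 * z i)) ** (Ji ** l)" .
  have "(star l ** J) ** (Ji ** l) = star l ** (J ** Ji) ** l" by (simp only: matrix_mul_assoc)
  then have 1: "(star l ** J) ** (Ji ** l) = mat 1" by (simp add: J KK_group(2)[OF kl(2)])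
  have "(Ji ** l) ** (star l ** J) = Ji ** (l ** star l) ** J" by (simp only: matrix_mul_assoc)
  then have 2: "(Ji ** l) ** (star l ** J) = mat 1" by (simp add: J KK_group(3)[OF kl(2)])
  have inv: "invertible (k ** mexp Z ** l)"
    using kl KK_group(1) G_invertible by (intro invertible_mult invertible_mexp) auto
  have "ip Z Z = trace (J ** (diagm z ** diagm z) ** Ji)"
    by (simp add: ip_def Z) (simp add: J(3) matrix_mul_assoc jj)
  then have "ip Z Z = (\<Sum>i\<in>UNIV. (z i)\<^sup>2)"
    by (simp add: trace_conj[OF J(2)] diagm_mult_diagm trace_diagm power2_eq_square)
  with \<tau>_diagonal[OF s 1 2 inv] that show ?thesis by blast
qed

text \<open>With the converse \<open>cartan_le_\<rho>\<close>, the function \<open>\<rho>\<close>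
  measures the norm of the Cartan projection up to constants. This half turns a difference of
  projections into a number of letters.\<close>

lemma \<rho>_cartan_le:
  assumes Z: "star Z = Z" and kl: "k \<in> KK" "l \<in> KK"
  shows "\<rho> (k ** mexp Z ** l) \<le> ln (2 * real CARD('n)) + 2 * sqrt (ip Z Z)"
proof -
  obtain z :: "'n \<Rightarrow> real" where z: "\<tau> (k ** mexp Z ** l) = 2 * (\<Sum>i\<in>UNIV. cosh (2 * z i))" "ip Z Z = (\<Sum>i\<in>UNIV. (z i)\<^sup>2)"
    by (rule \<tau>_cartan[OF assms])
  let ?m = "sqrt (ip Z Z)"
  have "cosh (2 * z i) \<le> exp (2 * ?m)" for i
  proof -
    have "(z i)\<^sup>2 \<le> ip Z Z" unfolding z(2) by (rule member_le_sum) simp_all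
    then have m: "\<bar>z i\<bar> \<le> ?m" by (metis real_sqrt_abs real_sqrt_le_mono)
    then have "exp (2 * z i) \<le> exp (2 * ?m)" "exp (- (2 * z i)) \<le> exp (2 * ?m)" by auto
    from add_mono[OF this] show ?thesis by (simp add: cosh_field_def)
  qed
  then have "(\<Sum>i\<in>(UNIV :: 'n set). cosh (2 * z i)) \<le> real CARD('n) * exp (2 * ?m)"
    using sum_bounded_above[of UNIV "\<lambda>i. cosh (2 * z i)" "exp (2 * ?m)"] by simp
  then have le: "\<tau> (k ** mexp Z ** l) \<le> 2 * real CARD('n) * exp (2 * ?m)" by (simp add: z(1))
  have "invertible (k ** mexp Z ** l)"
    using kl KK_group(1) G_invertible by (intro invertible_mult invertible_mexp) auto
  then have "\<rho> (k ** mexp Z ** l) \<le> ln (2 * real CARD('n) * exp (2 * ?m))"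
    unfolding \<rho>_def using le \<tau>_pos by (intro ln_mono) auto
  also have "\<dots> = ln (2 * real CARD('n)) + 2 * ?m" by (subst ln_mult) auto
  finally show ?thesis .
qed

lemma cartan_le_\<rho>:
  assumes Z: "star Z = Z" and kl: "k \<in> KK" "l \<in> KK"
  shows "sqrt (ip Z Z) \<le> real CARD('n) * \<rho> (k ** mexp Z ** l)"
proof -
  obtain z :: "'n \<Rightarrow> real" where z: "\<tau> (k ** mexp Z ** l) = 2 * (\<Sum>i\<in>UNIV. cosh (2 * z i))" "ip Z Z = (\<Sum>i\<in>UNIV. (z i)\<^sup>2)"
    by (rule \<tau>_cartan[OF assms])
  let ?r = "\<rho> (k ** mexp Z ** l)"
  have "\<bar>z i\<bar> \<le> ?r" for i
  proof -
    have "exp \<bar>z i\<bar> \<le> exp \<bar>2 * z i\<bar>" by simp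
    also have "\<dots> \<le> 2 * cosh (2 * z i)" by (auto simp: cosh_field_def abs_if)
    also have "cosh (2 * z i) \<le> (\<Sum>i\<in>UNIV. cosh (2 * z i))"
      by (rule member_le_sum) (auto simp: cosh_real_nonneg)
    finally have "exp \<bar>z i\<bar> \<le> \<tau> (k ** mexp Z ** l)" by (simp add: z(1))
    then have "ln (exp \<bar>z i\<bar>) \<le> ?r" unfolding \<rho>_def by (intro ln_mono) auto
    then show ?thesis by simp
  qed
  then have "(\<Sum>i\<in>(UNIV :: 'n set). \<bar>z i\<bar>) \<le> real CARD('n) * ?r"
    using sum_bounded_above[of UNIV "\<lambda>i. \<bar>z i\<bar>" ?r] by simp
  moreover have "sqrt (ip Z Z) \<le> (\<Sum>i\<in>UNIV. \<bar>z i\<bar>)"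
    unfolding z(2) using L2_set_le_sum_abs[of z UNIV] by (simp add: L2_set_def)
  ultimately show ?thesis by simp
qed

lemma \<rho>_nonneg:
  assumes "g \<in> G" shows "\<rho> g \<ge> 0"
proof -
  obtain k l Z where Z: "k \<in> KK" "l \<in> KK" "Z \<in> closure C" "g = k ** mexp Z ** l"
    by (rule cartan_decomposition[OF assms])
  then have "star Z = Z" using closure_C_A A_star by auto
  from \<tau>_cartan[OF this Z(1,2)] obtain z :: "'n \<Rightarrow> real" where z: "\<tau> g = 2 * (\<Sum>i\<in>(UNIV :: 'n set). cosh (2 * z i))"
    unfolding Z(4) by metis
  have "real CARD('n) * 1 \<le> (\<Sum>i\<in>(UNIV :: 'n set). cosh (2 * z i))"
    using sum_bounded_below[of UNIV 1 "\<lambda>i. cosh (2 * z i)"] by (simp add: cosh_real_ge_1)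
  moreover have "real CARD('n) \<ge> 1" by (simp add: Suc_le_eq)
  ultimately have "\<tau> g \<ge> 1" unfolding z by linarith
  then show ?thesis by (simp add: \<rho>_def)
qed

definition tball :: "real \<Rightarrow> (real^'n^'n) set" where "tball n = {g \<in> G. \<tau> g \<le> n}"

text \<open>Bounds on \<open>g\<close> and on its inverse pass to a common subsequence; the two
  limits are inverse to each other, so the limit stays in \<open>G\<close>.\<close>

lemma compact_tball: "compact (tball n)"
  unfolding compact_eq_seq_compact_metric seq_compact_def
proof (intro allI impI)
  fix x :: "nat \<Rightarrow> real^'n^'n" assume x: "\<forall>k. x k \<in> tball n"
  have le: "ip (x k) (x k) \<le> n" "ip (matrix_inv (x k)) (matrix_inv (x k)) \<le> n" "x k \<in> G" for k
  proof -
    have "x k \<in> G" "ip (x k) (x k) + ip (matrix_inv (x k)) (matrix_inv (x k)) \<le> n"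
      using x by (simp_all add: tball_def \<tau>_def)
    then show "ip (x k) (x k) \<le> n" "ip (matrix_inv (x k)) (matrix_inv (x k)) \<le> n" "x k \<in> G"
      using ip_nonneg[of "x k"] ip_nonneg[of "matrix_inv (x k)"] by linarith+
  qed
  obtain l r where r: "strict_mono (r :: nat \<Rightarrow> nat)" "(\<lambda>k. x (r k)) \<longlonglongrightarrow> l"
    by (rule ip_bounded_imp_convergent_subsequence[OF le(1)])
  obtain l' r' where r': "strict_mono (r' :: nat \<Rightarrow> nat)" "(\<lambda>k. matrix_inv (x (r (r' k)))) \<longlonglongrightarrow> l'"
    by (rule ip_bounded_imp_convergent_subsequence[OF le(2)[of "r _"]])
  have xl: "(\<lambda>k. x (r (r' k))) \<longlonglongrightarrow> l" using LIMSEQ_subseq_LIMSEQ[OF r(2) r'(1)] by (simp add: o_def)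
  have "(\<lambda>k. x (r (r' k)) ** matrix_inv (x (r (r' k)))) \<longlonglongrightarrow> l ** l'" by (intro mm.tendsto xl r')
  then have "(\<lambda>k::nat. mat 1) \<longlonglongrightarrow> l ** l'" using matrix_inv_right[OF G_invertible[OF le(3)]] by simp
  then have "l ** l' = mat 1" using LIMSEQ_const_iff by metis
  then have li: "invertible l" by (rule invertible_if_right_inverse)
  have lG: "l \<in> G" by (rule G_limit[OF le(3) xl li])
  have "continuous_on G (\<lambda>u. \<tau> (mat 1 ** u ** mat 1))"
    by (rule \<tau>_continuous) (use G_invertible in auto)
  then have "(\<lambda>k. \<tau> (x (r (r' k)))) \<longlonglongrightarrow> \<tau> l"
    using le(3) lG xl unfolding continuous_on_sequentially by (auto simp: o_def)
  then have "\<tau> l \<le> n" by (rule LIMSEQ_le_const2) (use x in \<open>auto simp: tball_def\<close>)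
  then have "l \<in> tball n" using lG by (simp add: tball_def)
  moreover have "strict_mono (r \<circ> r')" using r(1) r'(1) by (rule strict_mono_o)
  ultimately show "\<exists>l\<in>tball n. \<exists>r. strict_mono r \<and> (x \<circ> r) \<longlonglongrightarrow> l"
    using xl by (intro bexI[of _ l] exI[of _ "r \<circ> r'"]) (auto simp: o_def)
qed

lemma compact_subset_tball:
  assumes "compact U" "U \<subseteq> G"
  shows "\<exists>n. U \<subseteq> tball n"
proof -
  have "continuous_on U (\<lambda>u. \<tau> (mat 1 ** u ** mat 1))"
    by (rule \<tau>_continuous) (use assms G_invertible in auto)
  then have "bounded (\<tau> ` U)" using compact_imp_bounded[OF compact_continuous_image[OF _ assms(1)]] by simp
  then obtain n where "\<And>u. u \<in> U \<Longrightarrow> norm (\<tau> u) \<le> n" by (auto simp: bounded_iff)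
  then show ?thesis using assms by (intro exI[of _ n]) (force simp: tball_def)
qed

text \<open>Progress is measured by \<open>\<rho> (matrix_inv \<gamma> ** g0)\<close> for a moving
  point \<open>g0 = \<gamma>0 ** c0 ** h0\<close>. A round takes a new representation of the same
  point from the cover, which costs one letter of \<open>P\<close>, and then replaces
  \<open>c1\<close> by \<open>c1 ** u\<close>, which lowers the measure by \<open>\<epsilon>\<close>
  as long as it is above \<open>R\<close>.\<close>

lemma word_bound:
  assumes \<Gamma>: "subgroup \<Gamma> (matgrp GL)" "\<Gamma> \<subseteq> G" and H: "subgroup H (matgrp GL)" "H \<subseteq> G"
    and cover: "\<And>g. g \<in> G \<Longrightarrow> \<exists>\<gamma>\<in>\<Gamma>. \<exists>c\<in>tball n0. \<exists>h\<in>H. g = \<gamma> ** c ** h"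
    and proper: "\<And>n. finite {\<gamma> \<in> \<Gamma>. \<exists>c\<in>tball n. \<exists>c'\<in>tball n. \<exists>h\<in>H. \<exists>h'\<in>H. \<gamma> ** c ** h = c' ** h'}"
  obtains P a b where "finite P" "P \<subseteq> \<Gamma>" "a > 0" "b > 0"
    "\<And>\<gamma> k h g. \<gamma> \<in> \<Gamma> \<Longrightarrow> k \<in> KK \<Longrightarrow> h \<in> H \<Longrightarrow> g \<in> G \<Longrightarrow> \<gamma> = k ** h ** g \<Longrightarrow>
      \<exists>ws. set ws \<subseteq> P \<and> real (length ws) \<le> a * \<rho> g + b \<and> \<gamma> = foldr (**) ws (mat 1)"
proof -
  note sub = subgroup_matgrp_GL
  obtain r \<epsilon> R where r: "r > 0" and \<epsilon>: "\<epsilon> > 0" and cb: "cball (mat 1) r \<subseteq> {A :: real^'n^'n. invertible A}"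
    and descent: "\<And>g q. g \<in> G \<Longrightarrow> q \<in> G \<Longrightarrow>
      \<exists>u\<in>G. dist (mat 1) u \<le> r \<and> \<rho> (g ** matrix_inv q ** u ** q) \<le> max R (\<rho> g - \<epsilon>)"
    using \<rho>_descent by metis
  define U where "U = {u \<in> G. dist (mat 1) u \<le> r}"
  have "compact U"
  proof -
    have "closed U" unfolding closed_sequential_limits
    proof safe
      fix x l assume x: "\<forall>n. x n \<in> U" "x \<longlonglongrightarrow> l"
      then have l: "l \<in> cball (mat 1) r"
        using closed_sequentially[of "cball (mat 1) r" x l] by (auto simp: U_def)
      then have "invertible l" using cb by auto
      then have "l \<in> G" using x by (intro G_limit[of x l]) (auto simp: U_def)
      with l show "l \<in> U" by (simp add: U_def)
    qed
    moreover have "bounded U" by (rule bounded_subset[of "cball (mat 1) r"]) (auto simp: U_def)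
    ultimately show ?thesis by (simp add: compact_eq_bounded_closed)
  qed
  define V where "V = (\<lambda>(c, u). c ** u) ` (tball n0 \<times> U)"
  have "compact V" unfolding V_def
    by (intro compact_continuous_image compact_Times compact_tball \<open>compact U\<close>)
       (auto simp: case_prod_unfold intro!: mm.continuous_on continuous_on_fst continuous_on_snd continuous_on_id)
  \<comment> \<open>\<open>n1\<close> has to accommodate every compact part that occurs:
    \<open>KK\<close> at the start, \<open>tball n0\<close> from the cover, \<open>V\<close> after a
    descent and the sublevel set of \<open>R\<close> at the end.\<close>
  have "compact (KK \<union> V \<union> tball n0 \<union> tball (exp R))"
    by (intro compact_Un compact_KK compact_tball \<open>compact V\<close>)
  moreover have "KK \<union> V \<union> tball n0 \<union> tball (exp R) \<subseteq> G"
    using KK_group(1) by (auto simp: tball_def V_def U_def intro: G_mult)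
  ultimately obtain n1 where n1: "KK \<subseteq> tball n1" "V \<subseteq> tball n1" "tball n0 \<subseteq> tball n1" "tball (exp R) \<subseteq> tball n1"
    using compact_subset_tball by (metis le_supE)
  have R_tball: "g \<in> tball n1" if "g \<in> G" "\<rho> g \<le> R" for g
  proof -
    have "\<tau> g > 0" using that \<tau>_pos G_invertible by blast
    then have "\<tau> g \<le> exp R" using that(2) unfolding \<rho>_def by (metis exp_le_cancel_iff exp_ln)
    then show ?thesis using n1(4) that by (auto simp: tball_def)
  qed
  define P where "P = {\<gamma> \<in> \<Gamma>. \<exists>c\<in>tball n1. \<exists>c'\<in>tball n1. \<exists>h\<in>H. \<exists>h'\<in>H. \<gamma> ** c ** h = c' ** h'}"
  have P_intro: "matrix_inv \<gamma> ** \<gamma>' \<in> P"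
    if "\<gamma> \<in> \<Gamma>" "\<gamma>' \<in> \<Gamma>" "c \<in> tball n1" "c' \<in> tball n1" "h \<in> H" "h' \<in> H" "\<gamma> ** c ** h = \<gamma>' ** c' ** h'" for \<gamma> \<gamma>' c c' h h'
  proof -
    have "matrix_inv \<gamma> ** \<gamma>' ** c' ** h' = matrix_inv \<gamma> ** (\<gamma>' ** c' ** h')" by (simp only: matrix_mul_assoc)
    also have "\<dots> = (matrix_inv \<gamma> ** \<gamma>) ** c ** h" unfolding that(7)[symmetric] by (simp only: matrix_mul_assoc)
    also have "\<dots> = c ** h" using that(1) sub(1)[OF \<Gamma>(1)] by (simp add: matrix_inv_left)
    finally show ?thesis unfolding P_def using that sub(3,4)[OF \<Gamma>(1)] by blast
  qed
  \<comment> \<open>\<open>m\<close> counts the remaining descents; the extra letter in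
    \<open>Suc m\<close> is the last one, from a point with \<open>\<rho>\<close> at most
    \<open>R\<close> to \<open>\<gamma>\<close> itself.\<close>
  have step: "\<exists>ws. set ws \<subseteq> P \<and> length ws \<le> Suc m \<and> \<gamma> = \<gamma>0 ** foldr (**) ws (mat 1)"
    if "\<gamma> \<in> \<Gamma>" "\<gamma>0 \<in> \<Gamma>" "c0 \<in> tball n1" "h0 \<in> H" "\<rho> (matrix_inv \<gamma> ** (\<gamma>0 ** c0 ** h0)) \<le> R + real m * \<epsilon>" for \<gamma> \<gamma>0 c0 h0 m
    using that
  proof (induction m arbitrary: \<gamma>0 c0 h0)
    case 0
    have gi: "invertible \<gamma>" using 0 sub(1)[OF \<Gamma>(1)] by blast
    define b where "b = matrix_inv \<gamma> ** (\<gamma>0 ** c0 ** h0)"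
    have "b \<in> G" unfolding b_def using 0 \<Gamma>(2) H(2) by (intro G_mult G_inv) (auto simp: tball_def)
    then have "b \<in> tball n1" using 0 by (intro R_tball) (auto simp: b_def)
    moreover have "\<gamma> ** b ** mat 1 = \<gamma>0 ** c0 ** h0"
      by (simp add: b_def matrix_mul_assoc matrix_inv_right gi)
    ultimately have "matrix_inv \<gamma>0 ** \<gamma> \<in> P"
      using 0 sub(2)[OF H(1)] by (intro P_intro[of \<gamma>0 \<gamma> c0 b h0 "mat 1"]) auto
    moreover have "\<gamma> = \<gamma>0 ** (matrix_inv \<gamma>0 ** \<gamma>)"
      using 0 sub(1)[OF \<Gamma>(1)] by (simp add: matrix_mul_assoc matrix_inv_right)
    ultimately show ?case by (intro exI[of _ "[matrix_inv \<gamma>0 ** \<gamma>]"]) simp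
  next
    case (Suc m)
    define g0 where "g0 = \<gamma>0 ** c0 ** h0"
    have g0: "g0 \<in> G" unfolding g0_def using Suc.prems \<Gamma>(2) H(2) by (intro G_mult) (auto simp: tball_def)
    obtain \<gamma>1 c1 h1 where 1: "\<gamma>1 \<in> \<Gamma>" "c1 \<in> tball n0" "h1 \<in> H" "g0 = \<gamma>1 ** c1 ** h1"
      using cover[OF g0] by blast
    have s: "matrix_inv \<gamma>0 ** \<gamma>1 \<in> P"
      using Suc.prems 1 n1(3) by (intro P_intro[of \<gamma>0 \<gamma>1 c0 c1 h0 h1]) (auto simp: g0_def)
    have "matrix_inv \<gamma> ** g0 \<in> G" using g0 Suc.prems \<Gamma>(2) by (intro G_mult G_inv) auto
    from descent[OF this, of h1] obtain u where u: "u \<in> U"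
      "\<rho> (matrix_inv \<gamma> ** g0 ** matrix_inv h1 ** u ** h1) \<le> max R (\<rho> (matrix_inv \<gamma> ** g0) - \<epsilon>)"
      using 1(3) H(2) by (auto simp: U_def)
    have "invertible h1" using 1(3) sub(1)[OF H(1)] by blast
    have "g0 ** matrix_inv h1 = \<gamma>1 ** c1 ** (h1 ** matrix_inv h1)" unfolding 1(4) by (simp only: matrix_mul_assoc)
    then have eq: "matrix_inv \<gamma> ** g0 ** matrix_inv h1 ** u ** h1 = matrix_inv \<gamma> ** (\<gamma>1 ** (c1 ** u) ** h1)"
      using matrix_inv_right[OF \<open>invertible h1\<close>] by (simp flip: matrix_mul_assoc)
    have "max R (\<rho> (matrix_inv \<gamma> ** g0) - \<epsilon>) \<le> R + real m * \<epsilon>"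
      using Suc.prems(5) \<epsilon> by (auto simp: g0_def algebra_simps)
    then have "\<rho> (matrix_inv \<gamma> ** (\<gamma>1 ** (c1 ** u) ** h1)) \<le> R + real m * \<epsilon>" using u(2) unfolding eq by linarith
    moreover have "c1 ** u \<in> tball n1" using n1(2) 1(2) u(1) by (auto simp: V_def)
    ultimately obtain ws where ws: "set ws \<subseteq> P" "length ws \<le> Suc m" "\<gamma> = \<gamma>1 ** foldr (**) ws (mat 1)"
      using Suc.IH[OF Suc.prems(1) 1(1) _ 1(3)] by blast
    have "\<gamma>1 = \<gamma>0 ** (matrix_inv \<gamma>0 ** \<gamma>1)"
      using Suc.prems(2) sub(1)[OF \<Gamma>(1)] by (simp add: matrix_mul_assoc matrix_inv_right)
    then have "\<gamma> = \<gamma>0 ** foldr (**) ((matrix_inv \<gamma>0 ** \<gamma>1) # ws) (mat 1)"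
      using ws(3) by (simp add: matrix_mul_assoc)
    then show ?case using s ws by (intro exI[of _ "(matrix_inv \<gamma>0 ** \<gamma>1) # ws"]) simp
  qed
  show ?thesis
  proof
    show "finite P" unfolding P_def by (rule proper)
    show "P \<subseteq> \<Gamma>" by (auto simp: P_def)
    show "1 / \<epsilon> > 0" using \<epsilon> by simp
    show "\<bar>R\<bar> / \<epsilon> + 2 > 0" using \<epsilon> by (simp add: add_nonneg_pos)
    fix \<gamma> k h g assume a: "\<gamma> \<in> \<Gamma>" "k \<in> KK" "h \<in> H" "g \<in> G" "\<gamma> = k ** h ** g"
    have kh: "invertible (k ** h)" using a H(2) KK_group(1) G_invertible by (intro invertible_mult) auto
    have gi: "invertible g" using a G_invertible by blast
    \<comment> \<open>The start is \<open>\<gamma>0 = mat 1\<close>, \<open>c0 = k\<close> and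
      \<open>h0 = h\<close>; its measure is \<open>\<rho> g\<close> since \<open>\<tau>\<close> is
      invariant under inversion.\<close>
    have "matrix_inv \<gamma> ** (mat 1 ** k ** h) = matrix_inv g ** (matrix_inv (k ** h) ** (k ** h))"
      unfolding a(5) matrix_inv_mult[OF kh gi] by (simp add: matrix_mul_assoc)
    then have "matrix_inv \<gamma> ** (mat 1 ** k ** h) = matrix_inv g" by (simp add: matrix_inv_left[OF kh])
    then have \<rho>g: "\<rho> (matrix_inv \<gamma> ** (mat 1 ** k ** h)) = \<rho> g" by (simp add: \<rho>_def \<tau>_matrix_inv[OF gi])
    define m where "m = nat \<lceil>(\<rho> g - R) / \<epsilon>\<rceil>"
    have "(\<rho> g - R) / \<epsilon> \<le> real m" unfolding m_def by (rule real_nat_ceiling_ge)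
    then have "\<rho> g \<le> R + real m * \<epsilon>" using \<epsilon> by (simp add: field_simps)
    then obtain ws where ws: "set ws \<subseteq> P" "length ws \<le> Suc m" "\<gamma> = mat 1 ** foldr (**) ws (mat 1)"
      using step[OF a(1) sub(2)[OF \<Gamma>(1)], of k h m] a(2,3) n1(1) \<rho>g by (metis subsetD)
    have "real m \<le> \<bar>(\<rho> g - R) / \<epsilon>\<bar> + 1" unfolding m_def by linarith
    also have "\<bar>(\<rho> g - R) / \<epsilon>\<bar> \<le> (\<rho> g + \<bar>R\<bar>) / \<epsilon>"
      using \<rho>_nonneg[OF a(4)] \<epsilon> by (simp add: divide_right_mono)
    finally have "real (Suc m) \<le> 1 / \<epsilon> * \<rho> g + (\<bar>R\<bar> / \<epsilon> + 2)" by (simp add: add_divide_distrib)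
    then have "real (length ws) \<le> 1 / \<epsilon> * \<rho> g + (\<bar>R\<bar> / \<epsilon> + 2)" using ws(2) by linarith
    then show "\<exists>ws. set ws \<subseteq> P \<and> real (length ws) \<le> 1 / \<epsilon> * \<rho> g + (\<bar>R\<bar> / \<epsilon> + 2) \<and> \<gamma> = foldr (**) ws (mat 1)"
      using ws by auto
  qed
qed

text \<open>\<open>\<rho>\<close> is subadditive up to a constant, which is charged to each letter.
  The bound is the passage from word length to the norm of the Cartan projection in the proof of
  sharpness.\<close>

lemma \<rho>_word_le:
  assumes "finite P" "P \<subseteq> G"
  obtains a b where "a > 0" "b > 0" "\<And>ws. set ws \<subseteq> P \<Longrightarrow> \<rho> (foldr (**) ws (mat 1)) \<le> a * real (length ws) + b"
proof -
  obtain c where c: "c \<ge> 0" "\<And>g h. invertible g \<Longrightarrow> invertible h \<Longrightarrow> \<rho> (g ** h) \<le> \<rho> g + \<rho> h + c"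
    using \<rho>_mult_le by auto
  define M where "M = (\<Sum>p\<in>P. \<rho> p) + c + 1"
  have nn: "\<rho> p \<ge> 0" if "p \<in> P" for p using that assms \<rho>_nonneg by blast
  have M: "M > 0" unfolding M_def using c sum_nonneg[of P \<rho>] nn by (simp add: add_nonneg_pos)
  have pM: "\<rho> p + c \<le> M" if "p \<in> P" for p
    using member_le_sum[OF that, of \<rho>] nn assms(1) by (auto simp: M_def)
  have "\<rho> (foldr (**) ws (mat 1)) \<le> M * real (length ws) + (\<rho> (mat 1) + 1)" if "set ws \<subseteq> P" for ws
    using that
  proof (induction ws)
    case (Cons w ws)
    have "foldr (**) ws (mat 1) \<in> G" using Cons.prems assms(2)
      by (induction ws) (auto intro: G_one G_mult)
    then have "\<rho> (w ** foldr (**) ws (mat 1)) \<le> \<rho> w + \<rho> (foldr (**) ws (mat 1)) + c"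
      using Cons.prems assms(2) G_invertible by (intro c) auto
    also have "\<dots> \<le> M + (M * real (length ws) + (\<rho> (mat 1) + 1))"
      using Cons pM[of w] by auto
    finally show ?case by (simp add: algebra_simps)
  qed simp
  moreover have "\<rho> (mat 1) + 1 > 0" using \<rho>_nonneg[OF G_one] by simp
  ultimately show ?thesis using that M by blast
qed

end

section \<open>Words, coset spaces and the main estimate\<close>

context group begin

lemma foldr_mult_closed: "set ws \<subseteq> carrier G \<Longrightarrow> foldr (mult G) ws \<one> \<in> carrier G"
  by (induction ws) auto

lemma foldr_mult_append:
  "set us \<subseteq> carrier G \<Longrightarrow> set vs \<subseteq> carrier G \<Longrightarrow>
    foldr (mult G) (us @ vs) \<one> = foldr (mult G) us \<one> \<otimes> foldr (mult G) vs \<one>"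
  by (induction us) (auto simp: foldr_mult_closed m_assoc simp del: foldr_append)

lemma generating_set_word:
  assumes "generating_set G X" "g \<in> carrier G"
  shows "\<exists>ws. set ws \<subseteq> X \<union> m_inv G ` X \<and> g = foldr (mult G) ws \<one>"
proof -
  have X: "X \<subseteq> carrier G" "generate G X = carrier G" using assms by (auto simp: generating_set_def)
  then have XX: "X \<union> m_inv G ` X \<subseteq> carrier G" by auto
  have "g \<in> generate G X" using assms X by simp
  then show ?thesis
  proof (induction rule: generate.induct)
    case one
    show ?case by (rule exI[of _ "[]"]) simp
  next
    case (incl h)
    then show ?case using X by (intro exI[of _ "[h]"]) auto
  next
    case (inv h)
    then show ?case using X by (intro exI[of _ "[inv h]"]) auto
  next
    case (eng g h)
    then obtain us vs where us: "set us \<subseteq> X \<union> m_inv G ` X" "g = foldr (mult G) us \<one>"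
      and vs: "set vs \<subseteq> X \<union> m_inv G ` X" "h = foldr (mult G) vs \<one>" by blast
    have "foldr (mult G) (us @ vs) \<one> = g \<otimes> h"
      unfolding us(2) vs(2) using us(1) vs(1) XX by (intro foldr_mult_append) auto
    then show ?case using us(1) vs(1) by (intro exI[of _ "us @ vs"]) auto
  qed
qed

text \<open>Each letter of \<open>P\<close> is spelled out in the generators \<open>X\<close>; the
  sum of the lengths of these spellings serves as a common bound \<open>l\<close>.\<close>

lemma word_length_le_length:
  assumes X: "generating_set G X" and P: "finite P" "P \<subseteq> carrier G"
  shows "\<exists>l. \<forall>ps. set ps \<subseteq> P \<longrightarrow> word_length G X (foldr (mult G) ps \<one>) \<le> l * length ps"
proof -
  have XX: "X \<union> m_inv G ` X \<subseteq> carrier G" using X by (auto simp: generating_set_def)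
  have "\<forall>p\<in>P. \<exists>ws. set ws \<subseteq> X \<union> m_inv G ` X \<and> p = foldr (mult G) ws \<one>"
    using generating_set_word[OF X] P by blast
  then obtain w where w: "\<And>p. p \<in> P \<Longrightarrow> set (w p) \<subseteq> X \<union> m_inv G ` X" "\<And>p. p \<in> P \<Longrightarrow> p = foldr (mult G) (w p) \<one>"
    by metis
  define l where "l = (\<Sum>p\<in>P. length (w p))"
  have l: "length (w p) \<le> l" if "p \<in> P" for p
    unfolding l_def using P that by (intro member_le_sum) auto
  have "\<exists>ws. set ws \<subseteq> X \<union> m_inv G ` X \<and> foldr (mult G) ps \<one> = foldr (mult G) ws \<one> \<and> length ws \<le> l * length ps"
    if "set ps \<subseteq> P" for ps
    using that
  proof (induction ps)
    case (Cons p ps)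
    then obtain ws where ws: "set ws \<subseteq> X \<union> m_inv G ` X" "foldr (mult G) ps \<one> = foldr (mult G) ws \<one>"
      "length ws \<le> l * length ps" by auto
    have p: "p \<in> P" using Cons.prems by simp
    have "foldr (mult G) (w p @ ws) \<one> = p \<otimes> foldr (mult G) ws \<one>"
      using foldr_mult_append[of "w p" ws] w[OF p] ws(1) XX by (metis order_trans)
    then show ?case using ws w(1)[OF p] l[OF p] by (intro exI[of _ "w p @ ws"]) auto
  qed auto
  note words = this
  have "word_length G X (foldr (mult G) ps \<one>) \<le> l * length ps" if ps: "set ps \<subseteq> P" for ps
  proof -
    obtain ws where ws: "set ws \<subseteq> X \<union> m_inv G ` X" "foldr (mult G) ps \<one> = foldr (mult G) ws \<one>"
      "length ws \<le> l * length ps"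
      using words[OF ps] by blast
    have "word_length G X (foldr (mult G) ps \<one>) \<le> length ws"
      unfolding word_length_def by (rule Least_le) (use ws in blast)
    with ws(3) show ?thesis by simp
  qed
  then show ?thesis by blast
qed

end

lemma inner_product_norm_equivalence:
  fixes B :: "'a::euclidean_space \<Rightarrow> 'a \<Rightarrow> real"
  assumes "inner_product B"
  shows "\<exists>c>0. \<forall>X. sqrt (B X X) \<le> c * norm X \<and> norm X \<le> c * sqrt (B X X)"
proof -
  have bil: "bilinear B" and pos: "\<And>X. X \<noteq> 0 \<Longrightarrow> B X X > 0" using assms by (auto simp: inner_product_def)
  have bb: "bounded_bilinear B" using bil by (simp add: bilinear_conv_bounded_bilinear)
  obtain K where K: "K > 0" "\<And>X Y. norm (B X Y) \<le> norm X * norm Y * K"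
    using bounded_bilinear.pos_bounded[OF bb] by auto
  have up: "sqrt (B X X) \<le> sqrt K * norm X" for X
  proof -
    have "B X X \<le> K * (norm X)\<^sup>2" using K(2)[of X X] by (simp add: power2_eq_square mult_ac)
    then have "sqrt (B X X) \<le> sqrt (K * (norm X)\<^sup>2)" by (rule real_sqrt_le_mono)
    then show ?thesis by (simp add: real_sqrt_mult)
  qed
  have cont: "continuous_on (sphere 0 1) (\<lambda>X. B X X)"
    by (intro bounded_bilinear.continuous_on[OF bb] continuous_on_id)
  have "sphere (0::'a) 1 \<noteq> {}" by simp
  from continuous_attains_inf[OF compact_sphere this cont] obtain X0 where X0: "X0 \<in> sphere 0 1"
    and min: "\<And>X. X \<in> sphere 0 1 \<Longrightarrow> B X0 X0 \<le> B X X" by auto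
  define m where "m = B X0 X0"
  have "X0 \<noteq> 0" using X0 by auto
  then have m: "m > 0" unfolding m_def by (rule pos)
  have low: "norm X \<le> (1 / sqrt m) * sqrt (B X X)" for X
  proof (cases "X = 0")
    case False
    have "m \<le> B ((1 / norm X) *\<^sub>R X) ((1 / norm X) *\<^sub>R X)" unfolding m_def by (rule min) (simp add: False)
    also have "\<dots> = B X X / (norm X)\<^sup>2"
      by (simp add: bilinear_lmul[OF bil] bilinear_rmul[OF bil] power2_eq_square)
    finally have "m * (norm X)\<^sup>2 \<le> B X X" using False by (simp add: field_simps)
    then have "sqrt (m * (norm X)\<^sup>2) \<le> sqrt (B X X)" by (rule real_sqrt_le_mono)
    then show ?thesis using m by (simp add: real_sqrt_mult field_simps)
  qed (simp add: bilinear_lzero[OF bil])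
  define c where "c = max (sqrt K) (1 / sqrt m)"
  have sq: "sqrt (B X X) \<ge> 0" for X using pos[of X] by (cases "X = 0") (auto simp: bilinear_lzero[OF bil])
  have "sqrt (B X X) \<le> c * norm X \<and> norm X \<le> c * sqrt (B X X)" for X
    using order_trans[OF up[of X] mult_right_mono[of "sqrt K" c "norm X"]]
      order_trans[OF low[of X] mult_right_mono[of "1 / sqrt m" c "sqrt (B X X)"]] sq[of X]
    by (auto simp: c_def)
  moreover have "c > 0" using K(1) by (simp add: c_def less_max_iff_disj)
  ultimately show ?thesis by blast
qed

lemma (in adjoint) inner_product_ip: "inner_product ip"
proof -
  have right: "ip X (Y + Z) = ip X Y + ip X Z" for X Y Z
    using ip_add_left[of Y Z X] by (simp only: ip_commute[of X])
  show ?thesis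
    unfolding inner_product_def bilinear_def linear_iff
    by (intro conjI allI impI ip_commute ip_pos; simp add: right ip_add_left ip_scaleR_left ip_scaleR_right)
qed

lemma l_coset_matgrp: "g <#\<^bsub>matgrp G\<^esub> D = (\<lambda>h. g ** h) ` D"
  by (auto simp: l_coset_def)

lemma l_coset_assoc: "g <#\<^bsub>matgrp G\<^esub> (k <#\<^bsub>matgrp G\<^esub> D) = (g ** k) <#\<^bsub>matgrp G\<^esub> D"
  by (simp add: l_coset_matgrp image_image matrix_mul_assoc)

lemma l_coset_absorb:
  assumes H: "subgroup H (matgrp GL)" and h: "h \<in> H"
  shows "(g ** h) <#\<^bsub>matgrp G\<^esub> H = g <#\<^bsub>matgrp G\<^esub> H"
proof -
  note sub = subgroup_matgrp_GL[OF H]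
  have "(**) h ` H = H"
  proof
    show "(**) h ` H \<subseteq> H" using sub(3) h by auto
    show "H \<subseteq> (**) h ` H"
    proof
      fix x assume "x \<in> H"
      moreover have "x = h ** (matrix_inv h ** x)"
        by (simp add: matrix_mul_assoc matrix_inv_right sub(1)[OF h])
      ultimately show "x \<in> (**) h ` H" using sub(3,4) h by blast
    qed
  qed
  moreover have "(g ** h) <#\<^bsub>matgrp G\<^esub> H = (**) g ` ((**) h ` H)"
    by (simp add: l_coset_matgrp image_image matrix_mul_assoc)
  ultimately show ?thesis by (simp add: l_coset_matgrp)
qed

lemma continuous_map_coset_space:
  "continuous_map (top_of_set G) (coset_space G H) (\<lambda>g. g <#\<^bsub>matgrp G\<^esub> H)"
  unfolding coset_space_def by (rule quotient_imp_continuous_map[OF quotient_map_quotient_topology])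

context weyl_chamber begin

text \<open>The image of \<open>tball n\<close> in the coset space is compact, and each such
  \<open>\<gamma>\<close> moves some point of it to a point of it.\<close>

lemma properly_discontinuous_finite:
  assumes H: "subgroup H (matgrp GL)"
    and pd: "properly_discontinuous (matgrp \<Gamma>) (\<lambda>\<gamma> D. \<gamma> <#\<^bsub>matgrp G\<^esub> D) (coset_space G H)"
  shows "finite {\<gamma> \<in> \<Gamma>. \<exists>c\<in>tball n. \<exists>c'\<in>tball n. \<exists>h\<in>H. \<exists>h'\<in>H. \<gamma> ** c ** h = c' ** h'}"
proof -
  define D where "D = (\<lambda>g. g <#\<^bsub>matgrp G\<^esub> H) ` tball n"
  have "compactin (top_of_set G) (tball n)"
    by (simp add: compactin_subtopology compact_tball) (auto simp: tball_def)
  then have "compactin (coset_space G H) D"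
    unfolding D_def by (rule image_compactin[OF _ continuous_map_coset_space])
  then have "finite {\<gamma> \<in> \<Gamma>. (\<lambda>D. \<gamma> <#\<^bsub>matgrp G\<^esub> D) ` D \<inter> D \<noteq> {}}"
    using pd unfolding properly_discontinuous_def by simp
  moreover have "{\<gamma> \<in> \<Gamma>. \<exists>c\<in>tball n. \<exists>c'\<in>tball n. \<exists>h\<in>H. \<exists>h'\<in>H. \<gamma> ** c ** h = c' ** h'}
      \<subseteq> {\<gamma> \<in> \<Gamma>. (\<lambda>D. \<gamma> <#\<^bsub>matgrp G\<^esub> D) ` D \<inter> D \<noteq> {}}"
  proof safe
    fix \<gamma> c c' h h'
    assume a: "c \<in> tball n" "c' \<in> tball n" "h \<in> H" "h' \<in> H" "\<gamma> ** c ** h = c' ** h'"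
      and e: "(\<lambda>D. \<gamma> <#\<^bsub>matgrp G\<^esub> D) ` D \<inter> D = {}"
    have "\<gamma> <#\<^bsub>matgrp G\<^esub> (c <#\<^bsub>matgrp G\<^esub> H) = (\<gamma> ** c ** h) <#\<^bsub>matgrp G\<^esub> H"
      by (simp add: l_coset_assoc l_coset_absorb[OF H a(3)])
    also have "\<dots> = c' <#\<^bsub>matgrp G\<^esub> H" unfolding a(5) by (rule l_coset_absorb[OF H a(4)])
    finally have "\<gamma> <#\<^bsub>matgrp G\<^esub> (c <#\<^bsub>matgrp G\<^esub> H) \<in> D" using a(2) by (simp add: D_def)
    moreover have "c <#\<^bsub>matgrp G\<^esub> H \<in> D" using a(1) by (simp add: D_def)
    ultimately show False using e by blast
  qed
  ultimately show ?thesis by (rule rev_finite_subset)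
qed

text \<open>The sublevel sets of \<open>\<tau>\<close> exhaust \<open>G\<close> and have open images
  in the double quotient, so compactness of the latter selects finitely many, of which the largest
  suffices.\<close>

lemma cocompact_cover:
  assumes H: "subgroup H (matgrp GL)" "H \<subseteq> G" and \<Gamma>: "subgroup \<Gamma> (matgrp GL)" "\<Gamma> \<subseteq> G"
    and cc: "cocompact (matgrp \<Gamma>) (\<lambda>\<gamma> D. \<gamma> <#\<^bsub>matgrp G\<^esub> D) (coset_space G H)"
  shows "\<exists>n. \<forall>g\<in>G. \<exists>\<gamma>\<in>\<Gamma>. \<exists>c\<in>tball n. \<exists>h\<in>H. g = \<gamma> ** c ** h"
proof -
  note sH = subgroup_matgrp_GL[OF H(1)] and s\<Gamma> = subgroup_matgrp_GL[OF \<Gamma>(1)]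
  define \<pi> where "\<pi> g = g <#\<^bsub>matgrp G\<^esub> H" for g
  define orb where "orb = orbit (matgrp \<Gamma>) (\<lambda>\<gamma> D. \<gamma> <#\<^bsub>matgrp G\<^esub> D)"
  have orb: "orb (\<pi> g) = {\<pi> (\<gamma> ** g) | \<gamma>. \<gamma> \<in> \<Gamma>}" for g
    by (auto simp: orb_def orbit_def \<pi>_def l_coset_assoc)
  have top1: "topspace (coset_space G H) = \<pi> ` G"
    by (simp add: coset_space_def topspace_quotient_topology \<pi>_def[abs_def])
  define Y where "Y = quotient_topology (coset_space G H) orb"
  have topY: "topspace Y = orb ` \<pi> ` G" by (simp add: Y_def topspace_quotient_topology top1)
  have compactY: "compactin Y (topspace Y)"
    using cc by (simp add: cocompact_def Y_def orb_def compact_space_def)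
  have orb_eq: "(orb (\<pi> g) = orb (\<pi> g')) \<longleftrightarrow> (\<exists>\<gamma>\<in>\<Gamma>. \<exists>h\<in>H. g = \<gamma> ** g' ** h)" for g g'
  proof
    assume eq: "orb (\<pi> g) = orb (\<pi> g')"
    have "\<pi> (mat 1 ** g) \<in> orb (\<pi> g)" unfolding orb using s\<Gamma>(2) by blast
    then obtain \<gamma> where \<gamma>: "\<gamma> \<in> \<Gamma>" "\<pi> g = \<pi> (\<gamma> ** g')" unfolding eq unfolding orb by auto
    have "g ** mat 1 \<in> \<pi> g" unfolding \<pi>_def l_coset_matgrp using sH(2) by blast
    then obtain h where "h \<in> H" "g = \<gamma> ** g' ** h" unfolding \<gamma>(2) by (auto simp: \<pi>_def l_coset_matgrp)
    with \<gamma> show "\<exists>\<gamma>\<in>\<Gamma>. \<exists>h\<in>H. g = \<gamma> ** g' ** h" by blast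
  next
    assume "\<exists>\<gamma>\<in>\<Gamma>. \<exists>h\<in>H. g = \<gamma> ** g' ** h"
    then obtain \<gamma> h where g: "\<gamma> \<in> \<Gamma>" "h \<in> H" "g = \<gamma> ** g' ** h" by blast
    have \<pi>g: "\<pi> (\<eta> ** g) = \<pi> (\<eta> ** \<gamma> ** g')" for \<eta>
      using l_coset_absorb[OF H(1) g(2), of G "\<eta> ** \<gamma> ** g'"] by (simp add: \<pi>_def g(3) matrix_mul_assoc)
    show "orb (\<pi> g) = orb (\<pi> g')"
    proof
      show "orb (\<pi> g) \<subseteq> orb (\<pi> g')" unfolding orb \<pi>g using s\<Gamma>(3) g(1) by blast
      show "orb (\<pi> g') \<subseteq> orb (\<pi> g)"
      proof
        fix x assume "x \<in> orb (\<pi> g')"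
        then obtain \<eta> where \<eta>: "\<eta> \<in> \<Gamma>" "x = \<pi> (\<eta> ** g')" unfolding orb by blast
        have "\<eta> ** matrix_inv \<gamma> ** \<gamma> = \<eta>"
          using matrix_inv_left[OF s\<Gamma>(1)[OF g(1)]] by (simp flip: matrix_mul_assoc)
        then have "x = \<pi> ((\<eta> ** matrix_inv \<gamma>) ** g)" unfolding \<pi>g by (simp add: \<eta>(2))
        then show "x \<in> orb (\<pi> g)" unfolding orb using \<eta>(1) s\<Gamma>(3,4) g(1) by blast
      qed
    qed
  qed
  define V where "V n = {g \<in> G. \<tau> g < real n}" for n :: nat
  define O' where "O' n = orb ` \<pi> ` V n" for n
  have openO: "openin Y (O' n)" for n
  proof -
    \<comment> \<open>The saturation of \<open>V n\<close> under \<open>\<Gamma>\<close> and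
      \<open>H\<close>, written as a union of translates. Its openness in \<open>G\<close> is what
      the two quotient topologies together ask of \<open>O' n\<close>.\<close>
    define W where "W = (\<Union>(\<gamma>, h) \<in> \<Gamma> \<times> H. G \<inter> (\<lambda>g. \<tau> (matrix_inv \<gamma> ** g ** matrix_inv h)) -` {..<real n})"
    have "openin (top_of_set G) W" unfolding W_def
    proof (rule openin_Union, safe)
      fix \<gamma> h assume "\<gamma> \<in> \<Gamma>" "h \<in> H"
      then have "continuous_on G (\<lambda>g. \<tau> (matrix_inv \<gamma> ** g ** matrix_inv h))"
        using \<Gamma>(2) H(2) G_invertible G_inv by (intro \<tau>_continuous invertible_mult) auto
      then show "openin (top_of_set G) (G \<inter> (\<lambda>g. \<tau> (matrix_inv \<gamma> ** g ** matrix_inv h)) -` {..<real n})"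
        by (rule continuous_openin_preimage_gen) simp
    qed
    moreover have "W = {g \<in> G. \<pi> g \<in> {x \<in> \<pi> ` G. orb x \<in> O' n}}"
    proof (rule subset_antisym; rule subsetI)
      fix g assume "g \<in> W"
      then obtain \<gamma> h where g: "g \<in> G" "\<gamma> \<in> \<Gamma>" "h \<in> H" "\<tau> (matrix_inv \<gamma> ** g ** matrix_inv h) < real n"
        by (auto simp: W_def)
      define g' where "g' = matrix_inv \<gamma> ** g ** matrix_inv h"
      have "\<gamma> ** g' ** h = (\<gamma> ** matrix_inv \<gamma>) ** g ** (matrix_inv h ** h)"
        by (simp only: g'_def matrix_mul_assoc)
      then have "g = \<gamma> ** g' ** h"
        using matrix_inv_right[OF s\<Gamma>(1)[OF g(2)]] matrix_inv_left[OF sH(1)[OF g(3)]] by simp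
      then have "orb (\<pi> g) = orb (\<pi> g')" unfolding orb_eq using g by blast
      moreover have "g' \<in> V n" using g \<Gamma>(2) H(2) by (auto simp: V_def g'_def intro!: G_mult G_inv)
      ultimately show "g \<in> {g \<in> G. \<pi> g \<in> {x \<in> \<pi> ` G. orb x \<in> O' n}}" using g(1) by (auto simp: O'_def)
    next
      fix g assume "g \<in> {g \<in> G. \<pi> g \<in> {x \<in> \<pi> ` G. orb x \<in> O' n}}"
      then obtain g' where g: "g \<in> G" "g' \<in> V n" "orb (\<pi> g) = orb (\<pi> g')" by (auto simp: O'_def)
      then obtain \<gamma> h where h: "\<gamma> \<in> \<Gamma>" "h \<in> H" "g = \<gamma> ** g' ** h" unfolding orb_eq by blast
      have "matrix_inv \<gamma> ** g ** matrix_inv h = (matrix_inv \<gamma> ** \<gamma>) ** g' ** (h ** matrix_inv h)"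
        by (simp only: h(3) matrix_mul_assoc)
      then have "matrix_inv \<gamma> ** g ** matrix_inv h = g'"
        using matrix_inv_left[OF s\<Gamma>(1)[OF h(1)]] matrix_inv_right[OF sH(1)[OF h(2)]] by simp
      then have "\<tau> (matrix_inv \<gamma> ** g ** matrix_inv h) < real n" using g(2) by (simp add: V_def)
      then show "g \<in> W" unfolding W_def using g(1) h(1,2) by blast
    qed
    ultimately have "openin (coset_space G H) {x \<in> topspace (coset_space G H). orb x \<in> O' n}"
      by (simp add: coset_space_def openin_quotient_topology topspace_quotient_topology \<pi>_def[abs_def] Collect_restrict)
    moreover have "O' n \<subseteq> orb ` topspace (coset_space G H)" by (auto simp: O'_def top1 V_def)
    ultimately show ?thesis by (simp add: Y_def openin_quotient_topology)
  qed
  have cover: "topspace Y \<subseteq> \<Union> (range O')"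
  proof -
    have "orb (\<pi> g) \<in> \<Union> (range O')" if "g \<in> G" for g
    proof -
      obtain n :: nat where "\<tau> g < real n" using reals_Archimedean2 by blast
      then show ?thesis using that by (auto simp: O'_def V_def)
    qed
    then show ?thesis unfolding topY by auto
  qed
  obtain \<F> where "finite \<F>" "\<F> \<subseteq> range O'" "topspace Y \<subseteq> \<Union> \<F>"
    using compactinD[OF compactY _ cover] openO by auto
  then obtain I where I: "finite I" "topspace Y \<subseteq> \<Union> (O' ` I)"
    by (metis finite_subset_image)
  \<comment> \<open>The inserted 0 keeps the maximum defined when \<open>I\<close> is empty.\<close>
  define n where "n = Max (insert 0 I)"
  have "\<exists>\<gamma>\<in>\<Gamma>. \<exists>c\<in>tball (real n). \<exists>h\<in>H. g = \<gamma> ** c ** h" if "g \<in> G" for g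
  proof -
    have "orb (\<pi> g) \<in> topspace Y" using that by (auto simp: topY)
    then obtain i where i: "i \<in> I" "orb (\<pi> g) \<in> O' i" using I by blast
    then obtain c where c: "c \<in> V i" "orb (\<pi> g) = orb (\<pi> c)" by (auto simp: O'_def)
    have "i \<le> n" unfolding n_def using I(1) i(1) by (intro Max_ge) auto
    then have "c \<in> tball (real n)" using c(1) by (auto simp: V_def tball_def)
    with c(2) show ?thesis unfolding orb_eq by blast
  qed
  then show ?thesis by blast
qed

text \<open>\<open>Z\<close> and \<open>W\<close> commute, so
  \<open>mexp Z = mexp W ** mexp (Z - W)\<close>. Hence \<open>\<gamma>\<close> is
  \<open>(k ** star k') ** h ** g\<close> with \<open>g = star l' ** mexp (Z - W) ** l\<close>,
  whose size is governed by \<open>Z - W\<close>.\<close>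

lemma cartan_word_bound:
  assumes \<Gamma>: "subgroup \<Gamma> (matgrp GL)" "\<Gamma> \<subseteq> G" and H: "subgroup H (matgrp GL)" "H \<subseteq> G"
    and pd: "properly_discontinuous (matgrp \<Gamma>) (\<lambda>\<gamma> D. \<gamma> <#\<^bsub>matgrp G\<^esub> D) (coset_space G H)"
    and cc: "cocompact (matgrp \<Gamma>) (\<lambda>\<gamma> D. \<gamma> <#\<^bsub>matgrp G\<^esub> D) (coset_space G H)"
  obtains P a b where "finite P" "P \<subseteq> \<Gamma>" "a > 0" "b > 0"
    "\<And>\<gamma> h Z W k l k' l'. \<gamma> \<in> \<Gamma> \<Longrightarrow> h \<in> H \<Longrightarrow> Z \<in> A \<Longrightarrow> W \<in> A \<Longrightarrow> k \<in> KK \<Longrightarrow> l \<in> KK \<Longrightarrow> k' \<in> KK \<Longrightarrow> l' \<in> KK \<Longrightarrow>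
      \<gamma> = k ** mexp Z ** l \<Longrightarrow> h = k' ** mexp W ** l' \<Longrightarrow>
      \<exists>ws. set ws \<subseteq> P \<and> real (length ws) \<le> a * sqrt (ip (Z - W) (Z - W)) + b \<and> \<gamma> = foldr (**) ws (mat 1)"
proof -
  obtain n where n: "\<And>g. g \<in> G \<Longrightarrow> \<exists>\<gamma>\<in>\<Gamma>. \<exists>c\<in>tball n. \<exists>h\<in>H. g = \<gamma> ** c ** h"
    using cocompact_cover[OF H \<Gamma> cc] by blast
  obtain P a b where P: "finite P" "P \<subseteq> \<Gamma>" and ab: "a > 0" "b > 0"
    and words: "\<And>\<gamma> k h g. \<gamma> \<in> \<Gamma> \<Longrightarrow> k \<in> KK \<Longrightarrow> h \<in> H \<Longrightarrow> g \<in> G \<Longrightarrow> \<gamma> = k ** h ** g \<Longrightarrow>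
      \<exists>ws. set ws \<subseteq> P \<and> real (length ws) \<le> a * \<rho> g + b \<and> \<gamma> = foldr (**) ws (mat 1)"
    using word_bound[OF \<Gamma> H n properly_discontinuous_finite[OF H(1) pd]] by metis
  define e where "e = ln (2 * real CARD('n))"
  have "real CARD('n) \<ge> 1" by (simp add: Suc_le_eq)
  then have "2 * real CARD('n) \<ge> 1" by linarith
  then have e: "e \<ge> 0" unfolding e_def by (rule ln_ge_zero)
  show ?thesis
  proof
    show "finite P" "P \<subseteq> \<Gamma>" by (rule P)+
    show "2 * a > 0" "a * e + b > 0" using ab e by (auto intro: add_nonneg_pos)
    fix \<gamma> h Z W k l k' l'
    assume \<gamma>: "\<gamma> \<in> \<Gamma>" "h \<in> H" and ZW: "Z \<in> A" "W \<in> A" and kk: "k \<in> KK" "l \<in> KK" "k' \<in> KK" "l' \<in> KK"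
      and eq: "\<gamma> = k ** mexp Z ** l" "h = k' ** mexp W ** l'"
    define g where "g = star l' ** mexp (Z - W) ** l"
    have ZWA: "Z - W \<in> A" using ZW A_subspace by (intro subspace_diff)
    have gG: "g \<in> G" unfolding g_def
      using kk KK_group(1,4) ZWA by (intro G_mult lie_mexp A_lie) auto
    have eZ: "mexp W ** mexp (Z - W) = mexp Z"
      using mexp_add_commuting[of W "Z - W"] A_commute[OF ZW(2) ZWA] by simp
    have "(k ** star k') ** h ** g = k ** (star k' ** k') ** mexp W ** (l' ** star l') ** mexp (Z - W) ** l"
      by (simp only: eq(2) g_def matrix_mul_assoc)
    also have "\<dots> = k ** (mexp W ** mexp (Z - W)) ** l"
      by (simp add: KK_group(2)[OF kk(3)] KK_group(3)[OF kk(4)] matrix_mul_assoc)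
    finally have "\<gamma> = (k ** star k') ** h ** g" by (simp add: eZ eq(1))
    from words[OF \<gamma>(1) KK_mult[OF kk(1) KK_group(4)[OF kk(3)]] \<gamma>(2) gG this]
    obtain ws where ws: "set ws \<subseteq> P" "real (length ws) \<le> a * \<rho> g + b" "\<gamma> = foldr (**) ws (mat 1)" by blast
    have "\<rho> g \<le> e + 2 * sqrt (ip (Z - W) (Z - W))"
      unfolding g_def e_def by (rule \<rho>_cartan_le[OF A_star[OF ZWA] KK_group(4)[OF kk(4)] kk(2)])
    then have "a * \<rho> g + b \<le> a * (e + 2 * sqrt (ip (Z - W) (Z - W))) + b" using ab by simp
    then have "real (length ws) \<le> 2 * a * sqrt (ip (Z - W) (Z - W)) + (a * e + b)"
      using ws(2) by (simp add: algebra_simps)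
    with ws show "\<exists>ws. set ws \<subseteq> P \<and> real (length ws) \<le> 2 * a * sqrt (ip (Z - W) (Z - W)) + (a * e + b) \<and>
      \<gamma> = foldr (**) ws (mat 1)" by blast
  qed
qed

end

theorem theorem1p5:
  fixes G H \<Gamma> :: "(real^'n^'n) set"
    and \<Theta> :: "real^'n^'n \<Rightarrow> real^'n^'n"
    and A Ap :: "(real^'n^'n) set"
    and N :: "real^'n^'n \<Rightarrow> real"
    and \<mu> :: "real^'n^'n \<Rightarrow> real^'n^'n"
  assumes "linear_reductive G" and "connected G"
    and "cartan_involution G \<Theta>"
    and "maximal_abelian_subspace (cartan_p G \<Theta>) A"
    and "closed_weyl_chamber G A Ap"
    and "\<mu> = cartan_projection G \<Theta> Ap"
    and "euclidean_norm_on A N"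
    and "subgroup H (matgrp G)" and "closedin (top_of_set G) H"
    and "subgroup \<Gamma> (matgrp G)" and "discrete \<Gamma>"
    and "properly_discontinuous (matgrp \<Gamma>) (\<lambda>\<gamma> C. \<gamma> <#\<^bsub>matgrp G\<^esub> C) (coset_space G H)"
    and "cocompact (matgrp \<Gamma>) (\<lambda>\<gamma> C. \<gamma> <#\<^bsub>matgrp G\<^esub> C) (coset_space G H)"
  shows "finitely_generated (matgrp \<Gamma>) \<and> sharply_embedded N \<mu> H \<Gamma> \<and> sharp_action N \<mu> H \<Gamma>"
proof -

  \<comment> \<open>The Cartan involution as inverse adjoint\<close>
  have GL: "subgroup G (matgrp GL)" "closedin (top_of_set GL) G"
    using assms(1) by (auto simp: linear_reductive_def)
  note sG = subgroup_matgrp_GL[OF GL(1)]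
  obtain B :: "real^'n \<Rightarrow> real^'n \<Rightarrow> real" where B: "inner_product B"
    and \<Theta>: "\<And>g. g \<in> G \<Longrightarrow> \<Theta> g \<in> G" "\<And>g v w. g \<in> G \<Longrightarrow> B (g *v v) (\<Theta> g *v w) = B v w"
    using assms(3) unfolding cartan_involution_def by blast
  obtain S Si :: "real^'n^'n" where S: "S ** Si = mat 1" "Si ** S = mat 1"
    and BS: "\<And>v w. B v w = (S *v v) \<bullet> (S *v w)"
    by (rule inner_product_eq_inner[OF B]) (rule that)
  interpret adjoint S Si by unfold_locales (rule S)+
  have B_star: "B (M *v v) w = B v (star M *v w)" for M v w
  proof -
    have "S ** star M = transpose (cj M) ** S" by (simp add: star_def matrix_mul_assoc S)
    then have "B v (star M *v w) = (S *v v) \<bullet> (transpose (cj M) *v (S *v w))"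
      by (simp only: BS matrix_vector_mul_assoc)
    also have "\<dots> = (cj M *v (S *v v)) \<bullet> (S *v w)" by (rule inner_transpose_mult)
    also have "cj M *v (S *v v) = S *v (M *v v)" by (simp add: matrix_vector_mul_assoc cj_def)
    finally show ?thesis by (simp add: BS)
  qed
  have star_\<Theta>: "star g ** \<Theta> g = mat 1" if "g \<in> G" for g
  proof -
    have "(star g ** \<Theta> g) *v w = w" for w
    proof -
      let ?d = "(star g ** \<Theta> g) *v w - w"
      have "B v ((star g ** \<Theta> g) *v w) = B v w" for v
        using \<Theta>(2)[OF that, of v w] B_star[of g v "\<Theta> g *v w"] by (simp add: matrix_vector_mul_assoc)
      moreover have "B ?d ?d = B ?d ((star g ** \<Theta> g) *v w) - B ?d w"
        using B by (intro bilinear_rsub) (simp add: inner_product_def)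
      ultimately have "B ?d ?d = 0" by simp
      then show ?thesis using B unfolding inner_product_def by (metis less_irrefl right_minus_eq)
    qed
    then show ?thesis by (simp add: matrix_eq)
  qed
  have star_eq: "star g = matrix_inv (\<Theta> g)" if "g \<in> G" for g
    by (rule matrix_inv_eq[symmetric]) (use star_\<Theta>[OF that] matrix_left_right_inverse in blast)
  interpret lie_group S Si G
    by (intro lie_group.intro adjoint_axioms lie_group_axioms.intro) (use GL assms(2) star_eq \<Theta>(1) sG(4) in auto)
  have \<Theta>_eq: "\<Theta> g = g \<longleftrightarrow> star g ** g = mat 1" if "g \<in> G" for g
    using star_\<Theta>[OF that] matrix_inv_eq[of "star g" g] matrix_inv_eq[of "star g" "\<Theta> g"] by auto
  have K: "cartan_K G \<Theta> = KK"
    using \<Theta>_eq by (auto simp: cartan_K_def KK_def)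
  have p: "cartan_p G \<Theta> = pp"
  proof -
    have "(\<forall>t::real. \<Theta> (mexp (t *\<^sub>R X)) = mexp (- (t *\<^sub>R X))) \<longleftrightarrow> star X = X" if X: "X \<in> lie_algebra G" for X
    proof
      assume a: "\<forall>t::real. \<Theta> (mexp (t *\<^sub>R X)) = mexp (- (t *\<^sub>R X))"
      have e: "mexp (t *\<^sub>R star X) = mexp (t *\<^sub>R X)" for t
      proof -
        have "star (mexp (t *\<^sub>R X)) = matrix_inv (mexp (- (t *\<^sub>R X)))"
          using star_eq[OF lie_mexp_scaleR[OF X]] a by simp
        then show ?thesis by (simp add: matrix_inv_mexp star_mexp star_scaleR)
      qed
      \<comment> \<open>The generators are recovered from the one-parameter subgroups by difference
        quotients at 0.\<close>
      have "(\<lambda>k. (1 / inverse (real (Suc k))) *\<^sub>R (mexp (inverse (real (Suc k)) *\<^sub>R Y) - mat 1)) \<longlonglongrightarrow> Y"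
        for Y :: "real^'n^'n"
        by (rule mexp_difference_quotient[OF LIMSEQ_inverse_real_of_nat]) simp
      from LIMSEQ_unique[OF this[of "star X", unfolded e] this[of X]] show "star X = X" .
    next
      assume s: "star X = X"
      show "\<forall>t::real. \<Theta> (mexp (t *\<^sub>R X)) = mexp (- (t *\<^sub>R X))"
      proof
        fix t :: real
        let ?e = "mexp (t *\<^sub>R X)"
        have "?e ** \<Theta> ?e = mat 1" using star_\<Theta>[OF lie_mexp_scaleR[OF X]] by (simp add: star_mexp star_scaleR s)
        then show "\<Theta> ?e = mexp (- (t *\<^sub>R X))" using matrix_inv_eq[of ?e "\<Theta> ?e"] by (simp add: matrix_inv_mexp)
      qed
    qed
    then show ?thesis by (auto simp: cartan_p_def pp_def)
  qed

  \<comment> \<open>The Cartan projection and the comparison of norms\<close>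
  obtain C where C: "C \<in> components {X \<in> A. \<forall>\<alpha>. restricted_root G A \<alpha> \<longrightarrow> \<alpha> X \<noteq> 0}" "Ap = closure C"
    using assms(5) by (auto simp: closed_weyl_chamber_def)
  interpret weyl_chamber S Si G A C
    by unfold_locales (use assms(4) p C in auto)
  have \<mu>: "\<mu> g \<in> A \<and> (\<exists>k\<in>KK. \<exists>l\<in>KK. g = k ** mexp (\<mu> g) ** l)" if g: "g \<in> G" for g
  proof -
    obtain k l Z where Z: "k \<in> KK" "l \<in> KK" "Z \<in> closure C" "g = k ** mexp Z ** l"
      by (rule cartan_decomposition[OF g])
    have "\<mu> g = Z" unfolding assms(6) cartan_projection_def K C(2)
    proof (rule the_equality)
      show "Z \<in> closure C \<and> (\<exists>k\<in>KK. \<exists>k'\<in>KK. g = k ** mexp Z ** k')" using Z by blast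
      show "Z' = Z" if Z': "Z' \<in> closure C \<and> (\<exists>k\<in>KK. \<exists>k'\<in>KK. g = k ** mexp Z' ** k')" for Z'
      proof -
        obtain k' l' where "Z' \<in> closure C" "k' \<in> KK" "l' \<in> KK" "g = k' ** mexp Z' ** l'" using Z' by blast
        with Z show ?thesis using cartan_projection_unique[of Z Z' k l k' l'] by simp
      qed
    qed
    with Z closure_C_A show ?thesis by auto
  qed
  have H: "subgroup H (matgrp GL)" "H \<subseteq> G" and \<Gamma>: "subgroup \<Gamma> (matgrp GL)" "\<Gamma> \<subseteq> G"
    using subgroup_matgrp_trans[OF GL(1)] assms(8,10) subgroup.subset by fastforce+
  obtain P a b where P: "finite P" "P \<subseteq> \<Gamma>" and ab: "a > 0" "b > 0"
    and words: "\<And>\<gamma> h Z W k l k' l'. \<gamma> \<in> \<Gamma> \<Longrightarrow> h \<in> H \<Longrightarrow> Z \<in> A \<Longrightarrow> W \<in> A \<Longrightarrow> k \<in> KK \<Longrightarrow> l \<in> KK \<Longrightarrow> k' \<in> KK \<Longrightarrow> l' \<in> KK \<Longrightarrow>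
      \<gamma> = k ** mexp Z ** l \<Longrightarrow> h = k' ** mexp W ** l' \<Longrightarrow>
      \<exists>ws. set ws \<subseteq> P \<and> real (length ws) \<le> a * sqrt (ip (Z - W) (Z - W)) + b \<and> \<gamma> = foldr (**) ws (mat 1)"
    by (rule cartan_word_bound[OF \<Gamma> H assms(12,13)]) metis
  obtain B' where B': "inner_product B'" "\<And>X. X \<in> A \<Longrightarrow> N X = sqrt (B' X X)"
    using assms(7) by (auto simp: euclidean_norm_on_def)
  obtain c1 where c1: "c1 > 0" "\<And>X. sqrt (B' X X) \<le> c1 * norm X" "\<And>X. norm X \<le> c1 * sqrt (B' X X)"
    using inner_product_norm_equivalence[OF B'(1)] by blast
  obtain c2 where c2: "c2 > 0" "\<And>X. sqrt (ip X X) \<le> c2 * norm X" "\<And>X. norm X \<le> c2 * sqrt (ip X X)"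
    using inner_product_norm_equivalence[OF inner_product_ip] by blast
  \<comment> \<open>\<open>N\<close> and the norm of \<open>ip\<close> are compared on
    \<open>A\<close> through the Euclidean norm of matrices, so one constant serves in both
    directions.\<close>
  define c where "c = c1 * c2"
  have c: "c > 0" using c1 c2 by (simp add: c_def)
  have ipN: "sqrt (ip X X) \<le> c * N X" "N X \<le> c * sqrt (ip X X)" if "X \<in> A" for X
  proof -
    have "sqrt (ip X X) \<le> c2 * norm X" by (rule c2)
    also have "\<dots> \<le> c2 * (c1 * N X)" using c1(3)[of X] c2(1) B'(2)[OF that] by (intro mult_left_mono) auto
    finally show "sqrt (ip X X) \<le> c * N X" by (simp add: c_def mult_ac)
    have "N X \<le> c1 * norm X" using c1(2)[of X] B'(2)[OF that] by simp
    also have "\<dots> \<le> c1 * (c2 * sqrt (ip X X))" using c2(3)[of X] c1(1) by (intro mult_left_mono) auto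
    finally show "N X \<le> c * sqrt (ip X X)" by (simp add: c_def mult_ac)
  qed
  have near: "\<exists>ws. set ws \<subseteq> P \<and> real (length ws) \<le> a * c * N (\<mu> \<gamma> - \<mu> h) + b \<and> \<gamma> = foldr (**) ws (mat 1)"
    if \<gamma>h: "\<gamma> \<in> \<Gamma>" "h \<in> H" for \<gamma> h
  proof -
    have G: "\<gamma> \<in> G" "h \<in> G" using \<gamma>h \<Gamma> H by auto
    have A': "\<mu> \<gamma> \<in> A" "\<mu> h \<in> A" using \<mu> G by auto
    obtain k l where kl: "k \<in> KK" "l \<in> KK" "\<gamma> = k ** mexp (\<mu> \<gamma>) ** l" using \<mu>[OF G(1)] by blast
    obtain k' l' where kl': "k' \<in> KK" "l' \<in> KK" "h = k' ** mexp (\<mu> h) ** l'" using \<mu>[OF G(2)] by blast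
    obtain ws where ws: "set ws \<subseteq> P" "\<gamma> = foldr (**) ws (mat 1)"
      "real (length ws) \<le> a * sqrt (ip (\<mu> \<gamma> - \<mu> h) (\<mu> \<gamma> - \<mu> h)) + b"
      using words[OF \<gamma>h A' kl(1,2) kl'(1,2) kl(3) kl'(3)] by blast
    have "\<mu> \<gamma> - \<mu> h \<in> A" using A' A_subspace by (intro subspace_diff)
    from ipN(1)[OF this] have "a * sqrt (ip (\<mu> \<gamma> - \<mu> h) (\<mu> \<gamma> - \<mu> h)) \<le> a * (c * N (\<mu> \<gamma> - \<mu> h))"
      using ab by (intro mult_left_mono) auto
    with ws show ?thesis by (intro exI[of _ ws]) auto
  qed

  \<comment> \<open>Finite generation and the two sharpness bounds\<close>
  interpret \<Gamma>: group "matgrp \<Gamma>"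
    using subgroup.subgroup_is_group[OF \<Gamma>(1) group_GL] by (simp add: matgrp_def)
  have H1: "mat 1 \<in> H" using subgroup_matgrp_GL(2)[OF H(1)] .
  have "generating_set (matgrp \<Gamma>) P"
    unfolding generating_set_def
  proof (intro conjI equalityI)
    show "P \<subseteq> carrier (matgrp \<Gamma>)" using P by simp
    then show "generate (matgrp \<Gamma>) P \<subseteq> carrier (matgrp \<Gamma>)" by (rule \<Gamma>.generate_incl)
    show "carrier (matgrp \<Gamma>) \<subseteq> generate (matgrp \<Gamma>) P"
    proof
      fix \<gamma> assume "\<gamma> \<in> carrier (matgrp \<Gamma>)"
      then obtain ws where ws: "set ws \<subseteq> P" "\<gamma> = foldr (**) ws (mat 1)" using near[of \<gamma> "mat 1"] H1 by auto
      have "foldr (**) ws (mat 1) \<in> generate (matgrp \<Gamma>) P"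
        using ws(1)
      proof (induction ws)
        case Nil
        show ?case using generate.one[of "matgrp \<Gamma>" P] by simp
      next
        case (Cons w ws)
        then show ?case using generate.eng[OF generate.incl[of w P "matgrp \<Gamma>"]] by auto
      qed
      with ws(2) show "\<gamma> \<in> generate (matgrp \<Gamma>) P" by simp
    qed
  qed
  with P(1) have fg: "finitely_generated (matgrp \<Gamma>)" by (auto simp: finitely_generated_def)
  \<comment> \<open>Common to both bounds: \<open>f\<close> will be the word length for an arbitrary
    generating set, and then the norm of the Cartan projection. The infimum over \<open>H\<close> is
    harmless because \<open>near\<close> holds for every \<open>h\<close> with the same
    constants.\<close>
  have lower: "\<exists>c>0. \<exists>c'>0. \<forall>\<gamma>\<in>\<Gamma>. c * f \<gamma> - c' \<le> dist_to_set N (\<mu> \<gamma>) (\<mu> ` H)"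
    if M: "M > 0" "D \<ge> 0" and f: "\<And>ws. set ws \<subseteq> P \<Longrightarrow> f (foldr (**) ws (mat 1)) \<le> M * real (length ws) + D"
    for M D :: real and f :: "real^'n^'n \<Rightarrow> real"
  proof (intro exI conjI ballI)
    define e where "e = M * (a * c)"
    have e: "e > 0" using M ab c by (simp add: e_def)
    then show "1 / e > 0" "(M * b + D) / e > 0" using M ab by (auto intro!: divide_pos_pos add_pos_nonneg)
    fix \<gamma> assume \<gamma>: "\<gamma> \<in> \<Gamma>"
    show "1 / e * f \<gamma> - (M * b + D) / e \<le> dist_to_set N (\<mu> \<gamma>) (\<mu> ` H)"
      unfolding dist_to_set_def
    proof (rule cINF_greatest)
      show "\<mu> ` H \<noteq> {}" using H1 by auto
      fix Y assume "Y \<in> \<mu> ` H"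
      then obtain h where h: "h \<in> H" "Y = \<mu> h" by auto
      obtain ws where ws: "set ws \<subseteq> P" "\<gamma> = foldr (**) ws (mat 1)" "real (length ws) \<le> a * c * N (\<mu> \<gamma> - \<mu> h) + b"
        using near[OF \<gamma> h(1)] by blast
      have "f \<gamma> \<le> M * real (length ws) + D" using f[OF ws(1)] ws(2) by simp
      also have "M * real (length ws) \<le> M * (a * c * N (\<mu> \<gamma> - \<mu> h) + b)"
        using ws(3) M by (intro mult_left_mono) auto
      finally have "f \<gamma> - (M * b + D) \<le> e * N (\<mu> \<gamma> - Y)" by (simp add: e_def h(2) algebra_simps)
      then have "(f \<gamma> - (M * b + D)) / e \<le> N (\<mu> \<gamma> - Y)"
        using e by (simp add: pos_divide_le_eq mult.commute)
      then show "1 / e * f \<gamma> - (M * b + D) / e \<le> N (\<mu> \<gamma> - Y)" by (simp add: diff_divide_distrib)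
    qed
  qed
  have sharp_emb: "sharply_embedded N \<mu> H \<Gamma>"
    unfolding sharply_embedded_def
  proof (intro conjI fg allI impI)
    fix X assume X: "finite X \<and> generating_set (matgrp \<Gamma>) X"
    obtain l where l: "\<And>ps. set ps \<subseteq> P \<Longrightarrow> word_length (matgrp \<Gamma>) X (foldr (**) ps (mat 1)) \<le> l * length ps"
      using \<Gamma>.word_length_le_length[of X P] X P by auto
    show "\<exists>c>0. \<exists>c'>0. \<forall>\<gamma>\<in>\<Gamma>. c * real (word_length (matgrp \<Gamma>) X \<gamma>) - c' \<le> dist_to_set N (\<mu> \<gamma>) (\<mu> ` H)"
    proof (rule lower)
      \<comment> \<open>\<open>Suc l\<close> because \<open>lower\<close> asks for a positive factor
        and \<open>l\<close> may be 0.\<close>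
      show "real (Suc l) > 0" "(0::real) \<le> 0" by auto
      fix ws assume "set ws \<subseteq> P"
      from l[OF this] have "word_length (matgrp \<Gamma>) X (foldr (**) ws (mat 1)) \<le> Suc l * length ws" by simp
      then show "real (word_length (matgrp \<Gamma>) X (foldr (**) ws (mat 1))) \<le> real (Suc l) * real (length ws) + 0"
        by (simp only: of_nat_mult[symmetric] of_nat_le_iff add_0_right)
    qed
  qed
  have "sharp_action N \<mu> H \<Gamma>"
    unfolding sharp_action_def
  proof -
    have PG: "P \<subseteq> G" using P \<Gamma> by auto
    from \<rho>_word_le[OF P(1) this] obtain a' b' where ab': "a' > 0" "b' > 0"
      and \<rho>w: "\<And>ws. set ws \<subseteq> P \<Longrightarrow> \<rho> (foldr (**) ws (mat 1)) \<le> a' * real (length ws) + b'" by metis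
    define m where "m = c * real CARD('n)"
    have m: "m > 0" using c by (simp add: m_def)
    have N\<rho>: "N (\<mu> g) \<le> m * \<rho> g" if g: "g \<in> G" for g
    proof -
      obtain k l where A': "\<mu> g \<in> A" and kl: "k \<in> KK" "l \<in> KK" "g = k ** mexp (\<mu> g) ** l"
        using \<mu>[OF g] by blast
      have "N (\<mu> g) \<le> c * sqrt (ip (\<mu> g) (\<mu> g))" by (rule ipN(2)[OF A'])
      also have "\<dots> \<le> c * (real CARD('n) * \<rho> g)"
        using cartan_le_\<rho>[OF A_star[OF A'] kl(1,2)] kl(3) c by (intro mult_left_mono) auto
      finally show ?thesis by (simp add: m_def)
    qed
    show "\<exists>c>0. \<exists>c'>0. \<forall>\<gamma>\<in>\<Gamma>. c * N (\<mu> \<gamma>) - c' \<le> dist_to_set N (\<mu> \<gamma>) (\<mu> ` H)"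
    proof (rule lower)
      show "m * a' > 0" "m * b' \<ge> 0" using m ab' by auto
      fix ws assume ws: "set ws \<subseteq> P"
      have "foldr (**) ws (mat 1) \<in> G" using ws PG by (induction ws) (auto intro: G_mult sG(2))
      then have "N (\<mu> (foldr (**) ws (mat 1))) \<le> m * \<rho> (foldr (**) ws (mat 1))" by (rule N\<rho>)
      also have "\<dots> \<le> m * (a' * real (length ws) + b')" using \<rho>w[OF ws] m by (intro mult_left_mono) auto
      finally show "N (\<mu> (foldr (**) ws (mat 1))) \<le> m * a' * real (length ws) + m * b'"
        by (simp add: algebra_simps)
    qed
  qed
  with fg sharp_emb show ?thesis by blast
qed

end
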